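(* Let $\Phi$ be an arbitrary irreducible root system and let $\Lambda$ be a lattice with $Q(\Phi)\leq\Lambda\leq P(\Phi)$. Then for any commutative ring $R$ the simplicial groups $\mathrm{E}_\Lambda(\Phi,R[\Delta^\bullet])$ and $\mathrm{St}(\Phi,R[\Delta^\bullet])$ are connected. If, moreover, $\Phi$ has rank at least $2$, then the simplicial group $\mathrm{St}(\Phi,R[\Delta^\bullet])$ is simply-connected.
   Context: For an irreducible (reduced) root system $\Phi$ of rank $\geq 2$ and a commutative ring $R$, the Steinberg group $\mathrm{St}(\Phi,R)$ is the group with generators $x_\alpha(\xi)$ ($\alpha\in\Phi$, $\xi\in R$) and defining relations $x_\alpha(a)x_\alpha(b)=x_\alpha(a+b)$ and the Chevalley commutator formulas $[x_\alpha(a),x_\beta(b)]=\prod x_{i\alpha+j\beta}(N_{\alpha\beta ij}\,a^ib^j)$ for $\alpha+\beta\neq 0$, the product being over all $i,j\geq 1$ with $i\alpha+j\beta\in\Phi$ (in a fixed order), where $N_{\alpha\beta ij}$ are the integral structure constants of the Chevalley group of type $\Phi$. For $\Phi$ of rank $1$ the usual convention is used: the commutator formulas are replaced by $w_\alpha(u)x_\alpha(\xi)w_\alpha(u)^{-1}=x_{-\alpha}(-u^{-2}\xi)$ for $u\in R^\times$, where $w_\alpha(u)=x_\alpha(u)x_{-\alpha}(-u^{-1})x_\alpha(u)$. $Q(\Phi)$ and $P(\Phi)$ are the root and weight lattices; $\mathrm{G}_\Lambda(\Phi,-)$ is the Chevalley--Demazure group scheme of type $\Phi$ with weight lattice $\Lambda$,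 and $\mathrm{E}_\Lambda(\Phi,R)\leq\mathrm{G}_\Lambda(\Phi,R)$ is the subgroup generated by the elementary root unipotents $t_\alpha(\xi)$, $\alpha\in\Phi$, $\xi\in R$. The standard simplicial ring $R[\Delta^\bullet]$ is given by $R[\Delta^n]=R[t_0,\ldots,t_n]/\langle\sum_{i=0}^n t_i-1\rangle$ with faces $d_i(t_j)=t_j$ for $j<i$, $d_i(t_i)=0$, $d_i(t_j)=t_{j-1}$ for $j>i$, and degeneracies $s_i(t_j)=t_j$ for $j<i$, $s_i(t_i)=t_i+t_{i+1}$, $s_i(t_j)=t_{j+1}$ for $j>i$. Applying a group-valued functor degreewise gives a simplicial group. Connected means $\pi_0=1$; simply-connected means $\pi_0=1$ and $\pi_1=1$. *)

theory Defs
  imports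
    "HOL-Analysis.Analysis"
    "HOL-Algebra.Algebra"
    "HOL-Algebra.Indexed_Polynomials"
    "Jordan_Normal_Form.Char_Poly"
begin

section \<open>Root systems and lattices\<close>

text \<open>The pairing of \<open>x\<close> with the coroot of \<open>\<alpha>\<close>.\<close>

definition coroot_pairing :: "'v::euclidean_space \<Rightarrow> 'v \<Rightarrow> real" where
  "coroot_pairing x \<alpha> = 2 * inner x \<alpha> / inner \<alpha> \<alpha>"

definition root_system :: "'v::euclidean_space set \<Rightarrow> bool" where
  "root_system \<Phi> \<longleftrightarrow>
     finite \<Phi> \<and> span \<Phi> = UNIV \<and> 0 \<notin> \<Phi> \<and>
     (\<forall>\<alpha>\<in>\<Phi>. \<forall>\<beta>\<in>\<Phi>. \<beta> - coroot_pairing \<beta> \<alpha> *\<^sub>R \<alpha> \<in> \<Phi>) \<and>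
     (\<forall>\<alpha>\<in>\<Phi>. \<forall>\<beta>\<in>\<Phi>. coroot_pairing \<beta> \<alpha> \<in> \<int>) \<and>
     (\<forall>\<alpha>\<in>\<Phi>. \<forall>c. c *\<^sub>R \<alpha> \<in> \<Phi> \<longrightarrow> c = 1 \<or> c = -1)"

definition irreducible_root_system :: "'v::euclidean_space set \<Rightarrow> bool" where
  "irreducible_root_system \<Phi> \<longleftrightarrow>
     root_system \<Phi> \<and> \<Phi> \<noteq> {} \<and>
     \<not> (\<exists>\<Phi>\<^sub>1 \<Phi>\<^sub>2. \<Phi>\<^sub>1 \<noteq> {} \<and> \<Phi>\<^sub>2 \<noteq> {} \<and> \<Phi>\<^sub>1 \<union> \<Phi>\<^sub>2 = \<Phi> \<and>
          (\<forall>\<alpha>\<in>\<Phi>\<^sub>1. \<forall>\<beta>\<in>\<Phi>\<^sub>2. inner \<alpha> \<beta> = 0))"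

definition root_rank :: "'v::euclidean_space set \<Rightarrow> nat" where
  "root_rank \<Phi> = dim \<Phi>"

definition additive_subgroup_of_space :: "'v::euclidean_space set \<Rightarrow> bool" where
  "additive_subgroup_of_space L \<longleftrightarrow> 0 \<in> L \<and> (\<forall>x\<in>L. \<forall>y\<in>L. x - y \<in> L)"

definition int_span :: "'v::euclidean_space set \<Rightarrow> 'v set" where
  "int_span S = additive_subgroup_of_space hull S"

definition root_lattice :: "'v::euclidean_space set \<Rightarrow> 'v set" where
  "root_lattice \<Phi> = int_span \<Phi>"

definition weight_lattice :: "'v::euclidean_space set \<Rightarrow> 'v set" where
  "weight_lattice \<Phi> = {x. \<forall>\<alpha>\<in>\<Phi>. coroot_pairing x \<alpha> \<in> \<int>}"

section \<open>Polynomial rings and matrix groups over ring records\<close>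

text \<open>The library's indexed polynomials (functions from monomials, i.e. multisets of
  variables, to coefficients) form a ring under the convolution product.\<close>

definition mpoly_ring :: "('a, 'm) ring_scheme \<Rightarrow> 'x set \<Rightarrow> ('x multiset \<Rightarrow> 'a) ring" where
  "mpoly_ring R S =
     \<lparr> carrier = ring.indexed_pset R S (carrier R),
       monoid.mult = (\<lambda>P Q m. \<Oplus>\<^bsub>R\<^esub>l\<in>{l. l \<subseteq># m}. P l \<otimes>\<^bsub>R\<^esub> Q (m - l)),
       one = ring.indexed_const R \<one>\<^bsub>R\<^esub>,
       ring.zero = ring.indexed_const R \<zero>\<^bsub>R\<^esub>,
       add = ring.indexed_padd R \<rparr>"

text \<open>Evaluation at \<open>x \<mapsto> v x\<close> in \<open>A\<close>, coefficients being sent to \<open>A\<close> by \<open>\<phi>\<close>.\<close>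

definition mpoly_eval ::
  "('a, 'm) ring_scheme \<Rightarrow> ('b, 'n) ring_scheme \<Rightarrow> ('a \<Rightarrow> 'b) \<Rightarrow> ('x \<Rightarrow> 'b)
     \<Rightarrow> ('x multiset \<Rightarrow> 'a) \<Rightarrow> 'b" where
  "mpoly_eval R A \<phi> v P =
     (\<Oplus>\<^bsub>A\<^esub>m\<in>{m. P m \<noteq> \<zero>\<^bsub>R\<^esub>}.
        \<phi> (P m) \<otimes>\<^bsub>A\<^esub> (\<Otimes>\<^bsub>A\<^esub>x\<in>set_mset m. v x [^]\<^bsub>A\<^esub> count m x))"

definition matrix_monoid :: "('r, 'm) ring_scheme \<Rightarrow> nat \<Rightarrow> 'r mat monoid" where
  "matrix_monoid A n =
     \<lparr> carrier = {M \<in> carrier_mat n n. elements_mat M \<subseteq> carrier A},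
       mult = (\<lambda>M N. mat n n (\<lambda>(i, j). \<Oplus>\<^bsub>A\<^esub>k\<in>{..<n}. M $$ (i, k) \<otimes>\<^bsub>A\<^esub> N $$ (k, j))),
       one = mat n n (\<lambda>(i, j). if i = j then \<one>\<^bsub>A\<^esub> else \<zero>\<^bsub>A\<^esub>) \<rparr>"

definition general_linear_group :: "('r, 'm) ring_scheme \<Rightarrow> nat \<Rightarrow> 'r mat monoid" where
  "general_linear_group A n = units_of (matrix_monoid A n)"

section \<open>Chevalley--Demazure groups\<close>

definition lie_bracket :: "int mat \<Rightarrow> int mat \<Rightarrow> int mat" where
  "lie_bracket A B = A * B - B * A"

text \<open>\<open>coroot_mat e \<alpha>\<close> is the matrix of \<open>h\<^sub>\<alpha> = [e\<^sub>\<alpha>, e\<^sub>-\<^sub>\<alpha>]\<close>.\<close>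

definition coroot_mat :: "('v::euclidean_space \<Rightarrow> int mat) \<Rightarrow> 'v \<Rightarrow> int mat" where
  "coroot_mat e \<alpha> = lie_bracket (e \<alpha>) (e (- \<alpha>))"

definition string_length :: "'v::euclidean_space set \<Rightarrow> 'v \<Rightarrow> 'v \<Rightarrow> nat" where
  "string_length \<Phi> \<alpha> \<beta> = Max {p. \<beta> - real p *\<^sub>R \<alpha> \<in> \<Phi>}"

text \<open>A weight is a linear functional on the Cartan subalgebra spanned by the \<open>h\<^sub>\<alpha>\<close>; it is
  identified with the vector \<open>\<mu>\<close> whose pairings with the coroots are its values on the
  \<open>h\<^sub>\<alpha>\<close>.\<close>

definition rep_weights ::
  "'v::euclidean_space set \<Rightarrow> nat \<Rightarrow> ('v \<Rightarrow> int mat) \<Rightarrow> 'v set" where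
  "rep_weights \<Phi> n e =
     {\<mu>. \<exists>v. \<forall>\<alpha>\<in>\<Phi>.
        eigenvector (map_mat complex_of_int (coroot_mat e \<alpha>)) v
          (complex_of_real (coroot_pairing \<mu> \<alpha>))}"

text \<open>The input of Chevalley's construction: a representation \<open>V\<close> of the complex simple Lie
  algebra of type \<open>\<Phi>\<close> whose weights generate \<open>\<Lambda>\<close>, with an admissible \<open>\<int>\<close>-form.  It is given
  by the matrices \<open>e \<alpha>\<close> of the root vectors of a Chevalley basis in a \<open>\<int>\<close>-basis of the
  admissible lattice. As \<open>V\<close> is nontrivial it is faithful, so the Lie algebra is recovered as
  the span of the \<open>e \<alpha>\<close> and \<open>coroot_mat e \<alpha>\<close>, and the bracket conditions below are the
  relations of a Chevalley basis.  The last conjunct is admissibility: the lattice is stable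
  under all divided powers \<open>e\<^sub>\<alpha>\<^sup>k / k!\<close>.\<close>

definition chevalley_representation ::
  "'v::euclidean_space set \<Rightarrow> 'v set \<Rightarrow> nat \<Rightarrow> ('v \<Rightarrow> int mat) \<Rightarrow> bool" where
  "chevalley_representation \<Phi> \<Lambda> n e \<longleftrightarrow>
     (\<forall>\<alpha>\<in>\<Phi>. e \<alpha> \<in> carrier_mat n n) \<and>
     (\<forall>\<alpha>\<in>\<Phi>. \<forall>\<beta>\<in>\<Phi>. lie_bracket (coroot_mat e \<alpha>) (coroot_mat e \<beta>) = 0\<^sub>m n n) \<and>
     (\<forall>\<alpha>\<in>\<Phi>. \<forall>\<beta>\<in>\<Phi>.
        map_mat real_of_int (lie_bracket (coroot_mat e \<alpha>) (e \<beta>)) =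
        coroot_pairing \<beta> \<alpha> \<cdot>\<^sub>m map_mat real_of_int (e \<beta>)) \<and>
     (\<forall>\<alpha>\<in>\<Phi>. \<forall>\<beta>\<in>\<Phi>. \<alpha> + \<beta> \<in> \<Phi> \<longrightarrow>
        (\<exists>c\<in>{1, -1}. lie_bracket (e \<alpha>) (e \<beta>) =
           (c * (int (string_length \<Phi> \<alpha> \<beta>) + 1)) \<cdot>\<^sub>m e (\<alpha> + \<beta>))) \<and>
     (\<forall>\<alpha>\<in>\<Phi>. \<forall>\<beta>\<in>\<Phi>. \<alpha> + \<beta> \<notin> \<Phi> \<and> \<alpha> + \<beta> \<noteq> 0 \<longrightarrow>
        lie_bracket (e \<alpha>) (e \<beta>) = 0\<^sub>m n n) \<and>
     int_span (rep_weights \<Phi> n e) = \<Lambda> \<and>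
     (\<forall>\<alpha>\<in>\<Phi>. \<forall>k. \<forall>i<n. \<forall>j<n. fact k dvd (e \<alpha> ^\<^sub>m k) $$ (i, j))"

text \<open>The root unipotent \<open>t\<^sub>\<alpha>(\<xi>) = \<Sum>\<^sub>k \<xi>\<^sup>k e\<^sub>\<alpha>\<^sup>k / k!\<close> acting on \<open>V\<^sub>\<int> \<otimes> A\<close>. The division is exact
  by admissibility, and the sum is finite because \<open>e\<^sub>\<alpha>\<close> is nilpotent.\<close>

definition root_unipotent ::
  "nat \<Rightarrow> ('v \<Rightarrow> int mat) \<Rightarrow> ('r, 'm) ring_scheme \<Rightarrow> 'v \<Rightarrow> 'r \<Rightarrow> 'r mat" where
  "root_unipotent n e A \<alpha> \<xi> =
     mat n n (\<lambda>(i, j). \<Oplus>\<^bsub>A\<^esub>k\<in>{k. e \<alpha> ^\<^sub>m k \<noteq> 0\<^sub>m n n}.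
       [((e \<alpha> ^\<^sub>m k) $$ (i, j) div fact k)] \<cdot>\<^bsub>A\<^esub> (\<xi> [^]\<^bsub>A\<^esub> k))"

definition complex_ring :: "complex ring" where
  "complex_ring = \<lparr> carrier = UNIV, monoid.mult = (*), one = 1, ring.zero = 0, add = (+) \<rparr>"

definition complex_chevalley_group ::
  "'v::euclidean_space set \<Rightarrow> nat \<Rightarrow> ('v \<Rightarrow> int mat) \<Rightarrow> complex mat monoid" where
  "complex_chevalley_group \<Phi> n e =
     subgroup_generated (general_linear_group complex_ring n)
       {root_unipotent n e complex_ring \<alpha> \<xi> | \<alpha> \<xi>. \<alpha> \<in> \<Phi>}"

text \<open>Value at a matrix \<open>M\<close> over \<open>A\<close> of an integral polynomial in the matrix entries.\<close>

definition matrix_poly_value ::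
  "('r, 'm) ring_scheme \<Rightarrow> ((nat \<times> nat) multiset \<Rightarrow> int) \<Rightarrow> 'r mat \<Rightarrow> 'r" where
  "matrix_poly_value A F M =
     mpoly_eval int_ring A (\<lambda>k. [k] \<cdot>\<^bsub>A\<^esub> \<one>\<^bsub>A\<^esub>) (\<lambda>ij. M $$ ij) F"

text \<open>The \<open>A\<close>-points of the Chevalley--Demazure group scheme: the closed subscheme of \<open>GL\<^sub>n\<close>
  over \<open>\<int>\<close> cut out by all integral polynomials that vanish on the complex Chevalley group.\<close>

definition chevalley_demazure_group ::
  "'v::euclidean_space set \<Rightarrow> nat \<Rightarrow> ('v \<Rightarrow> int mat) \<Rightarrow> ('r, 'm) ring_scheme \<Rightarrow> 'r mat monoid" where
  "chevalley_demazure_group \<Phi> n e A =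
     (general_linear_group A n)
       \<lparr> carrier := {M \<in> carrier (general_linear_group A n).
           \<forall>F\<in>carrier (mpoly_ring int_ring ({..<n} \<times> {..<n})).
             (\<forall>C\<in>carrier (complex_chevalley_group \<Phi> n e).
                matrix_poly_value complex_ring F C = 0) \<longrightarrow>
             matrix_poly_value A F M = \<zero>\<^bsub>A\<^esub>} \<rparr>"

definition elementary_group ::
  "'v::euclidean_space set \<Rightarrow> nat \<Rightarrow> ('v \<Rightarrow> int mat) \<Rightarrow> ('r, 'm) ring_scheme \<Rightarrow> 'r mat monoid" where
  "elementary_group \<Phi> n e A =
     subgroup_generated (chevalley_demazure_group \<Phi> n e A)
       {root_unipotent n e A \<alpha> \<xi> | \<alpha> \<xi>. \<alpha> \<in> \<Phi> \<and> \<xi> \<in> carrier A}"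

text \<open>Action of the functor on a ring homomorphism \<open>f : A \<rightarrow> B\<close> (source and target are
  irrelevant here, but make the type uniform with \<open>steinberg_map\<close> below).\<close>

definition elementary_map ::
  "('r, 'm) ring_scheme \<Rightarrow> ('s, 'n) ring_scheme \<Rightarrow> ('r \<Rightarrow> 's) \<Rightarrow> 'r mat \<Rightarrow> 's mat" where
  "elementary_map A B f M = map_mat f M"

section \<open>Structure constants\<close>

definition root_pairs :: "'v::euclidean_space set \<Rightarrow> 'v \<Rightarrow> 'v \<Rightarrow> (nat \<times> nat) set" where
  "root_pairs \<Phi> \<alpha> \<beta> = {(i, j). 1 \<le> i \<and> 1 \<le> j \<and> real i *\<^sub>R \<alpha> + real j *\<^sub>R \<beta> \<in> \<Phi>}"

text \<open>A choice of order for the factors of each commutator formula.\<close>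

definition commutator_order ::
  "'v::euclidean_space set \<Rightarrow> ('v \<Rightarrow> 'v \<Rightarrow> (nat \<times> nat) list) \<Rightarrow> bool" where
  "commutator_order \<Phi> ord \<longleftrightarrow>
     (\<forall>\<alpha>\<in>\<Phi>. \<forall>\<beta>\<in>\<Phi>. \<alpha> + \<beta> \<noteq> 0 \<longrightarrow>
        distinct (ord \<alpha> \<beta>) \<and> set (ord \<alpha> \<beta>) = root_pairs \<Phi> \<alpha> \<beta>)"

text \<open>The integers \<open>N \<alpha> \<beta> i j\<close> are those for which the Chevalley commutator formula, with
  \<open>[x, y] = x y x\<^sup>-\<^sup>1 y\<^sup>-\<^sup>1\<close> and the factors in the order \<open>ord\<close>, holds in the complex Chevalley
  group; this determines them for all \<open>(i, j) \<in> root_pairs \<Phi> \<alpha> \<beta>\<close>.\<close>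

definition structure_constants ::
  "'v::euclidean_space set \<Rightarrow> nat \<Rightarrow> ('v \<Rightarrow> int mat) \<Rightarrow> ('v \<Rightarrow> 'v \<Rightarrow> (nat \<times> nat) list)
     \<Rightarrow> ('v \<Rightarrow> 'v \<Rightarrow> nat \<Rightarrow> nat \<Rightarrow> int) \<Rightarrow> bool" where
  "structure_constants \<Phi> n e ord N \<longleftrightarrow>
     (let G = complex_chevalley_group \<Phi> n e; t = root_unipotent n e complex_ring in
      \<forall>\<alpha>\<in>\<Phi>. \<forall>\<beta>\<in>\<Phi>. \<alpha> + \<beta> \<noteq> 0 \<longrightarrow> (\<forall>a b.
        t \<alpha> a \<otimes>\<^bsub>G\<^esub> t \<beta> b \<otimes>\<^bsub>G\<^esub> inv\<^bsub>G\<^esub> (t \<alpha> a) \<otimes>\<^bsub>G\<^esub> inv\<^bsub>G\<^esub> (t \<beta> b) =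
        foldr (\<lambda>(i, j) g. t (real i *\<^sub>R \<alpha> + real j *\<^sub>R \<beta>) (of_int (N \<alpha> \<beta> i j) * a ^ i * b ^ j) \<otimes>\<^bsub>G\<^esub> g)
          (ord \<alpha> \<beta>) \<one>\<^bsub>G\<^esub>))"

section \<open>Groups given by generators and relations\<close>

text \<open>A letter \<open>(True, x)\<close> stands for the generator \<open>x\<close> and \<open>(False, x)\<close> for its inverse.\<close>

type_synonym 'x group_word = "(bool \<times> 'x) list"

definition inverse_word :: "'x group_word \<Rightarrow> 'x group_word" where
  "inverse_word w = rev (map (\<lambda>(s, x). (\<not> s, x)) w)"

inductive presentation_eq ::
  "'x set \<Rightarrow> ('x group_word \<times> 'x group_word) set \<Rightarrow> 'x group_word \<Rightarrow> 'x group_word \<Rightarrow> bool"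
  for S rels where
  relation: "(u, v) \<in> rels \<Longrightarrow> presentation_eq S rels u v"
| cancel: "x \<in> S \<Longrightarrow> presentation_eq S rels [(s, x), (\<not> s, x)] []"
| refl: "w \<in> lists (UNIV \<times> S) \<Longrightarrow> presentation_eq S rels w w"
| sym: "presentation_eq S rels u v \<Longrightarrow> presentation_eq S rels v u"
| trans: "presentation_eq S rels u v \<Longrightarrow> presentation_eq S rels v w \<Longrightarrow> presentation_eq S rels u w"
| append: "presentation_eq S rels u u' \<Longrightarrow> presentation_eq S rels v v' \<Longrightarrow>
    presentation_eq S rels (u @ v) (u' @ v')"

definition presentation_class ::
  "'x set \<Rightarrow> ('x group_word \<times> 'x group_word) set \<Rightarrow> 'x group_word \<Rightarrow> 'x group_word set" where
  "presentation_class S rels w = {v. presentation_eq S rels w v}"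

definition presented_group ::
  "'x set \<Rightarrow> ('x group_word \<times> 'x group_word) set \<Rightarrow> 'x group_word set monoid" where
  "presented_group S rels =
     \<lparr> carrier = presentation_class S rels ` lists (UNIV \<times> S),
       mult = (\<lambda>U V. \<Union>u\<in>U. \<Union>v\<in>V. presentation_class S rels (u @ v)),
       one = presentation_class S rels [] \<rparr>"

section \<open>Steinberg groups\<close>

definition steinberg_generators ::
  "'v set \<Rightarrow> ('r, 'm) ring_scheme \<Rightarrow> ('v \<times> 'r) set" where
  "steinberg_generators \<Phi> A = \<Phi> \<times> carrier A"

definition x_letter :: "'v \<Rightarrow> 'r \<Rightarrow> bool \<times> 'v \<times> 'r" where
  "x_letter \<alpha> \<xi> = (True, \<alpha>, \<xi>)"

definition additivity_relations ::
  "'v set \<Rightarrow> ('r, 'm) ring_scheme \<Rightarrow> (('v \<times> 'r) group_word \<times> ('v \<times> 'r) group_word) set" where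
  "additivity_relations \<Phi> A =
     {([x_letter \<alpha> a, x_letter \<alpha> b], [x_letter \<alpha> (a \<oplus>\<^bsub>A\<^esub> b)]) | \<alpha> a b.
        \<alpha> \<in> \<Phi> \<and> a \<in> carrier A \<and> b \<in> carrier A}"

definition commutator_relations ::
  "'v::euclidean_space set \<Rightarrow> ('v \<Rightarrow> 'v \<Rightarrow> (nat \<times> nat) list) \<Rightarrow> ('v \<Rightarrow> 'v \<Rightarrow> nat \<Rightarrow> nat \<Rightarrow> int)
     \<Rightarrow> ('r, 'm) ring_scheme \<Rightarrow> (('v \<times> 'r) group_word \<times> ('v \<times> 'r) group_word) set" where
  "commutator_relations \<Phi> ord N A =
     {([x_letter \<alpha> a, x_letter \<beta> b] @ inverse_word [x_letter \<alpha> a] @ inverse_word [x_letter \<beta> b],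
       map (\<lambda>(i, j). x_letter (real i *\<^sub>R \<alpha> + real j *\<^sub>R \<beta>)
              ([N \<alpha> \<beta> i j] \<cdot>\<^bsub>A\<^esub> (a [^]\<^bsub>A\<^esub> i \<otimes>\<^bsub>A\<^esub> b [^]\<^bsub>A\<^esub> j))) (ord \<alpha> \<beta>)) | \<alpha> \<beta> a b.
        \<alpha> \<in> \<Phi> \<and> \<beta> \<in> \<Phi> \<and> \<alpha> + \<beta> \<noteq> 0 \<and> a \<in> carrier A \<and> b \<in> carrier A}"

definition w_word ::
  "('r, 'm) ring_scheme \<Rightarrow> 'v::euclidean_space \<Rightarrow> 'r \<Rightarrow> ('v \<times> 'r) group_word" where
  "w_word A \<alpha> u =
     [x_letter \<alpha> u, x_letter (- \<alpha>) (\<ominus>\<^bsub>A\<^esub> (inv\<^bsub>A\<^esub> u)), x_letter \<alpha> u]"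

definition weyl_relations ::
  "'v::euclidean_space set \<Rightarrow> ('r, 'm) ring_scheme
     \<Rightarrow> (('v \<times> 'r) group_word \<times> ('v \<times> 'r) group_word) set" where
  "weyl_relations \<Phi> A =
     {(w_word A \<alpha> u @ [x_letter \<alpha> \<xi>] @ inverse_word (w_word A \<alpha> u),
       [x_letter (- \<alpha>) (\<ominus>\<^bsub>A\<^esub> ((inv\<^bsub>A\<^esub> u) [^]\<^bsub>A\<^esub> (2::nat) \<otimes>\<^bsub>A\<^esub> \<xi>))]) | \<alpha> u \<xi>.
        \<alpha> \<in> \<Phi> \<and> u \<in> Units A \<and> \<xi> \<in> carrier A}"

definition steinberg_relations ::
  "'v::euclidean_space set \<Rightarrow> ('v \<Rightarrow> 'v \<Rightarrow> (nat \<times> nat) list) \<Rightarrow> ('v \<Rightarrow> 'v \<Rightarrow> nat \<Rightarrow> nat \<Rightarrow> int)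
     \<Rightarrow> ('r, 'm) ring_scheme \<Rightarrow> (('v \<times> 'r) group_word \<times> ('v \<times> 'r) group_word) set" where
  "steinberg_relations \<Phi> ord N A =
     additivity_relations \<Phi> A \<union>
     (if root_rank \<Phi> = 1 then weyl_relations \<Phi> A else commutator_relations \<Phi> ord N A)"

definition steinberg_group ::
  "'v::euclidean_space set \<Rightarrow> ('v \<Rightarrow> 'v \<Rightarrow> (nat \<times> nat) list) \<Rightarrow> ('v \<Rightarrow> 'v \<Rightarrow> nat \<Rightarrow> nat \<Rightarrow> int)
     \<Rightarrow> ('r, 'm) ring_scheme \<Rightarrow> ('v \<times> 'r) group_word set monoid" where
  "steinberg_group \<Phi> ord N A =
     presented_group (steinberg_generators \<Phi> A) (steinberg_relations \<Phi> ord N A)"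

text \<open>The homomorphism \<open>St(\<Phi>, A) \<rightarrow> St(\<Phi>, B)\<close>, \<open>x\<^sub>\<alpha>(\<xi>) \<mapsto> x\<^sub>\<alpha>(f \<xi>)\<close>.\<close>

definition steinberg_map ::
  "'v::euclidean_space set \<Rightarrow> ('v \<Rightarrow> 'v \<Rightarrow> (nat \<times> nat) list) \<Rightarrow> ('v \<Rightarrow> 'v \<Rightarrow> nat \<Rightarrow> nat \<Rightarrow> int)
     \<Rightarrow> ('r, 'm) ring_scheme \<Rightarrow> ('s, 'n) ring_scheme \<Rightarrow> ('r \<Rightarrow> 's)
     \<Rightarrow> ('v \<times> 'r) group_word set \<Rightarrow> ('v \<times> 's) group_word set" where
  "steinberg_map \<Phi> ord N A B f U =
     (\<Union>w\<in>U. presentation_class (steinberg_generators \<Phi> B) (steinberg_relations \<Phi> ord N B)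
        (map (\<lambda>(s, \<alpha>, \<xi>). (s, \<alpha>, f \<xi>)) w))"

section \<open>Simplicial groups\<close>

text \<open>Simplicial objects in rings or groups: \<open>face S n i\<close> is \<open>d\<^sub>i\<close> from level \<open>n\<close> to level
  \<open>n - 1\<close> (used for \<open>n \<ge> 1\<close>, \<open>i \<le> n\<close>), and \<open>degen S n i\<close> is \<open>s\<^sub>i\<close> from level \<open>n\<close> to level
  \<open>n + 1\<close>.\<close>

record ('o, 'x) simplicial =
  level :: "nat \<Rightarrow> 'o"
  face :: "nat \<Rightarrow> nat \<Rightarrow> 'x \<Rightarrow> 'x"
  degen :: "nat \<Rightarrow> nat \<Rightarrow> 'x \<Rightarrow> 'x"

text \<open>Degreewise application of a functor given by \<open>F\<close> on rings and by \<open>F\<^sub>m A B f\<close> on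
  homomorphisms \<open>f : A \<rightarrow> B\<close>.\<close>

definition apply_functor ::
  "('r ring \<Rightarrow> 'g monoid) \<Rightarrow> ('r ring \<Rightarrow> 'r ring \<Rightarrow> ('r \<Rightarrow> 'r) \<Rightarrow> 'g \<Rightarrow> 'g)
     \<Rightarrow> ('r ring, 'r) simplicial \<Rightarrow> ('g monoid, 'g) simplicial" where
  "apply_functor F F\<^sub>m S =
     \<lparr> level = (\<lambda>n. F (level S n)),
       face = (\<lambda>n i. F\<^sub>m (level S n) (level S (n - 1)) (face S n i)),
       degen = (\<lambda>n i. F\<^sub>m (level S n) (level S (n + 1)) (degen S n i)) \<rparr>"

text \<open>The combinatorial homotopy groups of a Kan complex, for the underlying simplicial set of a
  simplicial group (always Kan), at the base vertex \<open>1\<close>: classes of \<open>n\<close>-simplices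
  with trivial boundary, \<open>x\<close> and \<open>y\<close> being homotopic if some \<open>(n+1)\<close>-simplex \<open>z\<close> has
  \<open>d\<^sub>i z = 1\<close> for \<open>i < n\<close>, \<open>d\<^sub>n z = x\<close> and \<open>d\<^sub>n\<^sub>+\<^sub>1 z = y\<close>.\<close>

definition spheres :: "('g monoid, 'g) simplicial \<Rightarrow> nat \<Rightarrow> 'g set" where
  "spheres S n =
     {x \<in> carrier (level S n). n > 0 \<longrightarrow> (\<forall>i\<le>n. face S n i x = \<one>\<^bsub>level S (n - 1)\<^esub>)}"

definition homotopy_rel :: "('g monoid, 'g) simplicial \<Rightarrow> nat \<Rightarrow> ('g \<times> 'g) set" where
  "homotopy_rel S n =
     {(x, y). x \<in> spheres S n \<and> y \<in> spheres S n \<and>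
        (\<exists>z\<in>carrier (level S (n + 1)).
           (\<forall>i<n. face S (n + 1) i z = \<one>\<^bsub>level S n\<^esub>) \<and>
           face S (n + 1) n z = x \<and> face S (n + 1) (n + 1) z = y)}"

definition homotopy_set :: "('g monoid, 'g) simplicial \<Rightarrow> nat \<Rightarrow> 'g set set" where
  "homotopy_set S n = spheres S n // homotopy_rel S n"

definition simplicially_connected :: "('g monoid, 'g) simplicial \<Rightarrow> bool" where
  "simplicially_connected S \<longleftrightarrow> is_singleton (homotopy_set S 0)"

definition simplicially_simply_connected :: "('g monoid, 'g) simplicial \<Rightarrow> bool" where
  "simplicially_simply_connected S \<longleftrightarrow>
     is_singleton (homotopy_set S 0) \<and> is_singleton (homotopy_set S 1)"

section \<open>The standard simplicial ring\<close>

definition simplex_ideal ::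
  "('a, 'm) ring_scheme \<Rightarrow> nat \<Rightarrow> (nat multiset \<Rightarrow> 'a) set" where
  "simplex_ideal R n =
     (let P = mpoly_ring R {..n} in
      PIdl\<^bsub>P\<^esub> ((\<Oplus>\<^bsub>P\<^esub>i\<in>{..n}. ring.indexed_var R i) \<ominus>\<^bsub>P\<^esub> \<one>\<^bsub>P\<^esub>))"

definition simplex_ring ::
  "('a, 'm) ring_scheme \<Rightarrow> nat \<Rightarrow> (nat multiset \<Rightarrow> 'a) set ring" where
  "simplex_ring R n = mpoly_ring R {..n} Quot simplex_ideal R n"

text \<open>The homomorphism from degree \<open>n\<close> to degree \<open>m\<close> that sends the class of \<open>t\<^sub>j\<close> to the class
  of \<open>v j\<close>.\<close>

definition simplex_map ::
  "('a, 'm) ring_scheme \<Rightarrow> nat \<Rightarrow> (nat \<Rightarrow> nat multiset \<Rightarrow> 'a)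
     \<Rightarrow> (nat multiset \<Rightarrow> 'a) set \<Rightarrow> (nat multiset \<Rightarrow> 'a) set" where
  "simplex_map R m v U =
     (let P = mpoly_ring R {..m} in
      the_elem ((\<lambda>f. simplex_ideal R m +>\<^bsub>P\<^esub> mpoly_eval R P (ring.indexed_const R) v f) ` U))"

definition face_substitution ::
  "('a, 'm) ring_scheme \<Rightarrow> nat \<Rightarrow> nat \<Rightarrow> nat multiset \<Rightarrow> 'a" where
  "face_substitution R i j =
     (if j < i then ring.indexed_var R j
      else if j = i then ring.indexed_const R \<zero>\<^bsub>R\<^esub>
      else ring.indexed_var R (j - 1))"

definition degen_substitution ::
  "('a, 'm) ring_scheme \<Rightarrow> nat \<Rightarrow> nat \<Rightarrow> nat multiset \<Rightarrow> 'a" where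
  "degen_substitution R i j =
     (if j < i then ring.indexed_var R j
      else if j = i then ring.indexed_padd R (ring.indexed_var R i) (ring.indexed_var R (i + 1))
      else ring.indexed_var R (j + 1))"

definition standard_simplicial_ring ::
  "('a, 'm) ring_scheme \<Rightarrow>
     ((nat multiset \<Rightarrow> 'a) set ring, (nat multiset \<Rightarrow> 'a) set) simplicial" where
  "standard_simplicial_ring R =
     \<lparr> level = simplex_ring R,
       face = (\<lambda>n i. simplex_map R (n - 1) (face_substitution R i)),
       degen = (\<lambda>n i. simplex_map R (n + 1) (degen_substitution R i)) \<rparr>"

definition simplicial_elementary_group ::
  "'v::euclidean_space set \<Rightarrow> nat \<Rightarrow> ('v \<Rightarrow> int mat) \<Rightarrow> ('a, 'm) ring_scheme
     \<Rightarrow> ((nat multiset \<Rightarrow> 'a) set mat monoid, (nat multiset \<Rightarrow> 'a) set mat) simplicial" where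
  "simplicial_elementary_group \<Phi> n e R =
     apply_functor (elementary_group \<Phi> n e) elementary_map (standard_simplicial_ring R)"

definition simplicial_steinberg_group ::
  "'v::euclidean_space set \<Rightarrow> ('v \<Rightarrow> 'v \<Rightarrow> (nat \<times> nat) list) \<Rightarrow> ('v \<Rightarrow> 'v \<Rightarrow> nat \<Rightarrow> nat \<Rightarrow> int)
     \<Rightarrow> ('a, 'm) ring_scheme
     \<Rightarrow> (('v \<times> (nat multiset \<Rightarrow> 'a) set) group_word set monoid,
         ('v \<times> (nat multiset \<Rightarrow> 'a) set) group_word set) simplicial" where
  "simplicial_steinberg_group \<Phi> ord N R =
     apply_functor (steinberg_group \<Phi> ord N) (steinberg_map \<Phi> ord N) (standard_simplicial_ring R)"

end

theory Submission
  imports Defs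
begin

text \<open>Multiplying the arguments of the generators by the barycentric coordinates \<open>t\<^sub>0\<close>, \<open>t\<^sub>1\<close> gives
  paths from any product of generators to the identity; hence both groups are connected. For
  \<open>E\<^sub>\<Lambda>\<close> one has to know that \<open>t\<^sub>\<alpha>(\<xi>)\<close> is a point of the Chevalley--Demazure scheme over every
  ring. This follows from the generic unipotent over \<open>\<int>[X]\<close>, whose image under an integral
  polynomial vanishing on the complex group has every complex number as a root.

  Let \<open>w = \<Prod> x\<^sub>\<alpha>(f)\<close> be a loop in \<open>St(\<Phi>, R[\<Delta>\<^sup>1])\<close>. The \<open>2\<close>-simplex
  \<open>\<Prod> x\<^sub>\<alpha>(t\<^sub>2 s\<^sub>1(f) + t\<^sub>0 s\<^sub>0(f))\<close> has middle face \<open>w\<close>, and its outer faces are the cones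
  \<open>\<Prod> x\<^sub>\<alpha>(t\<^sub>i u)\<close> over words \<open>\<Prod> x\<^sub>\<alpha>(u)\<close> that are trivial in \<open>St(\<Phi>, R)\<close>. The cone over a
  trivial word is null-homotopic by induction on the derivation of its triviality: the additivity
  relations are preserved by the cone, and the commutator formula is filled by
  \<open>\<Prod> x\<^bsub>i\<alpha>+j\<beta>\<^esub>(N\<^bsub>\<alpha>\<beta>ij\<^esub> a\<^sup>i b\<^sup>j t\<^sub>0 (t\<^sub>0 + t\<^sub>1)\<^bsup>i+j-1\<^esup>)\<close>.\<close>

section \<open>Words modulo relations\<close>

text \<open>Scaling all arguments by a coordinate t is additive but not multiplicative. It respects
  the additivity relations, but in the commutator formula for the scaled arguments the (i,j)-factor
  carries t^(i+j), whereas the cone over the right-hand side carries t. The cone is therefore not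
  induced by a map of Steinberg groups, and the cone over a trivial word is only shown to be
  null-homotopic, not trivial. This is why the argument lives on words and why its induction runs
  over derivations of triviality instead of group elements. Derivations use symmetry and
  transitivity, so homotopies have to be reversed and composed; in a simplicial group both are done
  by multiplying with degenerate simplices. The Weyl relations of rank one cannot be scaled in this
  way at all: they are stated for units u, and t u is in general not a unit. The cones over the two
  ends of a loop have their vanishing ends at opposite vertices of the triangle, so the filling
  argument is set up to be read in either order of the vertices.\<close>

locale presentation =
  fixes S :: "'x set" and rels :: "('x group_word \<times> 'x group_word) set"
  assumes rels_words: "rels \<subseteq> lists (UNIV \<times> S) \<times> lists (UNIV \<times> S)"
begin

abbreviation words :: "'x group_word set" where "words \<equiv> lists (UNIV \<times> S)"
abbreviation eqv (infix \<open>\<doteq>\<close> 50) where "u \<doteq> v \<equiv> presentation_eq S rels u v"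
abbreviation cls where "cls \<equiv> presentation_class S rels"

text \<open>The \<open>relation\<close> rule of \<open>presentation_eq\<close> does not check that
  its two sides are words over \<open>S\<close>; the locale assumption supplies exactly this, and
  all other rules preserve it.\<close>

lemma eqv_words:
  assumes "u \<doteq> v"
  shows "u \<in> words" and "v \<in> words"
proof -
  from assms have "u \<in> words \<and> v \<in> words"
    by induction (use rels_words in auto)
  then show "u \<in> words" "v \<in> words" by auto
qed

lemma inverse_word_words: "w \<in> words \<Longrightarrow> inverse_word w \<in> words"
  by (auto simp: inverse_word_def in_lists_conv_set)

lemma append_inverse_word: "w \<in> words \<Longrightarrow> w @ inverse_word w \<doteq> []"
proof (induction w)
  case Nil
  then show ?case by (auto simp: inverse_word_def intro: presentation_eq.refl)
next
  case (Cons a w)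
  obtain s x where a: "a = (s, x)" by (cases a)
  have x: "x \<in> S" and w: "w \<in> words" using Cons.prems a by auto
  have "[(s, x)] @ (w @ inverse_word w) @ [(\<not> s, x)] \<doteq> [(s, x)] @ [] @ [(\<not> s, x)]"
    by (intro presentation_eq.append presentation_eq.refl Cons.IH w) (use x in auto)
  moreover have "[(s, x), (\<not> s, x)] \<doteq> []" by (rule presentation_eq.cancel[OF x])
  ultimately show ?case by (auto simp: a inverse_word_def intro: presentation_eq.trans)
qed

lemma inverse_word_inverse_word [simp]: "inverse_word (inverse_word w) = w"
  by (auto simp: inverse_word_def rev_map o_def case_prod_beta)

lemma inverse_word_append: "w \<in> words \<Longrightarrow> inverse_word w @ w \<doteq> []"
  using append_inverse_word[OF inverse_word_words, of w] by simp

lemma eqv_append_Nil: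
  assumes "u \<doteq> []" "v \<doteq> w"
  shows "u @ v \<doteq> w" and "v @ u \<doteq> w"
  using presentation_eq.append[OF assms] presentation_eq.append[OF assms(2,1)] by simp_all

text \<open>Inversion is not among the rules of \<open>presentation_eq\<close>. Placing
  \<open>u\<close> and \<open>v\<close> in turn between \<open>inverse_word u\<close> and
  \<open>inverse_word v\<close> gives equivalent words, the first of which cancels to
  \<open>inverse_word v\<close> and the second to \<open>inverse_word u\<close>.\<close>

lemma eqv_inverse_word:
  assumes "u \<doteq> v"
  shows "inverse_word u \<doteq> inverse_word v"
proof -
  have w: "u \<in> words" "v \<in> words" using eqv_words[OF assms] by auto
  have r: "inverse_word u \<doteq> inverse_word u" "inverse_word v \<doteq> inverse_word v"
    using w by (auto intro!: presentation_eq.refl inverse_word_words)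
  have "inverse_word u @ u @ inverse_word v \<doteq> inverse_word u @ v @ inverse_word v"
    by (intro presentation_eq.append r assms)
  moreover have "(inverse_word u @ u) @ inverse_word v \<doteq> inverse_word v"
    by (rule eqv_append_Nil(1)[OF inverse_word_append[OF w(1)] r(2)])
  moreover have "inverse_word u @ (v @ inverse_word v) \<doteq> inverse_word u"
    by (rule eqv_append_Nil(2)[OF append_inverse_word[OF w(2)] r(1)])
  ultimately show ?thesis
    by (metis append.assoc presentation_eq.sym presentation_eq.trans)
qed

lemma eqv_inverse_Nil: "u \<doteq> [] \<Longrightarrow> inverse_word u \<doteq> []"
  using eqv_inverse_word[of u "[]"] by (simp add: inverse_word_def)

lemma cls_eqI: "u \<doteq> v \<Longrightarrow> cls u = cls v"
  unfolding presentation_class_def by (blast intro: presentation_eq.sym presentation_eq.trans)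

text \<open>The hypothesis puts \<open>v\<close> into its own class. Sequences that are not words
  all have the empty class, so for them equality of classes would say nothing.\<close>

lemma cls_eq_iff: "v \<in> words \<Longrightarrow> cls u = cls v \<longleftrightarrow> u \<doteq> v"
  using cls_eqI presentation_eq.refl[of v S rels] unfolding presentation_class_def by blast

end

text \<open>The universal property of a presentation, on words: each relation only has to go to a
  derivable equality, not to a relation of the target.\<close>

lemma presentation_eq_map:
  assumes "presentation_eq S rels u v"
    and f: "\<And>x. x \<in> S \<Longrightarrow> f x \<in> S'"
    and rels: "\<And>u v. (u, v) \<in> rels \<Longrightarrow>
      presentation_eq S' rels' (map (map_prod id f) u) (map (map_prod id f) v)"
  shows "presentation_eq S' rels' (map (map_prod id f) u) (map (map_prod id f) v)"
  using assms(1)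
proof induction
  case (cancel x s)
  then show ?case using f presentation_eq.cancel[of "f x" S' rels' s] by simp
next
  case (refl w)
  then show ?case by (intro presentation_eq.refl) (auto simp: f in_lists_conv_set)
next
  case (append u u' v v')
  then show ?case by (auto intro: presentation_eq.append)
next
  case (relation u v)
  then show ?case by (rule rels)
qed (auto intro: presentation_eq.sym presentation_eq.trans)

section \<open>Functoriality of the Steinberg group\<close>

lemma ring_hom_int_pow:
  assumes "cring A" "cring B" "f \<in> Ring.ring_hom A B" "a \<in> carrier A"
  shows "f (add_pow A (k::int) a) = add_pow B k (f a)"
proof -
  interpret ring_hom_cring A B f
    using assms by (simp add: ring_hom_cring_def ring_hom_cring_axioms_def)
  interpret ring_hom_ring A B f
    by (intro ring_hom_ringI2 assms(3)) unfold_locales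
  have "group_hom (add_monoid A) (add_monoid B) f"
    by (rule ring.a_group_hom)
  from group_hom.hom_int_pow[OF this, of a k] show ?thesis
    using assms(4) by (simp add: add_pow_def)
qed

lemma ring_hom_Units:
  assumes "cring A" "cring B" "f \<in> Ring.ring_hom A B" "u \<in> Units A"
  shows "f u \<in> Units B" and "f (inv\<^bsub>A\<^esub> u) = inv\<^bsub>B\<^esub> (f u)"
proof -
  interpret A: cring A by fact
  interpret B: cring B by fact
  interpret ring_hom_cring A B f
    using assms by (simp add: ring_hom_cring_def ring_hom_cring_axioms_def)
  have c: "u \<in> carrier A" "inv\<^bsub>A\<^esub> u \<in> carrier A" using assms(4) by auto
  have *: "f u \<otimes>\<^bsub>B\<^esub> f (inv\<^bsub>A\<^esub> u) = \<one>\<^bsub>B\<^esub>"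
    using c A.Units_r_inv[OF assms(4)] by (simp flip: hom_mult)
  then show "f u \<in> Units B"
    using c by (intro B.unit_factor[of "f u" "f (inv\<^bsub>A\<^esub> u)"]) auto
  show "f (inv\<^bsub>A\<^esub> u) = inv\<^bsub>B\<^esub> (f u)"
    using * c by (metis B.comm_inv_char hom_closed)
qed

text \<open>An arbitrary function is allowed, because cones, contracting paths and interpolations
  between degeneracies are not ring homomorphisms in the arguments.\<close>

definition word_map :: "('r \<Rightarrow> 's) \<Rightarrow> ('v \<times> 'r) group_word \<Rightarrow> ('v \<times> 's) group_word" where
  "word_map f = map (\<lambda>(s, \<alpha>, \<xi>). (s, \<alpha>, f \<xi>))"

lemma word_map_alt: "word_map f = map (map_prod id (map_prod id f))"
  by (auto simp: word_map_def intro!: map_cong)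

lemma word_map_simps [simp]:
  "word_map f [] = []" "word_map f (u @ v) = word_map f u @ word_map f v"
  "word_map f ((s, \<alpha>, \<xi>) # w) = (s, \<alpha>, f \<xi>) # word_map f w"
  "word_map f (x_letter \<alpha> \<xi> # w) = x_letter \<alpha> (f \<xi>) # word_map f w"
  "word_map f (inverse_word w) = inverse_word (word_map f w)"
  by (auto simp: word_map_def x_letter_def inverse_word_def rev_map)

lemma word_map_word_map [simp]: "word_map f (word_map g w) = word_map (\<lambda>a. f (g a)) w"
  by (simp add: word_map_def o_def case_prod_beta)

lemma word_map_id: "word_map (\<lambda>a. a) w = w"
  by (induction w) (auto simp: word_map_def)

text \<open>The assumptions keep the relators inside the words: the Weyl relations mention the
  opposite root, the commutator formulas the roots listed by \<open>ord\<close>.\<close>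

locale steinberg_data =
  fixes \<Phi> :: "'v::euclidean_space set"
    and ord :: "'v \<Rightarrow> 'v \<Rightarrow> (nat \<times> nat) list"
    and N :: "'v \<Rightarrow> 'v \<Rightarrow> nat \<Rightarrow> nat \<Rightarrow> int"
  assumes uminus_root: "\<alpha> \<in> \<Phi> \<Longrightarrow> - \<alpha> \<in> \<Phi>"
    and ord: "commutator_order \<Phi> ord"
begin

abbreviation st_words :: "('r, 'm) ring_scheme \<Rightarrow> ('v \<times> 'r) group_word set" where
  "st_words A \<equiv> lists (UNIV \<times> steinberg_generators \<Phi> A)"

abbreviation st_eqv :: "('r, 'm) ring_scheme \<Rightarrow> ('v \<times> 'r) group_word \<Rightarrow> ('v \<times> 'r) group_word \<Rightarrow> bool" where
  "st_eqv A \<equiv> presentation_eq (steinberg_generators \<Phi> A) (steinberg_relations \<Phi> ord N A)"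

lemma x_letter_words [simp]:
  "x_letter \<alpha> a # w \<in> st_words A \<longleftrightarrow> \<alpha> \<in> \<Phi> \<and> a \<in> carrier A \<and> w \<in> st_words A"
  by (auto simp: x_letter_def steinberg_generators_def)

lemma ord_root:
  assumes "\<alpha> \<in> \<Phi>" "\<beta> \<in> \<Phi>" "\<alpha> + \<beta> \<noteq> 0" "(i, j) \<in> set (ord \<alpha> \<beta>)"
  shows "real i *\<^sub>R \<alpha> + real j *\<^sub>R \<beta> \<in> \<Phi>" and "1 \<le> i" and "1 \<le> j"
proof -
  have "set (ord \<alpha> \<beta>) = root_pairs \<Phi> \<alpha> \<beta>"
    using ord assms(1-3) by (auto simp: commutator_order_def)
  then show "real i *\<^sub>R \<alpha> + real j *\<^sub>R \<beta> \<in> \<Phi>" "1 \<le> i" "1 \<le> j"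
    using assms(4) by (auto simp: root_pairs_def)
qed

lemma commutator_words:
  assumes "\<alpha> \<in> \<Phi>" "\<beta> \<in> \<Phi>" "\<alpha> + \<beta> \<noteq> 0" "\<And>i j. g i j \<in> carrier A"
  shows "map (\<lambda>(i, j). x_letter (real i *\<^sub>R \<alpha> + real j *\<^sub>R \<beta>) (g i j)) (ord \<alpha> \<beta>) \<in> st_words A"
  using ord_root(1)[OF assms(1-3)] assms(4)
  by (auto simp: in_lists_conv_set x_letter_def steinberg_generators_def)

lemma inverse_letter_words [simp]:
  "inverse_word [x_letter \<alpha> a] \<in> st_words A \<longleftrightarrow> \<alpha> \<in> \<Phi> \<and> a \<in> carrier A"
  by (auto simp: x_letter_def steinberg_generators_def inverse_word_def)

lemma presentation_st:
  assumes "cring A"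
  shows "presentation (steinberg_generators \<Phi> A) (steinberg_relations \<Phi> ord N A)"
proof
  interpret A: cring A by fact
  have "additivity_relations \<Phi> A \<subseteq> st_words A \<times> st_words A"
    by (auto simp: additivity_relations_def x_letter_def steinberg_generators_def)
  moreover have "weyl_relations \<Phi> A \<subseteq> st_words A \<times> st_words A"
    by (auto simp: weyl_relations_def w_word_def inverse_word_def x_letter_def
        steinberg_generators_def uminus_root)
  moreover have "commutator_relations \<Phi> ord N A \<subseteq> st_words A \<times> st_words A"
  proof
    fix uv assume "uv \<in> commutator_relations \<Phi> ord N A"
    then obtain \<alpha> \<beta> a b where *: "\<alpha> \<in> \<Phi>" "\<beta> \<in> \<Phi>" "\<alpha> + \<beta> \<noteq> 0" "a \<in> carrier A" "b \<in> carrier A"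
      and uv: "uv = ([x_letter \<alpha> a, x_letter \<beta> b] @ inverse_word [x_letter \<alpha> a] @ inverse_word [x_letter \<beta> b],
        map (\<lambda>(i, j). x_letter (real i *\<^sub>R \<alpha> + real j *\<^sub>R \<beta>)
          (add_pow A (N \<alpha> \<beta> i j) (a [^]\<^bsub>A\<^esub> i \<otimes>\<^bsub>A\<^esub> b [^]\<^bsub>A\<^esub> j))) (ord \<alpha> \<beta>))"
      unfolding commutator_relations_def by blast
    have "fst uv \<in> st_words A"
      using * by (auto simp: uv inverse_word_def x_letter_def steinberg_generators_def)
    moreover have "snd uv \<in> st_words A"
      unfolding uv snd_conv by (rule commutator_words) (use * in auto)
    ultimately show "uv \<in> st_words A \<times> st_words A" by (auto simp: mem_Times_iff simp del: in_lists_conv_set)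
  qed
  ultimately show "steinberg_relations \<Phi> ord N A \<subseteq> st_words A \<times> st_words A"
    by (auto simp: steinberg_relations_def)
qed

lemma word_map_words:
  assumes "\<And>a. a \<in> carrier A \<Longrightarrow> f a \<in> carrier B" "w \<in> st_words A"
  shows "word_map f w \<in> st_words B"
  using assms by (auto simp: in_lists_conv_set word_map_def steinberg_generators_def)

lemma word_map_cong:
  assumes "\<And>a. a \<in> carrier A \<Longrightarrow> f a = g a" "w \<in> st_words A"
  shows "word_map f w = word_map g w"
  using assms by (auto simp: in_lists_conv_set word_map_def steinberg_generators_def)

lemma word_map_eqv:
  assumes "st_eqv A u v" and g: "\<And>a. a \<in> carrier A \<Longrightarrow> g a \<in> carrier B"
    and rels: "\<And>u v. (u, v) \<in> steinberg_relations \<Phi> ord N A \<Longrightarrow> st_eqv B (word_map g u) (word_map g v)"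
  shows "st_eqv B (word_map g u) (word_map g v)"
  unfolding word_map_alt
  by (rule presentation_eq_map[OF assms(1)])
    (use g rels in \<open>auto simp: word_map_alt steinberg_generators_def\<close>)

text \<open>A ring homomorphism preserves sums, integer multiples, powers and inverses of units, so
  each relation over \<open>A\<close> becomes a relation of the same kind over
  \<open>B\<close>.\<close>

lemma word_map_hom_eqv:
  assumes "cring A" "cring B" and f: "f \<in> Ring.ring_hom A B" and eqv: "st_eqv A u v"
  shows "st_eqv B (word_map f u) (word_map f v)"
proof (rule word_map_eqv[OF eqv])
  interpret A: cring A by fact
  interpret B: cring B by fact
  interpret ring_hom_cring A B f
    using assms by (simp add: ring_hom_cring_def ring_hom_cring_axioms_def)
  show "f a \<in> carrier B" if "a \<in> carrier A" for a using that by simp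
  fix u v assume uv: "(u, v) \<in> steinberg_relations \<Phi> ord N A"
  have "(word_map f u, word_map f v) \<in> additivity_relations \<Phi> B" if "(u, v) \<in> additivity_relations \<Phi> A"
    using that unfolding additivity_relations_def by fastforce
  moreover have "(word_map f u, word_map f v) \<in> weyl_relations \<Phi> B" if "(u, v) \<in> weyl_relations \<Phi> A"
  proof -
    obtain \<alpha> w \<xi> where *: "\<alpha> \<in> \<Phi>" "w \<in> Units A" "\<xi> \<in> carrier A"
      and u: "u = w_word A \<alpha> w @ [x_letter \<alpha> \<xi>] @ inverse_word (w_word A \<alpha> w)"
      and v: "v = [x_letter (- \<alpha>) (\<ominus>\<^bsub>A\<^esub> ((inv\<^bsub>A\<^esub> w) [^]\<^bsub>A\<^esub> (2::nat) \<otimes>\<^bsub>A\<^esub> \<xi>))]"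
      using \<open>(u, v) \<in> weyl_relations \<Phi> A\<close> unfolding weyl_relations_def by blast
    have w: "f w \<in> Units B" "f (inv\<^bsub>A\<^esub> w) = inv\<^bsub>B\<^esub> (f w)" "inv\<^bsub>A\<^esub> w \<in> carrier A" "w \<in> carrier A"
      using ring_hom_Units[OF assms(1-3) *(2)] *(2) by auto
    have "word_map f u = w_word B \<alpha> (f w) @ [x_letter \<alpha> (f \<xi>)] @ inverse_word (w_word B \<alpha> (f w))"
      using * w by (simp add: u w_word_def)
    moreover have "word_map f v = [x_letter (- \<alpha>) (\<ominus>\<^bsub>B\<^esub> ((inv\<^bsub>B\<^esub> (f w)) [^]\<^bsub>B\<^esub> (2::nat) \<otimes>\<^bsub>B\<^esub> f \<xi>))]"
      using * w by (simp add: v)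
    ultimately show ?thesis
      using * w hom_closed unfolding weyl_relations_def by blast
  qed
  moreover have "(word_map f u, word_map f v) \<in> commutator_relations \<Phi> ord N B"
    if "(u, v) \<in> commutator_relations \<Phi> ord N A"
  proof -
    obtain \<alpha> \<beta> a b where *: "\<alpha> \<in> \<Phi>" "\<beta> \<in> \<Phi>" "\<alpha> + \<beta> \<noteq> 0" "a \<in> carrier A" "b \<in> carrier A"
      and u: "u = [x_letter \<alpha> a, x_letter \<beta> b] @ inverse_word [x_letter \<alpha> a] @ inverse_word [x_letter \<beta> b]"
      and v: "v = map (\<lambda>(i, j). x_letter (real i *\<^sub>R \<alpha> + real j *\<^sub>R \<beta>)
              (add_pow A (N \<alpha> \<beta> i j) (a [^]\<^bsub>A\<^esub> i \<otimes>\<^bsub>A\<^esub> b [^]\<^bsub>A\<^esub> j))) (ord \<alpha> \<beta>)"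
      using \<open>(u, v) \<in> commutator_relations \<Phi> ord N A\<close> unfolding commutator_relations_def by blast
    have "word_map f u = [x_letter \<alpha> (f a), x_letter \<beta> (f b)] @ inverse_word [x_letter \<alpha> (f a)] @ inverse_word [x_letter \<beta> (f b)]"
      by (simp add: u)
    moreover have "word_map f v = map (\<lambda>(i, j). x_letter (real i *\<^sub>R \<alpha> + real j *\<^sub>R \<beta>)
              (add_pow B (N \<alpha> \<beta> i j) (f a [^]\<^bsub>B\<^esub> i \<otimes>\<^bsub>B\<^esub> f b [^]\<^bsub>B\<^esub> j))) (ord \<alpha> \<beta>)"
      using * by (auto simp: v word_map_def x_letter_def ring_hom_int_pow[OF assms(1-3)])
    ultimately show ?thesis
      using * hom_closed unfolding commutator_relations_def by blast
  qed
  ultimately have "(word_map f u, word_map f v) \<in> steinberg_relations \<Phi> ord N B"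
    using uv by (auto simp: steinberg_relations_def split: if_splits)
  then show "st_eqv B (word_map f u) (word_map f v)"
    by (rule presentation_eq.relation)
qed

text \<open>A letter with argument zero is idempotent by additivity, hence trivial. Only the roots
  in \<open>w\<close> matter, so \<open>w\<close> may come from another ring. Faces on which a
  scaling coordinate vanishes are collapsed in this way.\<close>

lemma eqv_zero_word:
  assumes "cring A" "w \<in> st_words B"
  shows "st_eqv A (word_map (\<lambda>_. \<zero>\<^bsub>A\<^esub>) w) []"
proof -
  interpret A: cring A by fact
  interpret presentation "steinberg_generators \<Phi> A" "steinberg_relations \<Phi> ord N A"
    by (rule presentation_st[OF assms(1)])
  have letter: "st_eqv A [x_letter \<alpha> \<zero>\<^bsub>A\<^esub>] []" if \<alpha>: "\<alpha> \<in> \<Phi>" for \<alpha>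
  proof -
    let ?x = "x_letter \<alpha> \<zero>\<^bsub>A\<^esub>"
    have x: "[?x] \<in> st_words A" using \<alpha> by (auto simp: x_letter_def steinberg_generators_def)
    \<comment> \<open>Additivity with 0 + 0 = 0 says that the square of the letter is the letter
      itself; one copy is then cancelled.\<close>
    have "([?x, ?x], [x_letter \<alpha> (\<zero>\<^bsub>A\<^esub> \<oplus>\<^bsub>A\<^esub> \<zero>\<^bsub>A\<^esub>)]) \<in> steinberg_relations \<Phi> ord N A"
      using \<alpha> A.zero_closed unfolding steinberg_relations_def additivity_relations_def by blast
    then have "st_eqv A [?x, ?x] [?x]" by (simp add: presentation_eq.relation)
    from presentation_eq.append[OF this presentation_eq.refl[OF inverse_word_words[OF x]]]
    have "st_eqv A ([?x] @ [?x] @ inverse_word [?x]) ([?x] @ inverse_word [?x])" by simp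
    moreover have "st_eqv A ([?x] @ [?x] @ inverse_word [?x]) [?x]"
      by (rule eqv_append_Nil(2)[OF append_inverse_word[OF x] presentation_eq.refl[OF x]])
    ultimately show ?thesis
      using append_inverse_word[OF x] by (meson presentation_eq.sym presentation_eq.trans)
  qed
  show ?thesis using assms(2)
  proof (induction w rule: list.induct)
    case (Cons l w)
    obtain s \<alpha> a where l: "l = (s, \<alpha>, a)" by (cases l)
    have \<alpha>: "\<alpha> \<in> \<Phi>" using Cons.prems l by (auto simp: steinberg_generators_def)
    have "st_eqv A [(s, \<alpha>, \<zero>\<^bsub>A\<^esub>)] []"
      using letter[OF \<alpha>] eqv_inverse_Nil[OF letter[OF \<alpha>]]
      by (cases s) (simp_all add: x_letter_def inverse_word_def)
    from eqv_append_Nil(1)[OF this Cons.IH] show ?case using Cons.prems l by simp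
  qed (auto intro: presentation_eq.refl)
qed

end

text \<open>The data that let a relation between words over \<open>B\<^sub>0\<close> be filled by a \<open>2\<close>-simplex: \<open>\<iota>\<close> and
  \<open>\<sigma>\<close> are degeneracies, \<open>\<delta>\<close> the faces, \<open>\<tau>\<close> and \<open>U\<close> are \<open>t\<^sub>0\<close> and \<open>t\<^sub>0 + t\<^sub>1\<close> or, with the vertices
  in reverse order, \<open>t\<^sub>1\<close> and \<open>t\<^sub>1 + t\<^sub>2\<close>.\<close>

locale triangle_filling = steinberg_data \<Phi> ord N
  for \<Phi> :: "'v::euclidean_space set" and ord :: "'v \<Rightarrow> 'v \<Rightarrow> (nat \<times> nat) list" and N +
  fixes B0 :: "('a, 'k) ring_scheme" and B1 :: "('b, 'l) ring_scheme" and B2 :: "('c, 'm) ring_scheme"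
    and \<iota> :: "'a \<Rightarrow> 'b" and \<sigma> :: "'b \<Rightarrow> 'c" and \<delta>0 \<delta>1 \<delta>2 :: "'c \<Rightarrow> 'b" and \<tau> :: 'b and U :: 'c
  assumes B0: "cring B0" and B1: "cring B1" and B2: "cring B2"
    and \<iota>: "\<iota> \<in> Ring.ring_hom B0 B1" and \<sigma>: "\<sigma> \<in> Ring.ring_hom B1 B2"
    and \<delta>0: "\<delta>0 \<in> Ring.ring_hom B2 B1" and \<delta>1: "\<delta>1 \<in> Ring.ring_hom B2 B1"
    and \<delta>2: "\<delta>2 \<in> Ring.ring_hom B2 B1"
    and \<tau>: "\<tau> \<in> carrier B1" and U: "U \<in> carrier B2"
    and \<delta>0_\<tau>: "\<delta>0 (\<sigma> \<tau>) = \<zero>\<^bsub>B1\<^esub>"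
    and \<delta>1_\<sigma>: "b \<in> carrier B1 \<Longrightarrow> \<delta>1 (\<sigma> b) = b" and \<delta>2_\<sigma>: "b \<in> carrier B1 \<Longrightarrow> \<delta>2 (\<sigma> b) = b"
    and \<delta>1_U: "\<delta>1 U = \<tau>" and \<delta>2_U: "\<delta>2 U = \<one>\<^bsub>B1\<^esub>"
    and rank: "root_rank \<Phi> \<noteq> 1"
begin

sublocale B0: cring B0 by (rule B0)
sublocale B1: cring B1 by (rule B1)
sublocale B2: cring B2 by (rule B2)
sublocale \<iota>: ring_hom_cring B0 B1 \<iota> by unfold_locales (rule \<iota>)
sublocale \<sigma>: ring_hom_cring B1 B2 \<sigma> by unfold_locales (rule \<sigma>)
sublocale \<delta>0: ring_hom_cring B2 B1 \<delta>0 by unfold_locales (rule \<delta>0)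
sublocale \<delta>1: ring_hom_cring B2 B1 \<delta>1 by unfold_locales (rule \<delta>1)
sublocale \<delta>2: ring_hom_cring B2 B1 \<delta>2 by unfold_locales (rule \<delta>2)
sublocale S1: presentation "steinberg_generators \<Phi> B1" "steinberg_relations \<Phi> ord N B1"
  by (rule presentation_st[OF B1])
sublocale S2: presentation "steinberg_generators \<Phi> B2" "steinberg_relations \<Phi> ord N B2"
  by (rule presentation_st[OF B2])

text \<open>This is a path of words from the zero word, at the end where \<tau> vanishes, to
  \<open>u\<close>, at the end where \<tau> is one. It is not a \<open>steinberg_map\<close>, since
  scaling by \<tau> is not multiplicative.\<close>

definition cone :: "('v \<times> 'a) group_word \<Rightarrow> ('v \<times> 'b) group_word" where
  "cone = word_map (\<lambda>a. \<tau> \<otimes>\<^bsub>B1\<^esub> \<iota> a)"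

lemma cone_words: "u \<in> st_words B0 \<Longrightarrow> cone u \<in> st_words B1"
  unfolding cone_def by (erule word_map_words[rotated]) (use \<tau> in auto)

text \<open>The homotopy relation in degree one, lifted to words. The boundary is prescribed only up
  to the Steinberg relations, so representatives of the faces can be changed freely.\<close>

definition fills :: "('v \<times> 'c) group_word \<Rightarrow> ('v \<times> 'b) group_word \<Rightarrow> ('v \<times> 'b) group_word \<Rightarrow> bool" where
  "fills z u v \<longleftrightarrow> z \<in> st_words B2 \<and> st_eqv B1 (word_map \<delta>0 z) [] \<and>
     st_eqv B1 (word_map \<delta>1 z) u \<and> st_eqv B1 (word_map \<delta>2 z) v"

lemma fills_eqv: "fills z u v \<Longrightarrow> st_eqv B1 u u' \<Longrightarrow> st_eqv B1 v v' \<Longrightarrow> fills z u' v'"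
  unfolding fills_def by (blast intro: presentation_eq.trans)

lemma fills_append: "fills z u v \<Longrightarrow> fills z' u' v' \<Longrightarrow> fills (z @ z') (u @ u') (v @ v')"
  unfolding fills_def using S1.eqv_append_Nil(1)[of "word_map \<delta>0 z" "word_map \<delta>0 z'" "[]"]
  by (auto intro: presentation_eq.append simp del: in_lists_conv_set)

lemma fills_inverse: "fills z u v \<Longrightarrow> fills (inverse_word z) (inverse_word u) (inverse_word v)"
  unfolding fills_def word_map_simps
  by (elim conjE, intro conjI S1.eqv_inverse_word S1.eqv_inverse_Nil S2.inverse_word_words)

text \<open>The constant homotopy of the path \<open>cone u\<close>, given by a degenerate triangle.
  Its zeroth face has all arguments zero because \<open>\<delta>0 (\<sigma> \<tau>)\<close> is
  zero.\<close>

lemma fills_cone: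
  assumes "u \<in> st_words B0"
  shows "fills (word_map \<sigma> (cone u)) (cone u) (cone u)"
proof -
  note c = cone_words[OF assms]
  have "word_map \<delta>0 (word_map \<sigma> (cone u)) = word_map (\<lambda>_. \<zero>\<^bsub>B1\<^esub>) u"
    unfolding cone_def word_map_word_map
    by (rule word_map_cong[OF _ assms]) (use \<tau> \<delta>0_\<tau> in auto)
  moreover have "word_map \<delta>1 (word_map \<sigma> (cone u)) = cone u" "word_map \<delta>2 (word_map \<sigma> (cone u)) = cone u"
    unfolding cone_def word_map_word_map
    by (rule word_map_cong[OF _ assms]; use \<tau> \<delta>1_\<sigma> \<delta>2_\<sigma> in simp)+
  ultimately show ?thesis
    unfolding fills_def
    using eqv_zero_word[OF B1 assms] presentation_eq.refl[OF c] word_map_words[OF \<sigma>.hom_closed c]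
    by simp
qed

text \<open>What travels along a derivation is a homotopy between the cones, not an equality. Every
  rule is thus a closure property of homotopy: products and inverses of fillers give congruence, and
  degenerate triangles give reversal and composition. Only the commutator relations need a genuinely
  new filler.\<close>

lemma cone_eqv_fills:
  assumes "st_eqv B0 u v"
  shows "\<exists>z. fills z (cone u) (cone v)"
  using assms
proof induction
  case (relation u v)
  then consider "(u, v) \<in> additivity_relations \<Phi> B0" | "(u, v) \<in> commutator_relations \<Phi> ord N B0"
    using rank by (auto simp: steinberg_relations_def)
  then show ?case
  proof cases
    case 1
    then obtain \<alpha> a b where *: "\<alpha> \<in> \<Phi>" "a \<in> carrier B0" "b \<in> carrier B0"
      and u: "u = [x_letter \<alpha> a, x_letter \<alpha> b]" and v: "v = [x_letter \<alpha> (a \<oplus>\<^bsub>B0\<^esub> b)]"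
      unfolding additivity_relations_def by blast
    have "(cone u, cone v) \<in> steinberg_relations \<Phi> ord N B1"
    proof -
      have "cone v = [x_letter \<alpha> (\<tau> \<otimes>\<^bsub>B1\<^esub> \<iota> a \<oplus>\<^bsub>B1\<^esub> \<tau> \<otimes>\<^bsub>B1\<^esub> \<iota> b)]"
        using * \<tau> by (simp add: v cone_def B1.r_distr)
      moreover have "cone u = [x_letter \<alpha> (\<tau> \<otimes>\<^bsub>B1\<^esub> \<iota> a), x_letter \<alpha> (\<tau> \<otimes>\<^bsub>B1\<^esub> \<iota> b)]"
        by (simp add: u cone_def)
      ultimately show ?thesis
        using * \<tau> \<iota>.hom_closed B1.m_closed
        unfolding steinberg_relations_def additivity_relations_def by blast
    qed
    then have "st_eqv B1 (cone u) (cone v)" by (rule presentation_eq.relation)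
    moreover have "u \<in> st_words B0" using * by (auto simp: u x_letter_def steinberg_generators_def)
    ultimately show ?thesis
      using fills_eqv[OF fills_cone] presentation_eq.refl S1.eqv_words by metis
  next
    case 2
    then obtain \<alpha> \<beta> a b where *: "\<alpha> \<in> \<Phi>" "\<beta> \<in> \<Phi>" "\<alpha> + \<beta> \<noteq> 0" "a \<in> carrier B0" "b \<in> carrier B0"
      and u: "u = [x_letter \<alpha> a, x_letter \<beta> b] @ inverse_word [x_letter \<alpha> a] @ inverse_word [x_letter \<beta> b]"
      and v: "v = map (\<lambda>(i, j). x_letter (real i *\<^sub>R \<alpha> + real j *\<^sub>R \<beta>)
              (add_pow B0 (N \<alpha> \<beta> i j) (a [^]\<^bsub>B0\<^esub> i \<otimes>\<^bsub>B0\<^esub> b [^]\<^bsub>B0\<^esub> j))) (ord \<alpha> \<beta>)"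
      unfolding commutator_relations_def by blast
    define c where "c i j = add_pow B0 (N \<alpha> \<beta> i j) (a [^]\<^bsub>B0\<^esub> i \<otimes>\<^bsub>B0\<^esub> b [^]\<^bsub>B0\<^esub> j)" for i j
    have c: "c i j \<in> carrier B0" for i j using * by (simp add: c_def)
    define \<Psi> where "\<Psi> g = map (\<lambda>(i, j). x_letter (real i *\<^sub>R \<alpha> + real j *\<^sub>R \<beta>) (g i j)) (ord \<alpha> \<beta>)"
      for g :: "nat \<Rightarrow> nat \<Rightarrow> 'b"
    \<comment> \<open>Since \<open>U\<close> becomes \<tau> under \<open>\<delta>1\<close> and one
      under \<open>\<delta>2\<close>, the coefficient of \<open>c i j\<close> becomes \<tau>^(i+j)
      and \<tau> respectively: the first is what the commutator formula for the scaled arguments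
      requires, the second what the cone over the right-hand side requires. The separate factor
      \<open>\<sigma> \<tau>\<close> makes the face \<open>\<delta>0\<close> vanish.\<close>
    define g where "g i j = \<sigma> \<tau> \<otimes>\<^bsub>B2\<^esub> (U [^]\<^bsub>B2\<^esub> (i + j - 1) \<otimes>\<^bsub>B2\<^esub> \<sigma> (\<iota> (c i j)))" for i j :: nat
    have g: "g i j \<in> carrier B2" for i j using c \<tau> U by (simp add: g_def)
    define z where "z = map (\<lambda>(i, j). x_letter (real i *\<^sub>R \<alpha> + real j *\<^sub>R \<beta>) (g i j)) (ord \<alpha> \<beta>)"
    have z: "z \<in> st_words B2"
      unfolding z_def by (rule commutator_words[OF *(1-3) g])
    have Psi_z: "word_map f z = \<Psi> (\<lambda>i j. f (g i j))" for f
      by (auto simp: z_def \<Psi>_def word_map_def x_letter_def)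
    have "word_map \<delta>0 z = word_map (\<lambda>_. \<zero>\<^bsub>B1\<^esub>) z"
      unfolding Psi_z \<Psi>_def using c \<tau> U \<delta>0_\<tau> by (auto simp: g_def)
    then have 0: "st_eqv B1 (word_map \<delta>0 z) []"
      using eqv_zero_word[OF B1 z] by simp
    have "\<delta>1 (g i j) = add_pow B1 (N \<alpha> \<beta> i j)
        ((\<tau> \<otimes>\<^bsub>B1\<^esub> \<iota> a) [^]\<^bsub>B1\<^esub> i \<otimes>\<^bsub>B1\<^esub> (\<tau> \<otimes>\<^bsub>B1\<^esub> \<iota> b) [^]\<^bsub>B1\<^esub> j)" if "1 \<le> i" "1 \<le> j" for i j
    proof -
      \<comment> \<open>The subtraction on natural numbers is exact because
        \<open>1 \<le> i\<close>; one of the i + j factors is the one contributed by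
        \<open>\<sigma> \<tau>\<close>.\<close>
      have \<tau>ij: "\<tau> [^]\<^bsub>B1\<^esub> i \<otimes>\<^bsub>B1\<^esub> \<tau> [^]\<^bsub>B1\<^esub> j = \<tau> \<otimes>\<^bsub>B1\<^esub> \<tau> [^]\<^bsub>B1\<^esub> (i + j - 1)"
      proof -
        obtain i' where "i = Suc i'" using \<open>1 \<le> i\<close> by (cases i) auto
        moreover have "\<tau> [^]\<^bsub>B1\<^esub> Suc i' \<otimes>\<^bsub>B1\<^esub> \<tau> [^]\<^bsub>B1\<^esub> j = \<tau> \<otimes>\<^bsub>B1\<^esub> (\<tau> [^]\<^bsub>B1\<^esub> i' \<otimes>\<^bsub>B1\<^esub> \<tau> [^]\<^bsub>B1\<^esub> j)"
          using \<tau> by (simp add: B1.m_ac)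
        ultimately show ?thesis
          using \<tau> by (simp add: B1.nat_pow_mult del: B1.nat_pow_Suc)
      qed
      have ab: "\<iota> a [^]\<^bsub>B1\<^esub> i \<in> carrier B1" "\<iota> b [^]\<^bsub>B1\<^esub> j \<in> carrier B1" using * by auto
      have "\<delta>1 (g i j) = \<tau> \<otimes>\<^bsub>B1\<^esub> (\<tau> [^]\<^bsub>B1\<^esub> (i + j - 1) \<otimes>\<^bsub>B1\<^esub>
          add_pow B1 (N \<alpha> \<beta> i j) (\<iota> a [^]\<^bsub>B1\<^esub> i \<otimes>\<^bsub>B1\<^esub> \<iota> b [^]\<^bsub>B1\<^esub> j))"
        using c \<tau> U \<delta>1_\<sigma> \<delta>1_U *(4,5) by (simp add: g_def) (simp add: c_def ring_hom_int_pow[OF B0 B1 \<iota>])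
      also have "\<dots> = add_pow B1 (N \<alpha> \<beta> i j) ((\<tau> [^]\<^bsub>B1\<^esub> i \<otimes>\<^bsub>B1\<^esub> \<tau> [^]\<^bsub>B1\<^esub> j) \<otimes>\<^bsub>B1\<^esub>
          (\<iota> a [^]\<^bsub>B1\<^esub> i \<otimes>\<^bsub>B1\<^esub> \<iota> b [^]\<^bsub>B1\<^esub> j))"
        using ab \<tau> by (simp add: \<tau>ij B1.add_pow_rdistr_int B1.m_assoc)
      also have "(\<tau> [^]\<^bsub>B1\<^esub> i \<otimes>\<^bsub>B1\<^esub> \<tau> [^]\<^bsub>B1\<^esub> j) \<otimes>\<^bsub>B1\<^esub> (\<iota> a [^]\<^bsub>B1\<^esub> i \<otimes>\<^bsub>B1\<^esub> \<iota> b [^]\<^bsub>B1\<^esub> j) =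
          (\<tau> \<otimes>\<^bsub>B1\<^esub> \<iota> a) [^]\<^bsub>B1\<^esub> i \<otimes>\<^bsub>B1\<^esub> (\<tau> \<otimes>\<^bsub>B1\<^esub> \<iota> b) [^]\<^bsub>B1\<^esub> j"
        using ab \<tau> * by (simp add: B1.nat_pow_distrib B1.m_ac)
      finally show ?thesis .
    qed
    then have "word_map \<delta>1 z = \<Psi> (\<lambda>i j. add_pow B1 (N \<alpha> \<beta> i j)
        ((\<tau> \<otimes>\<^bsub>B1\<^esub> \<iota> a) [^]\<^bsub>B1\<^esub> i \<otimes>\<^bsub>B1\<^esub> (\<tau> \<otimes>\<^bsub>B1\<^esub> \<iota> b) [^]\<^bsub>B1\<^esub> j))"
      unfolding Psi_z \<Psi>_def using ord_root(2,3)[OF *(1-3)] by auto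
    moreover have "cone u = [x_letter \<alpha> (\<tau> \<otimes>\<^bsub>B1\<^esub> \<iota> a), x_letter \<beta> (\<tau> \<otimes>\<^bsub>B1\<^esub> \<iota> b)] @
        inverse_word [x_letter \<alpha> (\<tau> \<otimes>\<^bsub>B1\<^esub> \<iota> a)] @ inverse_word [x_letter \<beta> (\<tau> \<otimes>\<^bsub>B1\<^esub> \<iota> b)]"
      by (simp add: u cone_def)
    ultimately have "(cone u, word_map \<delta>1 z) \<in> commutator_relations \<Phi> ord N B1"
      using *(1-3) B1.m_closed[OF \<tau> \<iota>.hom_closed[OF *(4)]] B1.m_closed[OF \<tau> \<iota>.hom_closed[OF *(5)]]
      unfolding commutator_relations_def \<Psi>_def by blast
    then have 1: "st_eqv B1 (word_map \<delta>1 z) (cone u)"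
      using rank by (auto simp: steinberg_relations_def intro!: presentation_eq.sym[OF presentation_eq.relation])
    have "\<delta>2 (g i j) = \<tau> \<otimes>\<^bsub>B1\<^esub> \<iota> (c i j)" for i j
      using c \<tau> U \<delta>2_\<sigma> \<delta>2_U by (simp add: g_def)
    then have "word_map \<delta>2 z = cone v"
      unfolding Psi_z by (auto simp: v cone_def \<Psi>_def word_map_def x_letter_def simp flip: c_def)
    moreover have "word_map \<delta>2 z \<in> st_words B1"
      by (rule word_map_words[OF \<delta>2.hom_closed z])
    ultimately have "st_eqv B1 (word_map \<delta>2 z) (cone v)"
      by (metis presentation_eq.refl)
    then show ?thesis using z 0 1 unfolding fills_def by blast
  qed
next
  case (cancel x s)
  obtain \<alpha> a where x: "x = (\<alpha>, a)" by (cases x)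
  have *: "\<alpha> \<in> \<Phi>" "\<tau> \<otimes>\<^bsub>B1\<^esub> \<iota> a \<in> carrier B1"
    using cancel \<tau> by (auto simp: x steinberg_generators_def)
  have "st_eqv B1 [] (cone [(s, x), (\<not> s, x)])"
    using presentation_eq.sym[OF presentation_eq.cancel, of "(\<alpha>, \<tau> \<otimes>\<^bsub>B1\<^esub> \<iota> a)" "steinberg_generators \<Phi> B1" _ s] *
    by (simp add: x cone_def steinberg_generators_def)
  moreover have "fills [] [] []" "cone [] = []"
    by (auto simp: fills_def cone_def intro: presentation_eq.refl)
  ultimately show ?case
    using fills_eqv by (metis S1.eqv_words(1) presentation_eq.refl)
next
  case (refl w)
  then show ?case using fills_cone by blast
next
  case (sym u v)
  then obtain z where z: "fills z (cone u) (cone v)" by blast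
  have uv: "u \<in> st_words B0" "v \<in> st_words B0"
    using presentation.eqv_words[OF presentation_st[OF B0] sym.hyps] by auto
  \<comment> \<open>Inverting \<open>z\<close> alone would give a homotopy between the inverse
    cones. With the constant homotopies of \<open>cone u\<close> and \<open>cone v\<close> on its
    two sides, the faces become u u^-1 v and u v^-1 v, which reverses the direction.\<close>
  from fills_append[OF fills_append[OF fills_cone[OF uv(1)] fills_inverse[OF z]] fills_cone[OF uv(2)]]
  obtain z' where "fills z' ((cone u @ inverse_word (cone u)) @ cone v) (cone u @ inverse_word (cone v) @ cone v)"
    by auto
  moreover have "st_eqv B1 ((cone u @ inverse_word (cone u)) @ cone v) (cone v)"
    using uv by (intro S1.eqv_append_Nil(1) S1.append_inverse_word cone_words presentation_eq.refl)
  moreover have "st_eqv B1 (cone u @ inverse_word (cone v) @ cone v) (cone u)"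
    using uv by (intro S1.eqv_append_Nil(2) S1.inverse_word_append cone_words presentation_eq.refl)
  ultimately show ?case using fills_eqv by blast
next
  case (trans u v w)
  then obtain z z' where z: "fills z (cone u) (cone v)" and z': "fills z' (cone v) (cone w)" by blast
  have uvw: "u \<in> st_words B0" "v \<in> st_words B0" "w \<in> st_words B0"
    using presentation.eqv_words[OF presentation_st[OF B0]] trans.hyps by auto
  \<comment> \<open>Composition: the constant homotopy of \<open>cone v\<close>, inverted, is put
    between the two fillers, so that the faces become u v^-1 v and v v^-1 w.\<close>
  from fills_append[OF fills_append[OF z fills_inverse[OF fills_cone[OF uvw(2)]]] z']
  obtain z'' where "fills z'' (cone u @ inverse_word (cone v) @ cone v) ((cone v @ inverse_word (cone v)) @ cone w)"
    by auto
  moreover have "st_eqv B1 ((cone v @ inverse_word (cone v)) @ cone w) (cone w)"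
    using uvw by (intro S1.eqv_append_Nil(1) S1.append_inverse_word cone_words presentation_eq.refl)
  moreover have "st_eqv B1 (cone u @ inverse_word (cone v) @ cone v) (cone u)"
    using uvw by (intro S1.eqv_append_Nil(2) S1.inverse_word_append cone_words presentation_eq.refl)
  ultimately show ?case using fills_eqv by blast
next
  case (append u u' v v')
  then show ?case using fills_append unfolding cone_def word_map_simps by blast
qed

lemma fills_cone_Nil:
  assumes "st_eqv B0 u []"
  shows "\<exists>z. fills z (cone u) []" and "\<exists>z. fills z [] (cone u)"
  using cone_eqv_fills[OF assms] cone_eqv_fills[OF presentation_eq.sym[OF assms]]
  by (simp_all add: cone_def)

end

section \<open>Connectedness of the Steinberg group\<close>

text \<open>All that path arguments use about levels zero and one of the standard simplicial ring.
  The map \<open>d0\<close> evaluates at the end where \<open>t1\<close> is one, and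
  \<open>d1\<close> at the end where \<open>t0\<close> is one.\<close>

locale ring_interval = A0: cring A0 + A1: cring A1
  for A0 :: "('a, 'k) ring_scheme" and A1 :: "('b, 'l) ring_scheme" +
  fixes d0 d1 :: "'b \<Rightarrow> 'a" and s :: "'a \<Rightarrow> 'b" and t0 t1 :: 'b
  assumes d0_hom: "d0 \<in> Ring.ring_hom A1 A0" and d1_hom: "d1 \<in> Ring.ring_hom A1 A0"
    and s_hom: "s \<in> Ring.ring_hom A0 A1"
    and t_closed: "t0 \<in> carrier A1" "t1 \<in> carrier A1"
    and d_s: "a \<in> carrier A0 \<Longrightarrow> d0 (s a) = a" "a \<in> carrier A0 \<Longrightarrow> d1 (s a) = a"
    and d_t: "d0 t0 = \<zero>\<^bsub>A0\<^esub>" "d0 t1 = \<one>\<^bsub>A0\<^esub>" "d1 t0 = \<one>\<^bsub>A0\<^esub>" "d1 t1 = \<zero>\<^bsub>A0\<^esub>"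
begin

sublocale d0: ring_hom_cring A1 A0 d0 by unfold_locales (rule d0_hom)
sublocale d1: ring_hom_cring A1 A0 d1 by unfold_locales (rule d1_hom)
sublocale s: ring_hom_cring A0 A1 s by unfold_locales (rule s_hom)

end

text \<open>Level two is added through simplicial identities and the restrictions of barycentric
  coordinates to the edges. With these as assumptions, the Steinberg part never sees quotients of
  polynomial rings.\<close>

locale ring_triangle = ring_interval A0 A1 d0 d1 s t0 t1 + A2: cring A2
  for A0 :: "('a, 'k) ring_scheme" and A1 :: "('b, 'l) ring_scheme" and d0 d1 s t0 t1
    and A2 :: "('c, 'm) ring_scheme" +
  fixes e0 e1 e2 :: "'c \<Rightarrow> 'b" and s0 s1 :: "'b \<Rightarrow> 'c" and u0 u1 u2 :: 'c
  assumes e0_hom: "e0 \<in> Ring.ring_hom A2 A1" and e1_hom: "e1 \<in> Ring.ring_hom A2 A1"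
    and e2_hom: "e2 \<in> Ring.ring_hom A2 A1"
    and s0_hom: "s0 \<in> Ring.ring_hom A1 A2" and s1_hom: "s1 \<in> Ring.ring_hom A1 A2"
    and u_closed: "u0 \<in> carrier A2" "u1 \<in> carrier A2" "u2 \<in> carrier A2"
    and e_s: "b \<in> carrier A1 \<Longrightarrow> e0 (s0 b) = b" "b \<in> carrier A1 \<Longrightarrow> e1 (s0 b) = b"
      "b \<in> carrier A1 \<Longrightarrow> e1 (s1 b) = b" "b \<in> carrier A1 \<Longrightarrow> e2 (s1 b) = b"
      "b \<in> carrier A1 \<Longrightarrow> e0 (s1 b) = s (d0 b)" "b \<in> carrier A1 \<Longrightarrow> e2 (s0 b) = s (d1 b)"
    and e_u: "e0 u0 = \<zero>\<^bsub>A1\<^esub>" "e0 u1 = t0" "e0 u2 = t1" "e1 u0 = t0" "e1 u1 = \<zero>\<^bsub>A1\<^esub>" "e1 u2 = t1"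
      "e2 u0 = t0" "e2 u1 = t1" "e2 u2 = \<zero>\<^bsub>A1\<^esub>"
    and t_sum: "t0 \<oplus>\<^bsub>A1\<^esub> t1 = \<one>\<^bsub>A1\<^esub>"
begin

sublocale e0: ring_hom_cring A2 A1 e0 by unfold_locales (rule e0_hom)
sublocale e1: ring_hom_cring A2 A1 e1 by unfold_locales (rule e1_hom)
sublocale e2: ring_hom_cring A2 A1 e2 by unfold_locales (rule e2_hom)
sublocale s0: ring_hom_cring A1 A2 s0 by unfold_locales (rule s0_hom)
sublocale s1: ring_hom_cring A1 A2 s1 by unfold_locales (rule s1_hom)

end

section \<open>Paths and loops in the Steinberg group over an abstract interval and triangle\<close>

context steinberg_data
begin

abbreviation st_cls :: "('r, 'm) ring_scheme \<Rightarrow> ('v \<times> 'r) group_word \<Rightarrow> ('v \<times> 'r) group_word set" where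
  "st_cls A \<equiv> presentation_class (steinberg_generators \<Phi> A) (steinberg_relations \<Phi> ord N A)"

lemma steinberg_group_simps:
  "carrier (steinberg_group \<Phi> ord N A) = st_cls A ` st_words A"
  "\<one>\<^bsub>steinberg_group \<Phi> ord N A\<^esub> = st_cls A []"
  by (simp_all add: steinberg_group_def presented_group_def)

text \<open>The union over all representatives in \<open>steinberg_map\<close> is a single class,
  because equivalent representatives have equivalent images.\<close>

lemma steinberg_map_cls:
  assumes AB: "cring A" "cring B" and f: "f \<in> Ring.ring_hom A B" and w: "w \<in> st_words A"
  shows "steinberg_map \<Phi> ord N A B f (st_cls A w) = st_cls B (word_map f w)"
proof -
  have "st_cls B (word_map f v) = st_cls B (word_map f w)" if "v \<in> st_cls A w" for v
  proof -
    have "st_eqv A v w"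
      using that unfolding presentation_class_def by (auto intro: presentation_eq.sym)
    from word_map_hom_eqv[OF AB f this] show ?thesis
      by (rule presentation.cls_eqI[OF presentation_st[OF AB(2)]])
  qed
  moreover have "w \<in> st_cls A w"
    using w by (simp add: presentation_class_def presentation_eq.refl del: in_lists_conv_set)
  ultimately show ?thesis
    unfolding steinberg_map_def word_map_def[symmetric] by blast
qed

text \<open>The path is the product of two contractions, \<open>u\<close> scaled by
  \<open>t1\<close> and \<open>v\<close> scaled by \<open>t0\<close>; at each end one factor is a
  zero word and the other is undisturbed.\<close>

lemma st_words_connected:
  assumes "ring_interval A0 A1 d0 d1 s t0 t1" and u: "u \<in> st_words A0" and v: "v \<in> st_words A0"
  shows "\<exists>z\<in>st_words A1. st_eqv A0 (word_map d0 z) u \<and> st_eqv A0 (word_map d1 z) v"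
proof -
  interpret ring_interval A0 A1 d0 d1 s t0 t1 by fact
  interpret presentation "steinberg_generators \<Phi> A0" "steinberg_relations \<Phi> ord N A0"
    by (rule presentation_st) unfold_locales
  define z where "z = word_map (\<lambda>a. t1 \<otimes>\<^bsub>A1\<^esub> s a) u @ word_map (\<lambda>a. t0 \<otimes>\<^bsub>A1\<^esub> s a) v"
  have "word_map d0 z = word_map (\<lambda>a. a) u @ word_map (\<lambda>_. \<zero>\<^bsub>A0\<^esub>) v"
    unfolding z_def word_map_simps word_map_word_map
    by (intro arg_cong2[where f = append]; rule word_map_cong[where A = A0])
      (use u v t_closed d_s d_t in \<open>auto simp del: in_lists_conv_set\<close>)
  moreover have "word_map d1 z = word_map (\<lambda>_. \<zero>\<^bsub>A0\<^esub>) u @ word_map (\<lambda>a. a) v"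
    unfolding z_def word_map_simps word_map_word_map
    by (intro arg_cong2[where f = append]; rule word_map_cong[where A = A0])
      (use u v t_closed d_s d_t in \<open>auto simp del: in_lists_conv_set\<close>)
  moreover have "z \<in> st_words A1"
  proof -
    have "word_map (\<lambda>a. t1 \<otimes>\<^bsub>A1\<^esub> s a) u \<in> st_words A1"
      by (rule word_map_words[OF _ u]) (use t_closed in auto)
    moreover have "word_map (\<lambda>a. t0 \<otimes>\<^bsub>A1\<^esub> s a) v \<in> st_words A1"
      by (rule word_map_words[OF _ v]) (use t_closed in auto)
    ultimately show ?thesis by (simp add: z_def)
  qed
  ultimately show ?thesis
    using eqv_append_Nil(2)[OF eqv_zero_word[OF A0.cring_axioms v] presentation_eq.refl[OF u]]
      eqv_append_Nil(1)[OF eqv_zero_word[OF A0.cring_axioms u] presentation_eq.refl[OF v]]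
    by (metis word_map_id)
qed

text \<open>The interpolating triangle already has the right middle face, but its outer faces are
  cones over the ends of \<open>w\<close>. These ends are trivial words, so each cone has a filler
  with trivial remaining faces, and dividing by the two fillers repairs the outer faces without
  disturbing the middle one.\<close>

lemma st_loop_fill:
  assumes "ring_triangle A0 A1 d0 d1 s t0 t1 A2 e0 e1 e2 s0 s1 u0 u1 u2"
    and rank: "root_rank \<Phi> \<noteq> 1" and w: "w \<in> st_words A1"
    and w0: "st_eqv A0 (word_map d0 w) []" and w1: "st_eqv A0 (word_map d1 w) []"
  shows "\<exists>z\<in>st_words A2. st_eqv A1 (word_map e0 z) [] \<and> st_eqv A1 (word_map e1 z) w \<and>
    st_eqv A1 (word_map e2 z) []"
proof -
  interpret ring_triangle A0 A1 d0 d1 s t0 t1 A2 e0 e1 e2 s0 s1 u0 u1 u2 by fact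
  interpret F: triangle_filling \<Phi> ord N A0 A1 A2 s s1 e0 e1 e2 t0 "u0 \<oplus>\<^bsub>A2\<^esub> u1"
    by unfold_locales (use rank s_hom s1_hom e0_hom e1_hom e2_hom t_closed u_closed e_s e_u d_t t_sum in auto)
  \<comment> \<open>The same data with the vertices in reverse order: the faces \<open>e0\<close>
    and \<open>e2\<close>, the degeneracies \<open>s0\<close> and \<open>s1\<close> and the
    coordinates are exchanged, while \<open>e1\<close> stays in the middle.\<close>
  interpret F': triangle_filling \<Phi> ord N A0 A1 A2 s s0 e2 e1 e0 t1 "u1 \<oplus>\<^bsub>A2\<^esub> u2"
    by unfold_locales (use rank s_hom s0_hom e0_hom e1_hom e2_hom t_closed u_closed e_s e_u d_t t_sum in auto)
  \<comment> \<open>Both degeneracies have \<open>a\<close> as their middle face, where the weights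
    \<open>u2\<close> and \<open>u0\<close> add up to one. On each outer face one weight vanishes,
    and the remaining degeneracy is there the constant path at an end of \<open>a\<close>; what is
    left is a cone.\<close>
  define f where "f a = u2 \<otimes>\<^bsub>A2\<^esub> s1 a \<oplus>\<^bsub>A2\<^esub> u0 \<otimes>\<^bsub>A2\<^esub> s0 a" for a
  define Z where "Z = word_map f w"
  have Z: "Z \<in> st_words A2"
    unfolding Z_def by (rule word_map_words[OF _ w]) (use u_closed in \<open>auto simp: f_def\<close>)
  have Z0: "word_map e0 Z = F'.cone (word_map d0 w)"
    unfolding Z_def F'.cone_def word_map_word_map
    by (rule word_map_cong[OF _ w]) (use u_closed t_closed e_s e_u in \<open>auto simp: f_def\<close>)
  have Z2: "word_map e2 Z = F.cone (word_map d1 w)"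
    unfolding Z_def F.cone_def word_map_word_map
    by (rule word_map_cong[OF _ w]) (use u_closed t_closed e_s e_u in \<open>auto simp: f_def\<close>)
  have "word_map e1 Z = word_map (\<lambda>a. a) w"
    unfolding Z_def word_map_word_map
  proof (rule word_map_cong[OF _ w])
    fix a assume a: "a \<in> carrier A1"
    have "e1 (f a) = (t1 \<oplus>\<^bsub>A1\<^esub> t0) \<otimes>\<^bsub>A1\<^esub> a"
      using a u_closed t_closed e_s e_u by (simp add: f_def A1.l_distr)
    then show "e1 (f a) = a"
      using a t_closed t_sum by (simp add: A1.a_comm)
  qed
  then have Z1: "word_map e1 Z = w" by (simp add: word_map_id)
  obtain z where z: "F.fills z [] (F.cone (word_map d1 w))"
    using F.fills_cone_Nil(2)[OF w1] by blast
  obtain z' where z': "F'.fills z' [] (F'.cone (word_map d0 w))"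
    using F'.fills_cone_Nil(2)[OF w0] by blast
  note iz = conjunct1[OF F.fills_inverse[OF z, unfolded F.fills_def]]
    conjunct2[OF F.fills_inverse[OF z, unfolded F.fills_def]]
  note iz' = conjunct1[OF F'.fills_inverse[OF z', unfolded F'.fills_def]]
    conjunct2[OF F'.fills_inverse[OF z', unfolded F'.fills_def]]
  \<comment> \<open>Under \<open>e0\<close>, \<open>e1\<close>, \<open>e2\<close> the filler
    \<open>z\<close> is trivial, trivial and the cone over \<open>word_map d1 w\<close>. Because of
    the reversed order \<open>z'\<close> is the cone over \<open>word_map d0 w\<close>, trivial and
    trivial. The two corrections thus act on different faces of \<open>Z\<close>.\<close>
  let ?z = "Z @ inverse_word z @ inverse_word z'"
  note c = F'.cone_words[OF word_map_words[OF d0.hom_closed w]] F.cone_words[OF word_map_words[OF d1.hom_closed w]]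
  have nil: "inverse_word [] = []" by (simp add: inverse_word_def)
  have "st_eqv A1 (F'.cone (word_map d0 w) @ word_map e0 (inverse_word z) @ word_map e0 (inverse_word z'))
      (F'.cone (word_map d0 w) @ [] @ inverse_word (F'.cone (word_map d0 w)))"
    by (rule presentation_eq.append[OF presentation_eq.refl[OF c(1)] presentation_eq.append[OF
          conjunct1[OF iz(2)] conjunct2[OF conjunct2[OF iz'(2)]]]])
  moreover have "st_eqv A1 (F'.cone (word_map d0 w) @ [] @ inverse_word (F'.cone (word_map d0 w))) []"
    using F.S1.append_inverse_word[OF c(1)] by simp
  ultimately have E0: "st_eqv A1 (word_map e0 ?z) []"
    unfolding word_map_simps(2) Z0 by (rule presentation_eq.trans)
  have "st_eqv A1 (w @ word_map e1 (inverse_word z) @ word_map e1 (inverse_word z')) (w @ inverse_word [] @ inverse_word [])"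
    by (rule presentation_eq.append[OF presentation_eq.refl[OF w] presentation_eq.append[OF
          conjunct1[OF conjunct2[OF iz(2)]] conjunct1[OF conjunct2[OF iz'(2)]]]])
  then have E1: "st_eqv A1 (word_map e1 ?z) w"
    unfolding word_map_simps(2) Z1 nil by simp
  have "st_eqv A1 (F.cone (word_map d1 w) @ word_map e2 (inverse_word z) @ word_map e2 (inverse_word z'))
      (F.cone (word_map d1 w) @ inverse_word (F.cone (word_map d1 w)) @ [])"
    by (rule presentation_eq.append[OF presentation_eq.refl[OF c(2)] presentation_eq.append[OF
          conjunct2[OF conjunct2[OF iz(2)]] conjunct1[OF iz'(2)]]])
  moreover have "st_eqv A1 (F.cone (word_map d1 w) @ inverse_word (F.cone (word_map d1 w)) @ []) []"
    using F.S1.append_inverse_word[OF c(2)] by simp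
  ultimately have E2: "st_eqv A1 (word_map e2 ?z) []"
    unfolding word_map_simps(2) Z2 by (rule presentation_eq.trans)
  have "?z \<in> st_words A2" using Z iz(1) iz'(1) by (simp only: append_in_lists_conv)
  then show ?thesis by (intro bexI[of _ ?z] conjI E0 E1 E2)
qed

end

section \<open>Integral polynomials\<close>

text \<open>A type-class ring as a ring record; it serves for the integers, for the complex numbers
  and for Z[X], so that one theory of matrices and evaluation covers all of them.\<close>

definition type_ring :: "'a::comm_ring_1 ring" where
  "type_ring = \<lparr> carrier = UNIV, monoid.mult = (*), one = 1, ring.zero = 0, add = (+) \<rparr>"

lemma type_ring_simps [simp]:
  "carrier type_ring = UNIV" "monoid.mult type_ring = (*)" "one type_ring = 1"
  "ring.zero type_ring = 0" "add type_ring = (+)"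
  by (simp_all add: type_ring_def)

lemma cring_type_ring: "cring (type_ring :: 'a::comm_ring_1 ring)"
proof (intro cringI abelian_groupI comm_monoidI)
  fix x :: 'a
  show "\<exists>y\<in>carrier type_ring. y \<oplus>\<^bsub>type_ring\<^esub> x = \<zero>\<^bsub>type_ring\<^esub>"
    by (rule bexI[of _ "- x"]) auto
qed (auto simp: algebra_simps)

lemma finsum_type_ring: "finsum type_ring f I = sum f I"
  for f :: "'c \<Rightarrow> 'b::comm_ring_1"
proof -
  interpret cring "type_ring :: 'b ring" by (rule cring_type_ring)
  show ?thesis
    by (induction I rule: infinite_finite_induct) (auto simp: finsum_insert)
qed

lemma int_pow_type_ring: "add_pow type_ring (k::int) x = of_int k * x"
  for x :: "'b::comm_ring_1"
proof -
  interpret cring "type_ring :: 'b ring" by (rule cring_type_ring)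
  have nat: "add_pow type_ring (m::nat) x = of_nat m * x" for m
    by (induction m) (auto simp: add_pow_def nat_pow_def algebra_simps)
  have neg: "\<ominus>\<^bsub>type_ring\<^esub> y = - y" for y :: 'b
    by (rule minus_equality) auto
  show ?thesis
    by (cases "k \<ge> 0") (auto simp: add_pow_int_ge add_pow_int_lt nat neg)
qed

lemma complex_ring_eq: "complex_ring = type_ring"
  by (simp add: complex_ring_def type_ring_def)

lemma int_ring_eq: "int_ring = type_ring"
  by (simp add: type_ring_def)

lemma (in abelian_group) finsum_swap:
  assumes "finite I" "finite J" "\<And>i j. i \<in> I \<Longrightarrow> j \<in> J \<Longrightarrow> g i j \<in> carrier G"
  shows "(\<Oplus>i\<in>I. \<Oplus>j\<in>J. g i j) = (\<Oplus>j\<in>J. \<Oplus>i\<in>I. g i j)"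
  using assms(1,3)
proof (induction I rule: finite_induct)
  case (insert i I)
  have "(\<Oplus>j\<in>J. \<Oplus>i\<in>insert i I. g i j) = (\<Oplus>j\<in>J. g i j \<oplus> (\<Oplus>i\<in>I. g i j))"
    by (rule finsum_cong') (use insert in \<open>auto simp: Pi_def intro!: finsum_closed\<close>)
  also have "\<dots> = (\<Oplus>j\<in>J. g i j) \<oplus> (\<Oplus>j\<in>J. \<Oplus>i\<in>I. g i j)"
    by (rule finsum_addf) (use insert in \<open>auto intro!: finsum_closed\<close>)
  finally show ?case
    using insert by (simp add: finsum_insert Pi_def finsum_closed)
qed (use assms(2) in \<open>simp add: add.finprod_one_eqI\<close>)

context cring
begin

lemma int_pow_scale:
  "x \<in> carrier R \<Longrightarrow> add_pow R (k::int) x = add_pow R k \<one> \<otimes> x"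
  using add_pow_ldistr_int[of \<one> x k] by simp

lemma int_pow_zero [simp]: "add_pow R (0::int) x = \<zero>"
  by (simp add: add_pow_int_ge)

lemma int_one_mult: "add_pow R (k * l :: int) \<one> = add_pow R k \<one> \<otimes> add_pow R l \<one>"
proof -
  have "add_pow R (k * l) \<one> = add_pow R k (add_pow R l \<one>)"
    using add.int_pow_pow[of \<one> k l] by (simp add: mult.commute)
  also have "\<dots> = add_pow R k \<one> \<otimes> add_pow R l \<one>"
    by (rule int_pow_scale) simp
  finally show ?thesis .
qed

end

text \<open>This is the homomorphism from Z[X] to \<open>A\<close> that sends X to \<xi>; it
  specialises generic matrices over Z[X] to an arbitrary commutative ring.\<close>

definition int_poly_eval :: "('r, 'm) ring_scheme \<Rightarrow> 'r \<Rightarrow> int poly \<Rightarrow> 'r" where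
  "int_poly_eval A \<xi> p = (\<Oplus>\<^bsub>A\<^esub>k\<in>{..Polynomial.degree p}. add_pow A (Polynomial.coeff p k) (\<xi> [^]\<^bsub>A\<^esub> k))"

context cring
begin

text \<open>Frees the sum from the degree, which may drop when polynomials are added, so that sums
  for different polynomials can be compared termwise.\<close>

lemma int_poly_eval_superset:
  assumes "\<xi> \<in> carrier R" "finite I" "\<And>k. k \<notin> I \<Longrightarrow> Polynomial.coeff p k = 0"
  shows "int_poly_eval R \<xi> p = (\<Oplus>k\<in>I. add_pow R (Polynomial.coeff p k) (\<xi> [^] k))"
  unfolding int_poly_eval_def
  by (rule add.finprod_mono_neutral_cong)
    (use assms in \<open>auto simp: coeff_eq_0\<close>)

lemma int_poly_eval_closed [simp]: "\<xi> \<in> carrier R \<Longrightarrow> int_poly_eval R \<xi> p \<in> carrier R"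
  unfolding int_poly_eval_def by (auto intro!: finsum_closed)

lemma int_poly_eval_0 [simp]: "\<xi> \<in> carrier R \<Longrightarrow> int_poly_eval R \<xi> 0 = \<zero>"
  unfolding int_poly_eval_def by simp

lemma int_poly_eval_add:
  assumes "\<xi> \<in> carrier R"
  shows "int_poly_eval R \<xi> (p + q) = int_poly_eval R \<xi> p \<oplus> int_poly_eval R \<xi> q"
proof -
  let ?I = "{..max (Polynomial.degree p) (Polynomial.degree q)}"
  have *: "int_poly_eval R \<xi> r = (\<Oplus>k\<in>?I. add_pow R (Polynomial.coeff r k) (\<xi> [^] k))" if "r \<in> {p, q, p + q}" for r
    by (rule int_poly_eval_superset) (use assms that in \<open>auto simp: coeff_eq_0\<close>)
  show ?thesis
    using assms by (simp add: * add.int_pow_mult finsum_addf Pi_def)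
qed

text \<open>Horner's rule. Multiplicativity, substitution and naturality of the evaluation become
  inductions along \<open>pCons\<close> through it.\<close>

lemma int_poly_eval_pCons:
  assumes \<xi>: "\<xi> \<in> carrier R"
  shows "int_poly_eval R \<xi> (pCons c p) = add_pow R c \<one> \<oplus> \<xi> \<otimes> int_poly_eval R \<xi> p"
proof -
  let ?n = "Polynomial.degree p"
  have "int_poly_eval R \<xi> (pCons c p) = (\<Oplus>k\<in>{..Suc ?n}. add_pow R (Polynomial.coeff (pCons c p) k) (\<xi> [^] k))"
    by (rule int_poly_eval_superset) (use \<xi> in \<open>auto simp: coeff_pCons coeff_eq_0 split: nat.splits\<close>)
  also have "\<dots> = (\<Oplus>k\<in>{..?n}. add_pow R (Polynomial.coeff p k) (\<xi> [^] Suc k)) \<oplus> add_pow R c \<one>"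
    by (subst finsum_Suc2) (use \<xi> in auto)
  also have "(\<Oplus>k\<in>{..?n}. add_pow R (Polynomial.coeff p k) (\<xi> [^] Suc k)) =
      (\<Oplus>k\<in>{..?n}. \<xi> \<otimes> add_pow R (Polynomial.coeff p k) (\<xi> [^] k))"
    by (rule finsum_cong') (use \<xi> in \<open>auto simp: add_pow_rdistr_int m_comm\<close>)
  also have "\<dots> = \<xi> \<otimes> int_poly_eval R \<xi> p"
    unfolding int_poly_eval_def by (subst finsum_rdistr) (use \<xi> in auto)
  finally show ?thesis using \<xi> by (simp add: a_comm)
qed

lemma int_poly_eval_smult:
  assumes \<xi>: "\<xi> \<in> carrier R"
  shows "int_poly_eval R \<xi> (Polynomial.smult c p) = add_pow R c \<one> \<otimes> int_poly_eval R \<xi> p"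
proof (induction p)
  case (pCons a p)
  then show ?case
    using \<xi> by (simp add: int_poly_eval_pCons int_one_mult r_distr m_lcomm)
qed (use \<xi> in auto)

lemma int_poly_eval_mult:
  assumes \<xi>: "\<xi> \<in> carrier R"
  shows "int_poly_eval R \<xi> (p * q) = int_poly_eval R \<xi> p \<otimes> int_poly_eval R \<xi> q"
proof (induction p)
  case (pCons a p)
  then show ?case
    using \<xi> by (simp add: int_poly_eval_add int_poly_eval_pCons int_poly_eval_smult l_distr m_assoc)
qed (use \<xi> in auto)

lemma int_poly_eval_ring_hom:
  assumes "\<xi> \<in> carrier R"
  shows "int_poly_eval R \<xi> \<in> Ring.ring_hom type_ring R"
proof (rule ring_hom_memI)
  have "int_poly_eval R \<xi> [:1:] = \<one>"
    using assms by (subst int_poly_eval_pCons) auto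
  then show "int_poly_eval R \<xi> \<one>\<^bsub>type_ring\<^esub> = \<one>" by (simp add: one_pCons)
qed (use assms in \<open>auto simp: int_poly_eval_add int_poly_eval_mult\<close>)

text \<open>Here \<open>[:0, -1:]\<close> is the polynomial -X; passing to the inverse of a
  unipotent thereby becomes an operation on the generic matrix.\<close>

lemma int_poly_eval_uminus:
  assumes \<xi>: "\<xi> \<in> carrier R"
  shows "int_poly_eval R (\<ominus> \<xi>) p = int_poly_eval R \<xi> (pcompose p [:0, -1:])"
proof (induction p)
  case (pCons a p)
  have "int_poly_eval R \<xi> [:0, -1:] = \<ominus> \<xi>"
    using \<xi> by (subst int_poly_eval_pCons, simp, subst int_poly_eval_pCons) (auto simp: r_minus add.int_pow_neg)
  moreover have "int_poly_eval R \<xi> [:a:] = add_pow R a \<one>"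
    using \<xi> by (subst int_poly_eval_pCons) auto
  ultimately show ?case
    using \<xi> pCons by (simp only: pcompose_pCons int_poly_eval_add int_poly_eval_mult int_poly_eval_pCons a_inv_closed)
qed (use \<xi> in auto)

lemma int_poly_eval_at_zero: "int_poly_eval R \<zero> p = add_pow R (Polynomial.coeff p 0) \<one>"
  by (cases p) (auto simp: int_poly_eval_pCons)

end

lemma int_poly_eval_type_ring: "int_poly_eval type_ring x p = poly (map_poly of_int p) x"
  for x :: "'b::comm_ring_1"
proof -
  interpret cring "type_ring :: 'b ring" by (rule cring_type_ring)
  show ?thesis
  proof (induction p)
    case (pCons a p)
    then show ?case by (simp add: int_poly_eval_pCons int_pow_type_ring map_poly_pCons)
  qed (use int_poly_eval_0[of x] in auto)
qed

lemma hom_int_poly_eval: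
  assumes "ring_hom_cring A B f" "\<xi> \<in> carrier A"
  shows "f (int_poly_eval A \<xi> p) = int_poly_eval B (f \<xi>) p"
proof -
  interpret ring_hom_cring A B f by fact
  have one: "f (add_pow A (k::int) \<one>\<^bsub>A\<^esub>) = add_pow B k \<one>\<^bsub>B\<^esub>" for k
  proof -
    interpret ring_hom_ring A B f
      by (intro ring_hom_ringI2 homh) unfold_locales
    have "group_hom (add_monoid A) (add_monoid B) f" by (rule ring.a_group_hom)
    from group_hom.hom_int_pow[OF this, of "\<one>\<^bsub>A\<^esub>" k] show ?thesis by (simp add: add_pow_def)
  qed
  show ?thesis
    by (induction p) (use assms(2) in \<open>auto simp: R.int_poly_eval_pCons S.int_poly_eval_pCons one\<close>)
qed

section \<open>Matrices over ring records\<close>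

lemma matrix_monoid_carrier:
  "M \<in> carrier (matrix_monoid A n) \<longleftrightarrow>
     M \<in> carrier_mat n n \<and> (\<forall>i<n. \<forall>j<n. M $$ (i, j) \<in> carrier A)"
proof -
  have "elements_mat M = {M $$ (i, j) | i j. i < n \<and> j < n}" if "M \<in> carrier_mat n n"
    using that unfolding elements_mat_def by auto force
  then show ?thesis unfolding matrix_monoid_def by auto
qed

lemma matrix_monoid_mult_index:
  "i < n \<Longrightarrow> j < n \<Longrightarrow> (M \<otimes>\<^bsub>matrix_monoid A n\<^esub> M') $$ (i, j) =
     (\<Oplus>\<^bsub>A\<^esub>k\<in>{..<n}. M $$ (i, k) \<otimes>\<^bsub>A\<^esub> M' $$ (k, j))"
  by (simp add: matrix_monoid_def)

lemma matrix_monoid_one_index: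
  "i < n \<Longrightarrow> j < n \<Longrightarrow> \<one>\<^bsub>matrix_monoid A n\<^esub> $$ (i, j) = (if i = j then \<one>\<^bsub>A\<^esub> else \<zero>\<^bsub>A\<^esub>)"
  by (simp add: matrix_monoid_def)

lemma matrix_monoid_dim [simp]:
  "M \<otimes>\<^bsub>matrix_monoid A n\<^esub> M' \<in> carrier_mat n n" "\<one>\<^bsub>matrix_monoid A n\<^esub> \<in> carrier_mat n n"
  "dim_row (M \<otimes>\<^bsub>matrix_monoid A n\<^esub> M') = n" "dim_col (M \<otimes>\<^bsub>matrix_monoid A n\<^esub> M') = n"
  "dim_row (\<one>\<^bsub>matrix_monoid A n\<^esub>) = n" "dim_col (\<one>\<^bsub>matrix_monoid A n\<^esub>) = n"
  by (simp_all add: matrix_monoid_def)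

lemma monoid_matrix_monoid:
  assumes "cring A"
  shows "Group.monoid (matrix_monoid A n)"
proof
  interpret A: cring A by fact
  let ?G = "matrix_monoid A n"
  fix x y z assume x: "x \<in> carrier ?G" and y: "y \<in> carrier ?G"
  show "x \<otimes>\<^bsub>?G\<^esub> y \<in> carrier ?G"
    using x y by (auto simp: matrix_monoid_carrier matrix_monoid_mult_index intro!: A.finsum_closed)
  show "\<one>\<^bsub>?G\<^esub> \<otimes>\<^bsub>?G\<^esub> x = x"
  proof (rule eq_matI)
    fix i j assume "i < dim_row x" "j < dim_col x"
    then have ij: "i < n" "j < n" using x by (auto simp: matrix_monoid_carrier)
    have "(\<one>\<^bsub>?G\<^esub> \<otimes>\<^bsub>?G\<^esub> x) $$ (i, j) = (\<Oplus>\<^bsub>A\<^esub>k\<in>{..<n}. if i = k then x $$ (k, j) else \<zero>\<^bsub>A\<^esub>)"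
      unfolding matrix_monoid_mult_index[OF ij]
      by (rule A.finsum_cong') (use ij x in \<open>auto simp: matrix_monoid_carrier matrix_monoid_one_index\<close>)
    also have "\<dots> = x $$ (i, j)"
      by (rule A.finsum_singleton) (use ij x in \<open>auto simp: matrix_monoid_carrier\<close>)
    finally show "(\<one>\<^bsub>?G\<^esub> \<otimes>\<^bsub>?G\<^esub> x) $$ (i, j) = x $$ (i, j)" .
  qed (use x in \<open>auto simp: matrix_monoid_carrier\<close>)
  show "x \<otimes>\<^bsub>?G\<^esub> \<one>\<^bsub>?G\<^esub> = x"
  proof (rule eq_matI)
    fix i j assume "i < dim_row x" "j < dim_col x"
    then have ij: "i < n" "j < n" using x by (auto simp: matrix_monoid_carrier)
    have "(x \<otimes>\<^bsub>?G\<^esub> \<one>\<^bsub>?G\<^esub>) $$ (i, j) = (\<Oplus>\<^bsub>A\<^esub>k\<in>{..<n}. if j = k then x $$ (i, k) else \<zero>\<^bsub>A\<^esub>)"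
      unfolding matrix_monoid_mult_index[OF ij]
      by (rule A.finsum_cong') (use ij x in \<open>auto simp: matrix_monoid_carrier matrix_monoid_one_index\<close>)
    also have "\<dots> = x $$ (i, j)"
      by (rule A.finsum_singleton) (use ij x in \<open>auto simp: matrix_monoid_carrier\<close>)
    finally show "(x \<otimes>\<^bsub>?G\<^esub> \<one>\<^bsub>?G\<^esub>) $$ (i, j) = x $$ (i, j)" .
  qed (use x in \<open>auto simp: matrix_monoid_carrier\<close>)
  assume z: "z \<in> carrier ?G"
  note c = x[unfolded matrix_monoid_carrier] y[unfolded matrix_monoid_carrier] z[unfolded matrix_monoid_carrier]
  show "x \<otimes>\<^bsub>?G\<^esub> y \<otimes>\<^bsub>?G\<^esub> z = x \<otimes>\<^bsub>?G\<^esub> (y \<otimes>\<^bsub>?G\<^esub> z)"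
  proof (rule eq_matI)
    fix i j assume "i < dim_row (x \<otimes>\<^bsub>?G\<^esub> (y \<otimes>\<^bsub>?G\<^esub> z))" "j < dim_col (x \<otimes>\<^bsub>?G\<^esub> (y \<otimes>\<^bsub>?G\<^esub> z))"
    then have ij: "i < n" "j < n" by auto
    have "(x \<otimes>\<^bsub>?G\<^esub> y \<otimes>\<^bsub>?G\<^esub> z) $$ (i, j) =
        (\<Oplus>\<^bsub>A\<^esub>k\<in>{..<n}. \<Oplus>\<^bsub>A\<^esub>l\<in>{..<n}. x $$ (i, l) \<otimes>\<^bsub>A\<^esub> y $$ (l, k) \<otimes>\<^bsub>A\<^esub> z $$ (k, j))"
      unfolding matrix_monoid_mult_index[OF ij]
      by (rule A.finsum_cong') (use ij c in \<open>auto simp: matrix_monoid_mult_index A.finsum_ldistr Pi_def intro!: A.finsum_closed\<close>)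
    also have "\<dots> = (\<Oplus>\<^bsub>A\<^esub>l\<in>{..<n}. \<Oplus>\<^bsub>A\<^esub>k\<in>{..<n}. x $$ (i, l) \<otimes>\<^bsub>A\<^esub> y $$ (l, k) \<otimes>\<^bsub>A\<^esub> z $$ (k, j))"
      by (rule A.finsum_swap) (use ij c in auto)
    also have "\<dots> = (\<Oplus>\<^bsub>A\<^esub>l\<in>{..<n}. x $$ (i, l) \<otimes>\<^bsub>A\<^esub> (\<Oplus>\<^bsub>A\<^esub>k\<in>{..<n}. y $$ (l, k) \<otimes>\<^bsub>A\<^esub> z $$ (k, j)))"
    proof (rule A.finsum_cong')
      fix l assume l: "l \<in> {..<n}"
      have "(\<Oplus>\<^bsub>A\<^esub>k\<in>{..<n}. x $$ (i, l) \<otimes>\<^bsub>A\<^esub> y $$ (l, k) \<otimes>\<^bsub>A\<^esub> z $$ (k, j)) =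
          (\<Oplus>\<^bsub>A\<^esub>k\<in>{..<n}. x $$ (i, l) \<otimes>\<^bsub>A\<^esub> (y $$ (l, k) \<otimes>\<^bsub>A\<^esub> z $$ (k, j)))"
        by (rule A.finsum_cong') (use ij c l in \<open>auto simp: A.m_assoc\<close>)
      also have "\<dots> = x $$ (i, l) \<otimes>\<^bsub>A\<^esub> (\<Oplus>\<^bsub>A\<^esub>k\<in>{..<n}. y $$ (l, k) \<otimes>\<^bsub>A\<^esub> z $$ (k, j))"
        by (rule A.finsum_rdistr[symmetric]) (use ij c l in auto)
      finally show "(\<Oplus>\<^bsub>A\<^esub>k\<in>{..<n}. x $$ (i, l) \<otimes>\<^bsub>A\<^esub> y $$ (l, k) \<otimes>\<^bsub>A\<^esub> z $$ (k, j)) =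
          x $$ (i, l) \<otimes>\<^bsub>A\<^esub> (\<Oplus>\<^bsub>A\<^esub>k\<in>{..<n}. y $$ (l, k) \<otimes>\<^bsub>A\<^esub> z $$ (k, j))" .
    qed (use ij c in \<open>auto intro!: A.finsum_closed A.m_closed\<close>)
    also have "\<dots> = (x \<otimes>\<^bsub>?G\<^esub> (y \<otimes>\<^bsub>?G\<^esub> z)) $$ (i, j)"
      unfolding matrix_monoid_mult_index[OF ij]
      by (rule A.finsum_cong') (use ij c in \<open>auto simp: matrix_monoid_mult_index intro!: A.finsum_closed A.m_closed\<close>)
    finally show "(x \<otimes>\<^bsub>?G\<^esub> y \<otimes>\<^bsub>?G\<^esub> z) $$ (i, j) = (x \<otimes>\<^bsub>?G\<^esub> (y \<otimes>\<^bsub>?G\<^esub> z)) $$ (i, j)" .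
  qed auto
next
  interpret A: cring A by fact
  show "\<one>\<^bsub>matrix_monoid A n\<^esub> \<in> carrier (matrix_monoid A n)"
    by (auto simp: matrix_monoid_carrier matrix_monoid_one_index)
qed

lemma map_mat_matrix_monoid:
  assumes "ring_hom_cring A B f"
  shows "M \<in> carrier (matrix_monoid A n) \<Longrightarrow> map_mat f M \<in> carrier (matrix_monoid B n)"
    and "map_mat f \<one>\<^bsub>matrix_monoid A n\<^esub> = \<one>\<^bsub>matrix_monoid B n\<^esub>"
    and "M \<in> carrier (matrix_monoid A n) \<Longrightarrow> M' \<in> carrier (matrix_monoid A n) \<Longrightarrow>
      map_mat f (M \<otimes>\<^bsub>matrix_monoid A n\<^esub> M') = map_mat f M \<otimes>\<^bsub>matrix_monoid B n\<^esub> map_mat f M'"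
proof -
  interpret ring_hom_cring A B f by fact
  show "M \<in> carrier (matrix_monoid A n) \<Longrightarrow> map_mat f M \<in> carrier (matrix_monoid B n)"
    by (auto simp: matrix_monoid_carrier)
  show "map_mat f \<one>\<^bsub>matrix_monoid A n\<^esub> = \<one>\<^bsub>matrix_monoid B n\<^esub>"
    by (rule eq_matI) (auto simp: matrix_monoid_one_index)
  assume M: "M \<in> carrier (matrix_monoid A n)" "M' \<in> carrier (matrix_monoid A n)"
  show "map_mat f (M \<otimes>\<^bsub>matrix_monoid A n\<^esub> M') = map_mat f M \<otimes>\<^bsub>matrix_monoid B n\<^esub> map_mat f M'"
  proof (rule eq_matI)
    fix i j assume "i < dim_row (map_mat f M \<otimes>\<^bsub>matrix_monoid B n\<^esub> map_mat f M')"
      "j < dim_col (map_mat f M \<otimes>\<^bsub>matrix_monoid B n\<^esub> map_mat f M')"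
    then have ij: "i < n" "j < n" by auto
    have "f (\<Oplus>\<^bsub>A\<^esub>k\<in>{..<n}. M $$ (i, k) \<otimes>\<^bsub>A\<^esub> M' $$ (k, j)) =
      (\<Oplus>\<^bsub>B\<^esub>k\<in>{..<n}. map_mat f M $$ (i, k) \<otimes>\<^bsub>B\<^esub> map_mat f M' $$ (k, j))"
      by (subst hom_finsum, use ij M in \<open>auto simp: matrix_monoid_carrier\<close>)
        (rule S.finsum_cong', use ij M in \<open>auto simp: matrix_monoid_carrier\<close>)
    then show "map_mat f (M \<otimes>\<^bsub>matrix_monoid A n\<^esub> M') $$ (i, j) =
        (map_mat f M \<otimes>\<^bsub>matrix_monoid B n\<^esub> map_mat f M') $$ (i, j)"
      using ij by (simp add: matrix_monoid_mult_index)
  qed auto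
qed

section \<open>Root unipotents\<close>

text \<open>The entries of E^k grow at most geometrically in k and are divisible by k!. A nonzero
  multiple of k! is at least k! in absolute value, which exceeds any geometric bound for large k, so
  the entries must vanish. This makes the index set of the sum in \<open>root_unipotent\<close>
  finite.\<close>

lemma int_mat_nilpotent:
  fixes E :: "int mat"
  assumes E: "E \<in> carrier_mat n n"
    and dvd: "\<And>k i j. i < n \<Longrightarrow> j < n \<Longrightarrow> fact k dvd (E ^\<^sub>m k) $$ (i, j)"
  shows "finite {k. E ^\<^sub>m k \<noteq> 0\<^sub>m n n}"
proof -
  \<comment> \<open>A crude bound for every entry of \<open>E\<close>; an entry of a product of two
    matrices is a sum of n terms, so (n C)^k bounds the entries of the k-th power.\<close>
  define C where "C = (\<Sum>i<n. \<Sum>j<n. \<bar>E $$ (i, j)\<bar>)"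
  have C: "\<bar>E $$ (i, j)\<bar> \<le> C" if "i < n" "j < n" for i j
  proof -
    have "\<bar>E $$ (i, j)\<bar> \<le> (\<Sum>j<n. \<bar>E $$ (i, j)\<bar>)"
      by (rule member_le_sum) (use that in auto)
    moreover have "(\<Sum>j<n. \<bar>E $$ (i, j)\<bar>) \<le> C"
      unfolding C_def by (rule member_le_sum[where f = "\<lambda>i. \<Sum>j<n. \<bar>E $$ (i, j)\<bar>"]) (use that in \<open>auto intro: sum_nonneg\<close>)
    ultimately show ?thesis by linarith
  qed
  have C0: "0 \<le> C" unfolding C_def by (intro sum_nonneg) auto
  have bound: "\<bar>(E ^\<^sub>m k) $$ (i, j)\<bar> \<le> (int n * C) ^ k" if "i < n" "j < n" for i j k
    using that
  proof (induction k arbitrary: j)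
    case 0
    then show ?case using E by auto
  next
    case (Suc k)
    have "(E ^\<^sub>m Suc k) $$ (i, j) = (\<Sum>l<n. (E ^\<^sub>m k) $$ (i, l) * E $$ (l, j))"
      using E Suc.prems by (simp add: scalar_prod_def atLeast0LessThan)
    moreover have "\<bar>\<Sum>l<n. (E ^\<^sub>m k) $$ (i, l) * E $$ (l, j)\<bar> \<le> (\<Sum>l<n. \<bar>(E ^\<^sub>m k) $$ (i, l) * E $$ (l, j)\<bar>)"
      by (rule sum_abs)
    moreover have "(\<Sum>l<n. \<bar>(E ^\<^sub>m k) $$ (i, l) * E $$ (l, j)\<bar>) \<le> (\<Sum>l<n. (int n * C) ^ k * C)"
    proof (rule sum_mono)
      fix l assume "l \<in> {..<n}"
      then show "\<bar>(E ^\<^sub>m k) $$ (i, l) * E $$ (l, j)\<bar> \<le> (int n * C) ^ k * C"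
        unfolding abs_mult using Suc C C0 by (intro mult_mono) auto
    qed
    moreover have "(\<Sum>l<n. (int n * C) ^ k * C) = (int n * C) ^ Suc k" by simp
    ultimately show ?case by linarith
  qed
  \<comment> \<open>These are the terms of a convergent exponential series; from some index on they
    are below one, which means (n C)^k < k!.\<close>
  have "(\<lambda>k. inverse (fact k) * (real n * of_int C) ^ k) \<longlonglongrightarrow> 0"
    by (rule summable_LIMSEQ_zero[OF summable_exp])
  then have "\<forall>\<^sub>F k in sequentially. inverse (fact k) * (real n * of_int C) ^ k < 1"
    by (rule order_tendstoD) simp
  then obtain K where K: "\<And>k. k \<ge> K \<Longrightarrow> inverse (fact k) * (real n * of_int C) ^ k < 1"
    unfolding eventually_sequentially by blast
  have zero: "E ^\<^sub>m k = 0\<^sub>m n n" if "k \<ge> K" for k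
  proof (rule eq_matI)
    fix i j assume "i < dim_row (0\<^sub>m n n :: int mat)" "j < dim_col (0\<^sub>m n n :: int mat)"
    then have ij: "i < n" "j < n" by auto
    have "(real n * of_int C) ^ k < fact k"
      using K[OF that] by (simp add: field_simps)
    then have "real_of_int ((int n * C) ^ k) < real_of_int (fact k)" by simp
    then have "(int n * C) ^ k < fact k" by (simp only: of_int_less_iff)
    then have "\<bar>(E ^\<^sub>m k) $$ (i, j)\<bar> < fact k" using bound[OF ij, of k] by simp
    moreover have "\<bar>fact k\<bar> \<le> \<bar>(E ^\<^sub>m k) $$ (i, j)\<bar>" if "(E ^\<^sub>m k) $$ (i, j) \<noteq> 0"
      by (rule dvd_imp_le_int[OF that dvd[OF ij]])
    ultimately have "(E ^\<^sub>m k) $$ (i, j) = 0"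
      by linarith
    then show "(E ^\<^sub>m k) $$ (i, j) = 0\<^sub>m n n $$ (i, j)" using ij by simp
  qed (use E in \<open>auto simp: pow_mat_dim_square\<close>)
  have "k < K" if "E ^\<^sub>m k \<noteq> 0\<^sub>m n n" for k
    using zero[of k] that by (cases "K \<le> k") simp_all
  then show ?thesis
    by (intro finite_subset[OF _ finite_lessThan[of K]] subsetI) simp
qed

definition divided_power :: "int mat \<Rightarrow> nat \<Rightarrow> nat \<times> nat \<Rightarrow> int" where
  "divided_power E k ij = (E ^\<^sub>m k) $$ ij div fact k"

text \<open>The exponential exp(X E) over Z[X], with the divided powers of \<open>E\<close> as its
  coefficients.\<close>

definition generic_unipotent :: "nat \<Rightarrow> int mat \<Rightarrow> int poly mat" where
  "generic_unipotent n E = mat n n (\<lambda>ij. \<Sum>k\<in>{k. E ^\<^sub>m k \<noteq> 0\<^sub>m n n}. Polynomial.monom (divided_power E k ij) k)"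

lemma generic_unipotent_carrier [simp]: "generic_unipotent n E \<in> carrier (matrix_monoid type_ring n)"
  by (simp add: matrix_monoid_carrier generic_unipotent_def)

lemma generic_unipotent_dim [simp]:
  "dim_row (generic_unipotent n E) = n" "dim_col (generic_unipotent n E) = n"
  by (simp_all only: generic_unipotent_def dim_row_mat dim_col_mat)

lemma root_unipotent_dim [simp]:
  "dim_row (root_unipotent n e A \<alpha> \<xi>) = n" "dim_col (root_unipotent n e A \<alpha> \<xi>) = n"
  by (simp_all only: root_unipotent_def dim_row_mat dim_col_mat)

locale divided_powers =
  fixes n :: nat and E :: "int mat"
  assumes carrier: "E \<in> carrier_mat n n"
    and fact_dvd: "i < n \<Longrightarrow> j < n \<Longrightarrow> fact k dvd (E ^\<^sub>m k) $$ (i, j)"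
begin

lemma finite_pow: "finite {k. E ^\<^sub>m k \<noteq> 0\<^sub>m n n}"
  by (rule int_mat_nilpotent[OF carrier fact_dvd])

lemma divided_power_eq_0: "i < n \<Longrightarrow> j < n \<Longrightarrow> E ^\<^sub>m k = 0\<^sub>m n n \<Longrightarrow> divided_power E k (i, j) = 0"
  by (simp add: divided_power_def)

lemma coeff_generic_unipotent:
  assumes "i < n" "j < n"
  shows "Polynomial.coeff (generic_unipotent n E $$ (i, j)) k = divided_power E k (i, j)"
proof -
  have "Polynomial.coeff (generic_unipotent n E $$ (i, j)) k =
      (\<Sum>l\<in>{k. E ^\<^sub>m k \<noteq> 0\<^sub>m n n}. if l = k then divided_power E l (i, j) else 0)"
    using assms by (simp add: generic_unipotent_def coeff_sum)
  also have "\<dots> = (if k \<in> {k. E ^\<^sub>m k \<noteq> 0\<^sub>m n n} then divided_power E k (i, j) else 0)"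
    by (rule sum.delta[OF finite_pow])
  also have "\<dots> = divided_power E k (i, j)"
    by (auto simp: divided_power_eq_0[OF assms])
  finally show ?thesis .
qed

lemma pow_closed: "E ^\<^sub>m k \<in> carrier_mat n n"
  by (rule pow_carrier_mat[OF carrier])

lemma pow_add: "E ^\<^sub>m (k + l) = E ^\<^sub>m k * E ^\<^sub>m l"
proof (induction l)
  case 0
  show ?case
    unfolding add_0_right pow_mat.simps carrier_matD(1)[OF carrier] by (rule right_mult_one_mat[OF pow_closed, symmetric])
next
  case (Suc l)
  show ?case
    unfolding add_Suc_right pow_mat.simps Suc.IH by (rule assoc_mult_mat[OF pow_closed pow_closed carrier])
qed

lemma fact_divided_power: "i < n \<Longrightarrow> j < n \<Longrightarrow> fact k * divided_power E k (i, j) = (E ^\<^sub>m k) $$ (i, j)"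
  unfolding divided_power_def by (rule dvd_mult_div_cancel[OF fact_dvd])

text \<open>Multiplication by k! (r-k)! turns the divided powers on the left into ordinary powers of
  \<open>E\<close>, whose product is E^r; the same factor turns the binomial coefficient into r!.
  This nonzero factor can be cancelled in the integers.\<close>

lemma divided_power_mult:
  assumes ij: "i < n" "j < n" and k: "k \<le> r"
  shows "(\<Sum>l<n. divided_power E k (i, l) * divided_power E (r - k) (l, j)) =
    int (r choose k) * divided_power E r (i, j)"
proof -
  let ?f = "fact k * fact (r - k) :: int"
  have "?f * (\<Sum>l<n. divided_power E k (i, l) * divided_power E (r - k) (l, j)) =
      (\<Sum>l<n. (fact k * divided_power E k (i, l)) * (fact (r - k) * divided_power E (r - k) (l, j)))"
    by (simp add: sum_distrib_left mult_ac)
  also have "\<dots> = (\<Sum>l<n. (E ^\<^sub>m k) $$ (i, l) * (E ^\<^sub>m (r - k)) $$ (l, j))"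
    by (rule sum.cong) (use ij in \<open>auto simp: fact_divided_power\<close>)
  also have "\<dots> = (E ^\<^sub>m r) $$ (i, j)"
    using pow_add[of k "r - k"] k ij carrier
    by (simp add: scalar_prod_def atLeast0LessThan pow_mat_dim_square)
  also have "\<dots> = fact r * divided_power E r (i, j)" by (rule fact_divided_power[OF ij, symmetric])
  finally have *: "?f * (\<Sum>l<n. divided_power E k (i, l) * divided_power E (r - k) (l, j)) =
    fact r * divided_power E r (i, j)" .
  have "int (fact k * fact (r - k) * (r choose k)) = int (fact r)"
    by (simp only: binomial_fact_lemma[OF k])
  then have "?f * int (r choose k) = fact r"
    by (simp only: of_nat_mult of_nat_fact)
  then have "?f * (int (r choose k) * divided_power E r (i, j)) = fact r * divided_power E r (i, j)"
    by (simp only: mult.assoc[symmetric])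
  with * have "?f * (\<Sum>l<n. divided_power E k (i, l) * divided_power E (r - k) (l, j)) =
      ?f * (int (r choose k) * divided_power E r (i, j))" by (simp only:)
  then show ?thesis by (simp only: mult_left_cancel[of ?f] mult_eq_0_iff fact_nonzero simp_thms)
qed

text \<open>This is exp(X E) exp(-X E) = 1. By \<open>divided_power_mult\<close> the coefficient of
  X^r is the divided power of degree r times the alternating sum of binomial coefficients, which is
  (1 - 1)^r.\<close>

lemma generic_unipotent_inverse:
  "generic_unipotent n E \<otimes>\<^bsub>matrix_monoid type_ring n\<^esub>
     map_mat (\<lambda>p. pcompose p [:0, -1:]) (generic_unipotent n E) = \<one>\<^bsub>matrix_monoid type_ring n\<^esub>"
  (is "?T \<otimes>\<^bsub>?G\<^esub> ?T' = _")
proof (rule eq_matI)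
  fix i j assume "i < dim_row \<one>\<^bsub>?G\<^esub>" "j < dim_col \<one>\<^bsub>?G\<^esub>"
  then have ij: "i < n" "j < n" by auto
  have "Polynomial.coeff ((?T \<otimes>\<^bsub>?G\<^esub> ?T') $$ (i, j)) r = (if r = 0 \<and> i = j then 1 else 0)" for r
  proof -
    have "Polynomial.coeff ((?T \<otimes>\<^bsub>?G\<^esub> ?T') $$ (i, j)) r = (\<Sum>l<n. \<Sum>k\<le>r. divided_power E k (i, l) *
        ((-1) ^ (r - k) * divided_power E (r - k) (l, j)))"
      unfolding matrix_monoid_mult_index[OF ij] finsum_type_ring
      using ij by (simp add: coeff_sum coeff_mult coeff_pcompose_linear coeff_generic_unipotent)
    also have "\<dots> = (\<Sum>k\<le>r. (-1) ^ (r - k) * (\<Sum>l<n. divided_power E k (i, l) * divided_power E (r - k) (l, j)))"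
      by (subst sum.swap) (simp add: sum_distrib_left mult_ac)
    also have "\<dots> = (\<Sum>k\<le>r. int (r choose k) * 1 ^ k * (-1) ^ (r - k)) * divided_power E r (i, j)"
      unfolding sum_distrib_right by (rule sum.cong) (use ij in \<open>auto simp: divided_power_mult\<close>)
    also have "(\<Sum>k\<le>r. int (r choose k) * 1 ^ k * (-1) ^ (r - k)) = (1 + -1) ^ r"
      by (rule binomial_ring[symmetric])
    also have "(1 + -1 :: int) = 0" by simp
    \<comment> \<open>With 0^0 = 1, the only surviving coefficient is the constant one, and the
      zeroth divided power is the identity matrix.\<close>
    also have "0 ^ r * divided_power E r (i, j) = (if r = 0 \<and> i = j then 1 else 0)"
    proof (cases r)
      case 0
      then show ?thesis using ij carrier by (simp add: divided_power_def)
    qed simp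
    finally show ?thesis .
  qed
  then show "(?T \<otimes>\<^bsub>?G\<^esub> ?T') $$ (i, j) = \<one>\<^bsub>?G\<^esub> $$ (i, j)"
    using ij by (intro poly_eqI) (auto simp: matrix_monoid_one_index)
qed auto

end

locale admissible_root_vectors =
  fixes \<Phi> :: "'v::euclidean_space set" and n :: nat and e :: "'v \<Rightarrow> int mat"
  assumes divided_powers: "\<alpha> \<in> \<Phi> \<Longrightarrow> divided_powers n (e \<alpha>)"
begin

text \<open>Every root unipotent over every commutative ring is a specialisation of one matrix over
  Z[X]. Inverses, naturality and the equations of the scheme are all transferred along this
  specialisation.\<close>

lemma root_unipotent_generic:
  assumes "cring A" "\<alpha> \<in> \<Phi>" "\<xi> \<in> carrier A"
  shows "root_unipotent n e A \<alpha> \<xi> = map_mat (int_poly_eval A \<xi>) (generic_unipotent n (e \<alpha>))"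
proof -
  interpret A: cring A by fact
  interpret divided_powers n "e \<alpha>" by (rule divided_powers) fact
  show ?thesis
  proof (rule eq_matI)
    fix i j assume "i < dim_row (map_mat (int_poly_eval A \<xi>) (generic_unipotent n (e \<alpha>)))"
      "j < dim_col (map_mat (int_poly_eval A \<xi>) (generic_unipotent n (e \<alpha>)))"
    then have ij: "i < n" "j < n" by simp_all
    have "int_poly_eval A \<xi> (generic_unipotent n (e \<alpha>) $$ (i, j)) =
        (\<Oplus>\<^bsub>A\<^esub>k\<in>{k. e \<alpha> ^\<^sub>m k \<noteq> 0\<^sub>m n n}.
          add_pow A (Polynomial.coeff (generic_unipotent n (e \<alpha>) $$ (i, j)) k) (\<xi> [^]\<^bsub>A\<^esub> k))"
      by (rule A.int_poly_eval_superset[OF assms(3) finite_pow])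
        (simp add: coeff_generic_unipotent[OF ij] divided_power_eq_0[OF ij])
    then show "root_unipotent n e A \<alpha> \<xi> $$ (i, j) =
        map_mat (int_poly_eval A \<xi>) (generic_unipotent n (e \<alpha>)) $$ (i, j)"
      unfolding coeff_generic_unipotent[OF ij] divided_power_def
      unfolding root_unipotent_def using ij by simp
  qed simp_all
qed

lemma root_unipotent_inverse:
  assumes "cring A" "\<alpha> \<in> \<Phi>" "\<xi> \<in> carrier A"
  shows "root_unipotent n e A \<alpha> \<xi> \<in> carrier (matrix_monoid A n)"
    and "root_unipotent n e A \<alpha> \<xi> \<otimes>\<^bsub>matrix_monoid A n\<^esub> root_unipotent n e A \<alpha> (\<ominus>\<^bsub>A\<^esub> \<xi>) = \<one>\<^bsub>matrix_monoid A n\<^esub>"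
    and "root_unipotent n e A \<alpha> (\<ominus>\<^bsub>A\<^esub> \<xi>) \<otimes>\<^bsub>matrix_monoid A n\<^esub> root_unipotent n e A \<alpha> \<xi> = \<one>\<^bsub>matrix_monoid A n\<^esub>"
proof -
  interpret A: cring A by fact
  interpret divided_powers n "e \<alpha>" by (rule divided_powers) fact
  have hom: "ring_hom_cring type_ring A (int_poly_eval A \<xi>)" if "\<xi> \<in> carrier A" for \<xi>
    using that cring_type_ring assms(1) A.int_poly_eval_ring_hom
    by (simp add: ring_hom_cring_def ring_hom_cring_axioms_def)
  show closed: "root_unipotent n e A \<alpha> \<xi> \<in> carrier (matrix_monoid A n)"
    unfolding root_unipotent_generic[OF assms]
    by (rule map_mat_matrix_monoid(1)[OF hom[OF assms(3)] generic_unipotent_carrier])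
  have *: "root_unipotent n e A \<alpha> \<xi> \<otimes>\<^bsub>matrix_monoid A n\<^esub> root_unipotent n e A \<alpha> (\<ominus>\<^bsub>A\<^esub> \<xi>) = \<one>\<^bsub>matrix_monoid A n\<^esub>"
    if \<xi>: "\<xi> \<in> carrier A" for \<xi>
  proof -
    let ?T = "generic_unipotent n (e \<alpha>)" and ?T' = "map_mat (\<lambda>p. pcompose p [:0, -1:]) (generic_unipotent n (e \<alpha>))"
    have "root_unipotent n e A \<alpha> (\<ominus>\<^bsub>A\<^esub> \<xi>) = map_mat (int_poly_eval A \<xi>) ?T'"
      unfolding root_unipotent_generic[OF assms(1,2) A.a_inv_closed[OF \<xi>]]
      by (rule eq_matI) (use \<xi> in \<open>simp_all add: A.int_poly_eval_uminus\<close>)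
    then have "root_unipotent n e A \<alpha> \<xi> \<otimes>\<^bsub>matrix_monoid A n\<^esub> root_unipotent n e A \<alpha> (\<ominus>\<^bsub>A\<^esub> \<xi>) =
        map_mat (int_poly_eval A \<xi>) (?T \<otimes>\<^bsub>matrix_monoid type_ring n\<^esub> ?T')"
      unfolding root_unipotent_generic[OF assms(1,2) \<xi>]
      by (subst map_mat_matrix_monoid(3)[OF hom[OF \<xi>]]) (auto simp: matrix_monoid_carrier)
    then show ?thesis
      by (simp add: generic_unipotent_inverse map_mat_matrix_monoid(2)[OF hom[OF \<xi>]])
  qed
  show "root_unipotent n e A \<alpha> \<xi> \<otimes>\<^bsub>matrix_monoid A n\<^esub> root_unipotent n e A \<alpha> (\<ominus>\<^bsub>A\<^esub> \<xi>) = \<one>\<^bsub>matrix_monoid A n\<^esub>"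
    by (rule *[OF assms(3)])
  show "root_unipotent n e A \<alpha> (\<ominus>\<^bsub>A\<^esub> \<xi>) \<otimes>\<^bsub>matrix_monoid A n\<^esub> root_unipotent n e A \<alpha> \<xi> = \<one>\<^bsub>matrix_monoid A n\<^esub>"
    using *[OF A.a_inv_closed[OF assms(3)]] assms(3) by simp
qed

lemma root_unipotent_zero:
  assumes "cring A" "\<alpha> \<in> \<Phi>"
  shows "root_unipotent n e A \<alpha> \<zero>\<^bsub>A\<^esub> = \<one>\<^bsub>matrix_monoid A n\<^esub>"
proof -
  interpret A: cring A by fact
  interpret divided_powers n "e \<alpha>" by (rule divided_powers) fact
  show ?thesis
    unfolding root_unipotent_generic[OF assms A.zero_closed]
  proof (rule eq_matI)
    fix i j assume "i < dim_row \<one>\<^bsub>matrix_monoid A n\<^esub>" "j < dim_col \<one>\<^bsub>matrix_monoid A n\<^esub>"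
    then have ij: "i < n" "j < n" by auto
    have D: "divided_power (e \<alpha>) 0 (i, j) = (if i = j then 1 else 0)"
      using ij carrier by (simp add: divided_power_def)
    have "map_mat (int_poly_eval A \<zero>\<^bsub>A\<^esub>) (generic_unipotent n (e \<alpha>)) $$ (i, j) =
        int_poly_eval A \<zero>\<^bsub>A\<^esub> (generic_unipotent n (e \<alpha>) $$ (i, j))"
      by (rule index_map_mat(1)) (simp_all only: generic_unipotent_dim ij)
    also have "\<dots> = add_pow A (if i = j then 1 else 0 :: int) \<one>\<^bsub>A\<^esub>"
      unfolding A.int_poly_eval_at_zero coeff_generic_unipotent[OF ij] D ..
    also have "\<dots> = (if i = j then \<one>\<^bsub>A\<^esub> else \<zero>\<^bsub>A\<^esub>)" by simp
    also have "\<dots> = \<one>\<^bsub>matrix_monoid A n\<^esub> $$ (i, j)" by (rule matrix_monoid_one_index[OF ij, symmetric])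
    finally show "map_mat (int_poly_eval A \<zero>\<^bsub>A\<^esub>) (generic_unipotent n (e \<alpha>)) $$ (i, j) =
        \<one>\<^bsub>matrix_monoid A n\<^esub> $$ (i, j)" .
  qed simp_all
qed

lemma map_mat_root_unipotent:
  assumes "ring_hom_cring A B f" "\<alpha> \<in> \<Phi>" "\<xi> \<in> carrier A"
  shows "map_mat f (root_unipotent n e A \<alpha> \<xi>) = root_unipotent n e B \<alpha> (f \<xi>)"
proof -
  interpret ring_hom_cring A B f by fact
  have eq: "root_unipotent n e A \<alpha> \<xi> = map_mat (int_poly_eval A \<xi>) (generic_unipotent n (e \<alpha>))"
    "root_unipotent n e B \<alpha> (f \<xi>) = map_mat (int_poly_eval B (f \<xi>)) (generic_unipotent n (e \<alpha>))"
    using root_unipotent_generic[OF R.cring_axioms assms(2,3)]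
      root_unipotent_generic[OF S.cring_axioms assms(2) hom_closed[OF assms(3)]] by simp_all
  show ?thesis
    unfolding eq by (rule eq_matI) (simp_all add: hom_int_poly_eval[OF assms(1,3)])
qed

end

section \<open>Chevalley--Demazure groups and their elementary subgroups\<close>

text \<open>\<open>indexed_pset\<close> is generated inductively, so finiteness of the support and
  the bound on the variables are read off its rules. Finiteness matters because
  \<open>finsum\<close> falls back to zero on infinite index sets.\<close>

lemma (in ring) indexed_pset_support:
  assumes "P \<in> indexed_pset S (carrier R)"
  shows "finite {m. P m \<noteq> \<zero>}" and "P m \<noteq> \<zero> \<Longrightarrow> set_mset m \<subseteq> S" and "P m \<in> carrier R"
proof -
  have "finite {m. P m \<noteq> \<zero>} \<and> (\<forall>m. P m \<noteq> \<zero> \<longrightarrow> set_mset m \<subseteq> S) \<and> (\<forall>m. P m \<in> carrier R)"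
    using assms
  proof induction
    case (indexed_const k)
    have "finite {m. indexed_const k m \<noteq> \<zero>}"
      by (rule finite_subset[of _ "{{#}}"]) (auto simp: indexed_const_def)
    then show ?case
      using indexed_const by (simp add: indexed_const_def)
  next
    case (indexed_padd P Q)
    have "finite {m. indexed_padd P Q m \<noteq> \<zero>}"
    proof (rule finite_subset)
      show "{m. indexed_padd P Q m \<noteq> \<zero>} \<subseteq> {m. P m \<noteq> \<zero>} \<union> {m. Q m \<noteq> \<zero>}"
        by (auto simp: indexed_padd_def)
    qed (use indexed_padd.IH in simp)
    moreover have "P m \<noteq> \<zero> \<or> Q m \<noteq> \<zero>" if "indexed_padd P Q m \<noteq> \<zero>" for m
      using that by (auto simp: indexed_padd_def)
    then have "\<forall>m. indexed_padd P Q m \<noteq> \<zero> \<longrightarrow> set_mset m \<subseteq> S" using indexed_padd.IH by metis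
    moreover have "\<forall>m. indexed_padd P Q m \<in> carrier R"
      using indexed_padd.IH by (simp add: indexed_padd_def)
    ultimately show ?case by (intro conjI)
  next
    case (indexed_pmult P i)
    have pm: "i \<in># m \<and> P (m - {#i#}) \<noteq> \<zero>" if "indexed_pmult P i m \<noteq> \<zero>" for m
      using that by (auto simp: indexed_pmult_def split: if_splits)
    have "finite {m. indexed_pmult P i m \<noteq> \<zero>}"
    proof (rule finite_subset)
      show "{m. indexed_pmult P i m \<noteq> \<zero>} \<subseteq> add_mset i ` {m. P m \<noteq> \<zero>}"
      proof
        fix m assume "m \<in> {m. indexed_pmult P i m \<noteq> \<zero>}"
        then show "m \<in> add_mset i ` {m. P m \<noteq> \<zero>}"
          by (intro image_eqI[of _ _ "m - {#i#}"]) (auto dest: pm)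
      qed
    qed (use indexed_pmult.IH in simp)
    moreover have "set_mset m \<subseteq> S" if m: "indexed_pmult P i m \<noteq> \<zero>" for m
    proof -
      have "set_mset (m - {#i#}) \<subseteq> S" using indexed_pmult.IH pm[OF m] by simp
      moreover have "set_mset m = insert i (set_mset (m - {#i#}))"
        using pm[OF m] by (metis insert_DiffM set_mset_add_mset_insert)
      ultimately show ?thesis using indexed_pmult.hyps(2) by simp
    qed
    moreover have "\<forall>m. indexed_pmult P i m \<in> carrier R"
      using indexed_pmult.IH by (simp add: indexed_pmult_def)
    ultimately show ?case by (intro conjI allI impI) simp_all
  qed
  then show "finite {m. P m \<noteq> \<zero>}" "P m \<noteq> \<zero> \<Longrightarrow> set_mset m \<subseteq> S" "P m \<in> carrier R" by auto
qed

text \<open>A polynomial with integer coefficients commutes with ring homomorphisms. The bound on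
  the variables guarantees that only entries inside the n by n range are read, where
  \<open>map_mat\<close> is meaningful.\<close>

lemma hom_matrix_poly_value:
  assumes "ring_hom_cring A B f" and M: "M \<in> carrier (matrix_monoid A n)"
    and F: "F \<in> carrier (mpoly_ring int_ring ({..<n} \<times> {..<n}))"
  shows "f (matrix_poly_value A F M) = matrix_poly_value B F (map_mat f M)"
proof -
  interpret ring_hom_cring A B f by fact
  have r: "ring int_ring" unfolding int_ring_eq using cring_type_ring by (rule cring.axioms)
  have "F \<in> ring.indexed_pset int_ring ({..<n} \<times> {..<n}) (carrier int_ring)"
    using F by (simp add: mpoly_ring_def)
  then have sup: "set_mset m \<subseteq> {..<n} \<times> {..<n}" if "F m \<noteq> 0" for m
    by (rule ring.indexed_pset_support(2)[OF r]) (simp add: that)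
  have F0: "x \<in> {..<n} \<times> {..<n}" if "F m \<noteq> 0" "x \<in># m" for m x
    using sup[of m] that by auto
  have closed: "(\<Otimes>\<^bsub>A\<^esub>x\<in>set_mset m. M $$ x [^]\<^bsub>A\<^esub> count m x) \<in> carrier A" if "F m \<noteq> 0" for m
    by (rule R.finprod_closed) (use M F0[OF that] in \<open>auto simp: matrix_monoid_carrier\<close>)
  have Mx: "M $$ x \<in> carrier A" "map_mat f M $$ x = f (M $$ x)" if "F m \<noteq> 0" "x \<in># m" for m x
    using M F0[OF that] by (auto simp: matrix_monoid_carrier)
  have "f (\<Otimes>\<^bsub>A\<^esub>x\<in>set_mset m. M $$ x [^]\<^bsub>A\<^esub> count m x) =
      (\<Otimes>\<^bsub>B\<^esub>x\<in>set_mset m. map_mat f M $$ x [^]\<^bsub>B\<^esub> count m x)" if m: "F m \<noteq> 0" for m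
  proof -
    have "f (\<Otimes>\<^bsub>A\<^esub>x\<in>set_mset m. M $$ x [^]\<^bsub>A\<^esub> count m x) =
        (\<Otimes>\<^bsub>B\<^esub>x\<in>set_mset m. (f \<circ> (\<lambda>x. M $$ x [^]\<^bsub>A\<^esub> count m x)) x)"
      by (rule hom_finprod) (simp add: Mx[OF m])
    also have "\<dots> = (\<Otimes>\<^bsub>B\<^esub>x\<in>set_mset m. map_mat f M $$ x [^]\<^bsub>B\<^esub> count m x)"
      by (rule S.finprod_cong') (simp_all add: Mx[OF m])
    finally show ?thesis .
  qed
  then have summand: "f (add_pow A (F m) \<one>\<^bsub>A\<^esub> \<otimes>\<^bsub>A\<^esub> (\<Otimes>\<^bsub>A\<^esub>x\<in>set_mset m. M $$ x [^]\<^bsub>A\<^esub> count m x)) =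
      add_pow B (F m) \<one>\<^bsub>B\<^esub> \<otimes>\<^bsub>B\<^esub> (\<Otimes>\<^bsub>B\<^esub>x\<in>set_mset m. map_mat f M $$ x [^]\<^bsub>B\<^esub> count m x)"
    if "F m \<noteq> 0" for m
    using that closed[OF that] ring_hom_int_pow[OF R.cring_axioms S.cring_axioms homh] by simp
  have closed': "(\<Otimes>\<^bsub>B\<^esub>x\<in>set_mset m. map_mat f M $$ x [^]\<^bsub>B\<^esub> count m x) \<in> carrier B" if "F m \<noteq> 0" for m
    by (rule S.finprod_closed) (simp add: Mx[OF that])
  have "f (\<Oplus>\<^bsub>A\<^esub>m\<in>{m. F m \<noteq> 0}. add_pow A (F m) \<one>\<^bsub>A\<^esub> \<otimes>\<^bsub>A\<^esub> (\<Otimes>\<^bsub>A\<^esub>x\<in>set_mset m. M $$ x [^]\<^bsub>A\<^esub> count m x)) =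
      (\<Oplus>\<^bsub>B\<^esub>m\<in>{m. F m \<noteq> 0}. (f \<circ> (\<lambda>m. add_pow A (F m) \<one>\<^bsub>A\<^esub> \<otimes>\<^bsub>A\<^esub>
        (\<Otimes>\<^bsub>A\<^esub>x\<in>set_mset m. M $$ x [^]\<^bsub>A\<^esub> count m x))) m)"
    by (rule hom_finsum) (simp add: closed)
  also have "\<dots> = (\<Oplus>\<^bsub>B\<^esub>m\<in>{m. F m \<noteq> 0}. add_pow B (F m) \<one>\<^bsub>B\<^esub> \<otimes>\<^bsub>B\<^esub>
      (\<Otimes>\<^bsub>B\<^esub>x\<in>set_mset m. map_mat f M $$ x [^]\<^bsub>B\<^esub> count m x))"
    by (rule S.finsum_cong') (simp_all add: closed' summand)
  finally show ?thesis
    unfolding matrix_poly_value_def mpoly_eval_def by simp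
qed

lemma chevalley_demazure_group_simps:
  "monoid.mult (chevalley_demazure_group \<Phi> n e A) = monoid.mult (matrix_monoid A n)"
  "\<one>\<^bsub>chevalley_demazure_group \<Phi> n e A\<^esub> = \<one>\<^bsub>matrix_monoid A n\<^esub>"
  by (simp_all add: chevalley_demazure_group_def general_linear_group_def units_of_def)

section \<open>Root unipotents as points of the scheme, and induction over the elementary
  group\<close>

context admissible_root_vectors
begin

lemma root_unipotent_Units:
  assumes "cring A" "\<alpha> \<in> \<Phi>" "\<xi> \<in> carrier A"
  shows "root_unipotent n e A \<alpha> \<xi> \<in> Units (matrix_monoid A n)"
proof -
  interpret A: cring A by fact
  show ?thesis
    using root_unipotent_inverse[OF assms] root_unipotent_inverse(1)[OF assms(1,2) A.a_inv_closed[OF assms(3)]]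
    unfolding Units_def by blast
qed

lemma root_unipotent_complex:
  assumes "\<alpha> \<in> \<Phi>"
  shows "root_unipotent n e complex_ring \<alpha> s \<in> carrier (complex_chevalley_group \<Phi> n e)"
proof -
  have "root_unipotent n e complex_ring \<alpha> s \<in> carrier (general_linear_group complex_ring n)"
    using root_unipotent_Units[OF _ assms, of complex_ring s] cring_type_ring
    by (simp add: general_linear_group_def units_of_def complex_ring_eq)
  then show ?thesis
    using assms unfolding complex_chevalley_group_def subgroup_generated_def
    by (auto intro!: generate.incl)
qed

text \<open>An integral polynomial vanishing on the complex Chevalley group vanishes at the generic
  unipotent, because the resulting polynomial in one variable has all complex numbers as roots.\<close>

lemma root_unipotent_in_chevalley_demazure:
  assumes "cring A" "\<alpha> \<in> \<Phi>" "\<xi> \<in> carrier A"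
  shows "root_unipotent n e A \<alpha> \<xi> \<in> carrier (chevalley_demazure_group \<Phi> n e A)"
proof -
  interpret A: cring A by fact
  have "matrix_poly_value A F (root_unipotent n e A \<alpha> \<xi>) = \<zero>\<^bsub>A\<^esub>"
    if F: "F \<in> carrier (mpoly_ring int_ring ({..<n} \<times> {..<n}))"
      and van: "\<forall>C\<in>carrier (complex_chevalley_group \<Phi> n e). matrix_poly_value complex_ring F C = 0" for F
  proof -
    \<comment> \<open>One integral polynomial in X whose specialisations are the values of
      \<open>F\<close> at the root unipotents over all rings; it remains to see that it is
      zero.\<close>
    define p where "p = matrix_poly_value type_ring F (generic_unipotent n (e \<alpha>))"
    have eval: "int_poly_eval B x p = matrix_poly_value B F (root_unipotent n e B \<alpha> x)"
      if B: "cring B" "x \<in> carrier B" for B :: "('x, 'y) ring_scheme" and x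
    proof -
      have "ring_hom_cring type_ring B (int_poly_eval B x)"
        using B cring_type_ring cring.int_poly_eval_ring_hom[OF B]
        by (simp add: ring_hom_cring_def ring_hom_cring_axioms_def)
      from hom_matrix_poly_value[OF this generic_unipotent_carrier F] show ?thesis
        by (simp add: p_def root_unipotent_generic[OF B(1) assms(2) B(2)])
    qed
    have "poly (map_poly of_int p) s = 0" for s :: complex
    proof -
      have "poly (map_poly of_int p) s = int_poly_eval complex_ring s p"
        unfolding complex_ring_eq by (rule int_poly_eval_type_ring[symmetric])
      also have "\<dots> = matrix_poly_value complex_ring F (root_unipotent n e complex_ring \<alpha> s)"
        by (rule eval) (simp_all add: complex_ring_eq cring_type_ring)
      also have "\<dots> = 0" by (rule bspec[OF van root_unipotent_complex[OF assms(2)]])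
      finally show ?thesis .
    qed
    then have "map_poly of_int p = (0 :: complex poly)"
      by (intro iffD1[OF poly_all_0_iff_0] allI)
    \<comment> \<open>The integers embed into the complex numbers, so vanishing over the complex
      numbers descends to \<open>p\<close> itself. From \<open>p\<close> it passes to any ring
      \<open>A\<close>, whatever its characteristic.\<close>
    then have "of_int (Polynomial.coeff p k) = (0 :: complex)" for k
      by (metis coeff_0 coeff_map_poly of_int_0)
    then have "p = 0" by (intro poly_eqI) simp
    then show ?thesis
      using eval[OF assms(1,3)] assms(3) by simp
  qed
  then show ?thesis
    using root_unipotent_Units[OF assms]
    by (simp add: chevalley_demazure_group_def general_linear_group_def units_of_def)
qed

text \<open>The inverse is a definite description over the points of the scheme, which are not
  established here to form a group. Existence comes from the unipotent with the opposite argument,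
  uniqueness from the surrounding matrix monoid.\<close>

lemma root_unipotent_inv:
  assumes "cring A" "\<alpha> \<in> \<Phi>" "\<xi> \<in> carrier A"
  shows "inv\<^bsub>chevalley_demazure_group \<Phi> n e A\<^esub> (root_unipotent n e A \<alpha> \<xi>) = root_unipotent n e A \<alpha> (\<ominus>\<^bsub>A\<^esub> \<xi>)"
proof -
  interpret A: cring A by fact
  interpret M: Group.monoid "matrix_monoid A n" by (rule monoid_matrix_monoid) fact
  let ?t = "root_unipotent n e A \<alpha>"
  note inv = root_unipotent_inverse[OF assms]
  have closed: "?t (\<ominus>\<^bsub>A\<^esub> \<xi>) \<in> carrier (chevalley_demazure_group \<Phi> n e A)"
    by (rule root_unipotent_in_chevalley_demazure[OF assms(1,2) A.a_inv_closed[OF assms(3)]])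
  have uniq: "y = ?t (\<ominus>\<^bsub>A\<^esub> \<xi>)"
    if "y \<in> carrier (chevalley_demazure_group \<Phi> n e A)" "?t \<xi> \<otimes>\<^bsub>matrix_monoid A n\<^esub> y = \<one>\<^bsub>matrix_monoid A n\<^esub>" for y
  proof -
    have y: "y \<in> carrier (matrix_monoid A n)"
      using that(1) by (simp add: chevalley_demazure_group_def general_linear_group_def units_of_def Units_def)
    show ?thesis
      using M.inv_unique[OF inv(3) that(2) inv(1)] y root_unipotent_inverse(1)[OF assms(1,2) A.a_inv_closed[OF assms(3)]]
      by simp
  qed
  show ?thesis
    unfolding m_inv_def chevalley_demazure_group_simps
    by (rule the_equality, intro conjI closed inv(2,3)) (elim conjE, rule uniq)
qed

text \<open>\<open>subgroup_generated\<close> first intersects the generators with the carrier. That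
  nothing is lost is the statement that root unipotents are points of the scheme.\<close>

lemma elementary_group_carrier:
  assumes "cring A"
  shows "carrier (elementary_group \<Phi> n e A) = generate (chevalley_demazure_group \<Phi> n e A)
    {root_unipotent n e A \<alpha> \<xi> | \<alpha> \<xi>. \<alpha> \<in> \<Phi> \<and> \<xi> \<in> carrier A}"
proof -
  have "carrier (chevalley_demazure_group \<Phi> n e A) \<inter> {root_unipotent n e A \<alpha> \<xi> | \<alpha> \<xi>. \<alpha> \<in> \<Phi> \<and> \<xi> \<in> carrier A} =
      {root_unipotent n e A \<alpha> \<xi> | \<alpha> \<xi>. \<alpha> \<in> \<Phi> \<and> \<xi> \<in> carrier A}"
    using root_unipotent_in_chevalley_demazure[OF assms] by (intro Int_absorb1 subsetI) (elim CollectE exE conjE, simp)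
  then show ?thesis
    by (simp add: elementary_group_def subgroup_generated_def)
qed

lemma elementary_group_intros:
  assumes "cring A"
  shows "\<one>\<^bsub>matrix_monoid A n\<^esub> \<in> carrier (elementary_group \<Phi> n e A)"
    and "\<alpha> \<in> \<Phi> \<Longrightarrow> \<xi> \<in> carrier A \<Longrightarrow> root_unipotent n e A \<alpha> \<xi> \<in> carrier (elementary_group \<Phi> n e A)"
    and "x \<in> carrier (elementary_group \<Phi> n e A) \<Longrightarrow> y \<in> carrier (elementary_group \<Phi> n e A) \<Longrightarrow>
      x \<otimes>\<^bsub>matrix_monoid A n\<^esub> y \<in> carrier (elementary_group \<Phi> n e A)"
  unfolding elementary_group_carrier[OF assms] chevalley_demazure_group_simps[of \<Phi> n e A, symmetric]
  by (auto intro: generate.intros)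

text \<open>The inverse of a root unipotent is again one, so the inverse case of
  \<open>generate\<close> is absorbed by the case of generators.\<close>

lemma elementary_group_induct [consumes 2, case_names one unipotent mult]:
  assumes A: "cring A" and x: "x \<in> carrier (elementary_group \<Phi> n e A)"
    and one: "P \<one>\<^bsub>matrix_monoid A n\<^esub>"
    and unip: "\<And>\<alpha> \<xi>. \<alpha> \<in> \<Phi> \<Longrightarrow> \<xi> \<in> carrier A \<Longrightarrow> P (root_unipotent n e A \<alpha> \<xi>)"
    and mult: "\<And>x y. x \<in> carrier (elementary_group \<Phi> n e A) \<Longrightarrow> y \<in> carrier (elementary_group \<Phi> n e A) \<Longrightarrow>
      P x \<Longrightarrow> P y \<Longrightarrow> P (x \<otimes>\<^bsub>matrix_monoid A n\<^esub> y)"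
  shows "P x"
  using x unfolding elementary_group_carrier[OF A]
proof induction
  case one
  then show ?case using assms(3) by (simp add: chevalley_demazure_group_simps)
next
  case (incl h)
  then show ?case using unip by blast
next
  case (inv h)
  then obtain \<alpha> \<xi> where "h = root_unipotent n e A \<alpha> \<xi>" "\<alpha> \<in> \<Phi>" "\<xi> \<in> carrier A" by blast
  then show ?case
    using unip root_unipotent_inv[OF A] cring.cring_simprules(3)[OF A] by simp
next
  case (eng h1 h2)
  then show ?case
    using mult by (simp add: chevalley_demazure_group_simps elementary_group_carrier[OF A])
qed

lemma elementary_group_matrix:
  assumes A: "cring A" and x: "x \<in> carrier (elementary_group \<Phi> n e A)"
  shows "x \<in> carrier (matrix_monoid A n)"
proof -
  interpret M: Group.monoid "matrix_monoid A n" by (rule monoid_matrix_monoid) fact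
  show ?thesis
    using A x by (induction rule: elementary_group_induct) (auto intro: root_unipotent_inverse(1)[OF A])
qed

end

section \<open>Contracting paths in the elementary group\<close>

context admissible_root_vectors
begin

text \<open>The path \<open>t\<^sub>\<alpha>(t a)\<close> contracts the generator \<open>t\<^sub>\<alpha>(a)\<close>.\<close>

lemma elementary_contract:
  assumes A: "cring A0" "cring A1" and f: "ring_hom_cring A1 A0 f" and g: "ring_hom_cring A1 A0 g"
    and s: "s \<in> Ring.ring_hom A0 A1" and t: "t \<in> carrier A1"
    and ft: "f t = \<one>\<^bsub>A0\<^esub>" and gt: "g t = \<zero>\<^bsub>A0\<^esub>"
    and fs: "\<And>a. a \<in> carrier A0 \<Longrightarrow> f (s a) = a" and x: "x \<in> carrier (elementary_group \<Phi> n e A0)"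
  shows "\<exists>z\<in>carrier (elementary_group \<Phi> n e A1). map_mat f z = x \<and> map_mat g z = \<one>\<^bsub>matrix_monoid A0 n\<^esub>"
proof -
  interpret A0: cring A0 by fact
  interpret A1: cring A1 by fact
  interpret f: ring_hom_cring A1 A0 f by fact
  interpret g: ring_hom_cring A1 A0 g by fact
  interpret M: Group.monoid "matrix_monoid A0 n" by (rule monoid_matrix_monoid) fact
  show ?thesis
    using A(1) x
  proof (induction rule: elementary_group_induct)
    case one
    show ?case
      by (intro bexI[OF _ elementary_group_intros(1)[OF A(2)]] conjI map_mat_matrix_monoid(2)[OF f]
          map_mat_matrix_monoid(2)[OF g])
  next
    case (unipotent \<alpha> \<xi>)
    have sx: "s \<xi> \<in> carrier A1" by (rule ring_hom_closed[OF s unipotent(2)])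
    have c: "t \<otimes>\<^bsub>A1\<^esub> s \<xi> \<in> carrier A1" using t sx by simp
    have "map_mat f (root_unipotent n e A1 \<alpha> (t \<otimes>\<^bsub>A1\<^esub> s \<xi>)) = root_unipotent n e A0 \<alpha> \<xi>"
      unfolding map_mat_root_unipotent[OF f unipotent(1) c]
      using t sx ft fs unipotent by simp
    moreover have "map_mat g (root_unipotent n e A1 \<alpha> (t \<otimes>\<^bsub>A1\<^esub> s \<xi>)) = \<one>\<^bsub>matrix_monoid A0 n\<^esub>"
      unfolding map_mat_root_unipotent[OF g unipotent(1) c]
      using t sx gt root_unipotent_zero[OF A(1) unipotent(1)] by simp
    ultimately show ?case
      by (intro bexI[OF _ elementary_group_intros(2)[OF A(2) unipotent(1) c]] conjI)
  next
    case (mult x y)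
    obtain z where z: "z \<in> carrier (elementary_group \<Phi> n e A1)" "map_mat f z = x"
      "map_mat g z = \<one>\<^bsub>matrix_monoid A0 n\<^esub>"
      using mult.IH(1) by (elim bexE conjE)
    obtain z' where z': "z' \<in> carrier (elementary_group \<Phi> n e A1)" "map_mat f z' = y"
      "map_mat g z' = \<one>\<^bsub>matrix_monoid A0 n\<^esub>"
      using mult.IH(2) by (elim bexE conjE)
    note zm = elementary_group_matrix[OF A(2) z(1)] elementary_group_matrix[OF A(2) z'(1)]
    have "map_mat f (z \<otimes>\<^bsub>matrix_monoid A1 n\<^esub> z') = x \<otimes>\<^bsub>matrix_monoid A0 n\<^esub> y"
      unfolding map_mat_matrix_monoid(3)[OF f zm] z(2) z'(2) ..
    moreover have "map_mat g (z \<otimes>\<^bsub>matrix_monoid A1 n\<^esub> z') = \<one>\<^bsub>matrix_monoid A0 n\<^esub>"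
      unfolding map_mat_matrix_monoid(3)[OF g zm] z(3) z'(3) by simp
    ultimately show ?case
      by (intro bexI[OF _ elementary_group_intros(3)[OF A(2) z(1) z'(1)]] conjI)
  qed
qed

text \<open>A path from \<open>x\<close> to the identity is multiplied by a path from the identity
  to \<open>y\<close>; the coordinate that scales the arguments is \<open>t1\<close> for the first
  and \<open>t0\<close> for the second.\<close>

lemma elementary_connected:
  assumes "ring_interval A0 A1 d0 d1 s t0 t1"
    and x: "x \<in> carrier (elementary_group \<Phi> n e A0)" and y: "y \<in> carrier (elementary_group \<Phi> n e A0)"
  shows "\<exists>z\<in>carrier (elementary_group \<Phi> n e A1). map_mat d0 z = x \<and> map_mat d1 z = y"
proof -
  interpret ring_interval A0 A1 d0 d1 s t0 t1 by fact
  interpret M: Group.monoid "matrix_monoid A0 n" by (rule monoid_matrix_monoid) (rule A0.cring_axioms)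
  have "\<exists>z\<in>carrier (elementary_group \<Phi> n e A1). map_mat d0 z = x \<and> map_mat d1 z = \<one>\<^bsub>matrix_monoid A0 n\<^esub>"
    by (rule elementary_contract[OF A0.cring_axioms A1.cring_axioms d0.ring_hom_cring_axioms
          d1.ring_hom_cring_axioms s_hom t_closed(2) d_t(2,4) _ x]) (rule d_s(1))
  then obtain z where z: "z \<in> carrier (elementary_group \<Phi> n e A1)" "map_mat d0 z = x"
    "map_mat d1 z = \<one>\<^bsub>matrix_monoid A0 n\<^esub>"
    by (elim bexE conjE)
  have "\<exists>z\<in>carrier (elementary_group \<Phi> n e A1). map_mat d1 z = y \<and> map_mat d0 z = \<one>\<^bsub>matrix_monoid A0 n\<^esub>"
    by (rule elementary_contract[OF A0.cring_axioms A1.cring_axioms d1.ring_hom_cring_axioms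
          d0.ring_hom_cring_axioms s_hom t_closed(1) d_t(3,1) _ y]) (rule d_s(2))
  then obtain z' where z': "z' \<in> carrier (elementary_group \<Phi> n e A1)" "map_mat d1 z' = y"
    "map_mat d0 z' = \<one>\<^bsub>matrix_monoid A0 n\<^esub>"
    by (elim bexE conjE)
  note zm = elementary_group_matrix[OF A1.cring_axioms z(1)] elementary_group_matrix[OF A1.cring_axioms z'(1)]
  have "map_mat d0 (z \<otimes>\<^bsub>matrix_monoid A1 n\<^esub> z') = x"
    unfolding map_mat_matrix_monoid(3)[OF d0.ring_hom_cring_axioms zm] z z'
    by (rule M.r_one[OF elementary_group_matrix[OF A0.cring_axioms x]])
  moreover have "map_mat d1 (z \<otimes>\<^bsub>matrix_monoid A1 n\<^esub> z') = y"
    unfolding map_mat_matrix_monoid(3)[OF d1.ring_hom_cring_axioms zm] z z'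
    by (rule M.l_one[OF elementary_group_matrix[OF A0.cring_axioms y]])
  ultimately show ?thesis
    by (intro bexI[OF _ elementary_group_intros(3)[OF A1.cring_axioms z(1) z'(1)]] conjI)
qed

end

section \<open>The ring of polynomials in several variables\<close>

lemma finite_submultisets: "finite {l. l \<subseteq># m}"
proof (induction m)
  case (add x m)
  have "{l. l \<subseteq># add_mset x m} \<subseteq> {l. l \<subseteq># m} \<union> add_mset x ` {l. l \<subseteq># m}"
  proof
    fix l assume "l \<in> {l. l \<subseteq># add_mset x m}"
    then have l: "l \<subseteq># add_mset x m" by simp
    show "l \<in> {l. l \<subseteq># m} \<union> add_mset x ` {l. l \<subseteq># m}"
    proof (cases "x \<in># l")
      case True
      then obtain l' where "l = add_mset x l'" by (metis insert_DiffM)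
      then show ?thesis using l by auto
    next
      case False
      have "count l a \<le> count m a" for a
        using mset_subset_eq_count[OF l, of a] False by (cases "a = x") (auto simp: not_in_iff)
      then have "l \<subseteq># m" by (rule mset_subset_eqI)
      then show ?thesis by simp
    qed
  qed
  then show ?case by (rule finite_subset) (use add in simp)
qed simp

lemma diff_diff_submultiset: "l \<subseteq># m \<Longrightarrow> m - (m - l) = l"
  by (rule multiset_eqI) (simp add: mset_subset_eq_count)

context cring
begin

definition conv :: "('x multiset \<Rightarrow> 'a) \<Rightarrow> ('x multiset \<Rightarrow> 'a) \<Rightarrow> 'x multiset \<Rightarrow> 'a" where
  "conv P Q = (\<lambda>m. \<Oplus>l\<in>{l. l \<subseteq># m}. P l \<otimes> Q (m - l))"

abbreviation "pset S \<equiv> indexed_pset S (carrier R)"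

lemma pset_closed [simp]: "P \<in> pset S \<Longrightarrow> P m \<in> carrier R"
  by (rule indexed_pset_support(3))

lemma conv_const:
  assumes "k \<in> carrier R" "\<And>m. Q m \<in> carrier R"
  shows "conv (indexed_const k) Q = (\<lambda>m. k \<otimes> Q m)"
proof
  fix m
  have "conv (indexed_const k) Q m = (\<Oplus>l\<in>{l. l \<subseteq># m}. if {#} = l then k \<otimes> Q (m - l) else \<zero>)"
    unfolding conv_def by (rule finsum_cong') (use assms in \<open>auto simp: indexed_const_def\<close>)
  also have "\<dots> = k \<otimes> Q (m - {#})"
    by (rule finsum_singleton) (use assms finite_submultisets in auto)
  finally show "conv (indexed_const k) Q m = k \<otimes> Q m" by simp
qed

lemma conv_padd:
  assumes "\<And>m. P m \<in> carrier R" "\<And>m. P' m \<in> carrier R" "\<And>m. Q m \<in> carrier R"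
  shows "conv (indexed_padd P P') Q = indexed_padd (conv P Q) (conv P' Q)"
  unfolding indexed_padd_def conv_def
  using assms by (intro ext) (simp add: l_distr finsum_addf Pi_def)

text \<open>Only submultisets containing \<open>i\<close> contribute, and these are the
  \<open>add_mset i l\<close> with \<open>l\<close> contained in the rest of \<open>m\<close>.
  Together with the rules for constants and sums, this lets closure, associativity and evaluation of
  products be proved by induction on the first factor.\<close>

lemma conv_pmult:
  assumes "\<And>m. P m \<in> carrier R" "\<And>m. Q m \<in> carrier R"
  shows "conv (indexed_pmult P i) Q = indexed_pmult (conv P Q) i"
proof
  fix m
  show "conv (indexed_pmult P i) Q m = indexed_pmult (conv P Q) i m"
  proof (cases "i \<in># m")
    case False
    have notin: "i \<notin># l" if "l \<subseteq># m" for l using False mset_subset_eqD[OF that, of i] by blast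
    have "conv (indexed_pmult P i) Q m = (\<Oplus>l\<in>{l. l \<subseteq># m}. \<zero>)"
      unfolding conv_def by (rule finsum_cong') (simp_all add: indexed_pmult_def notin assms)
    then show ?thesis using False by (simp add: indexed_pmult_def)
  next
    case True
    then obtain m' where m: "m = add_mset i m'" by (metis insert_DiffM)
    have "(\<Oplus>l\<in>{l. l \<subseteq># m}. indexed_pmult P i l \<otimes> Q (m - l)) =
        (\<Oplus>l\<in>add_mset i ` {l. l \<subseteq># m'}. indexed_pmult P i l \<otimes> Q (m - l))"
    proof (rule add.finprod_mono_neutral_cong_right)
      fix l assume "l \<in> {l. l \<subseteq># m} - add_mset i ` {l. l \<subseteq># m'}"
      then have "l \<subseteq># m \<and> l \<notin> add_mset i ` {l. l \<subseteq># m'}"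
        unfolding Diff_iff mem_Collect_eq .
      note l = conjunct1[OF this] conjunct2[OF this]
      have "i \<notin># l"
      proof
        assume "i \<in># l"
        then obtain l' where l': "l = add_mset i l'" by (metis insert_DiffM)
        have "l' \<subseteq># m'" using l(1) unfolding l' m by simp
        then show False using l(2) unfolding l' by blast
      qed
      then show "indexed_pmult P i l \<otimes> Q (m - l) = \<zero>" using assms by (simp add: indexed_pmult_def)
    qed (use assms m in \<open>auto simp: indexed_pmult_def finite_submultisets\<close>)
    also have "\<dots> = (\<Oplus>l\<in>{l. l \<subseteq># m'}. indexed_pmult P i (add_mset i l) \<otimes> Q (m - add_mset i l))"
      by (rule add.finprod_reindex) (use assms in \<open>auto simp: indexed_pmult_def inj_on_def\<close>)
    also have "\<dots> = indexed_pmult (conv P Q) i m"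
      by (simp add: m indexed_pmult_def conv_def)
    finally show ?thesis by (simp only: conv_def)
  qed
qed

text \<open>Complementation of \<open>l\<close> in \<open>m\<close> is an involution of the
  submultisets of \<open>m\<close>; reindexing the sum by it exchanges the two factors.\<close>

lemma conv_comm:
  fixes P Q :: "'x multiset \<Rightarrow> 'a"
  assumes "\<And>m. P m \<in> carrier R" "\<And>m. Q m \<in> carrier R"
  shows "conv P Q = conv Q P"
proof
  fix m :: "'x multiset"
  have inj: "inj_on (\<lambda>l. m - l) {l. l \<subseteq># m}"
    by (rule inj_on_inverseI[of _ "\<lambda>l. m - l"]) (simp add: diff_diff_submultiset)
  have img: "(\<lambda>l. m - l) ` {l. l \<subseteq># m} = {l. l \<subseteq># m}"
  proof (intro subset_antisym subsetI)
    fix l assume "l \<in> {l. l \<subseteq># m}"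
    then show "l \<in> (\<lambda>l. m - l) ` {l. l \<subseteq># m}"
      by (intro image_eqI[of _ _ "m - l"]) (auto simp: diff_diff_submultiset)
  qed auto
  have "conv P Q m = (\<Oplus>l\<in>(\<lambda>l. m - l) ` {l. l \<subseteq># m}. P l \<otimes> Q (m - l))"
    by (simp only: conv_def img)
  also have "\<dots> = (\<Oplus>l\<in>{l. l \<subseteq># m}. P (m - l) \<otimes> Q (m - (m - l)))"
    by (rule add.finprod_reindex) (use assms inj in auto)
  also have "\<dots> = conv Q P m"
    unfolding conv_def by (rule finsum_cong') (use assms in \<open>auto simp: m_comm diff_diff_submultiset\<close>)
  finally show "conv P Q m = conv Q P m" .
qed

text \<open>The inductive definition offers only multiplication by variables. Scaling is the base
  case for products, and scaling by -1 supplies additive inverses in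
  \<open>cring_mpoly_ring\<close>.\<close>

lemma pset_scale:
  fixes S :: "'x set"
  assumes "k \<in> carrier R" "P \<in> pset S"
  shows "(\<lambda>m. k \<otimes> P m) \<in> pset S"
  using assms(2)
proof induction
  case (indexed_const l)
  have "(\<lambda>m :: 'x multiset. k \<otimes> indexed_const l m) = indexed_const (k \<otimes> l)"
    using assms(1) by (auto simp: indexed_const_def)
  then show ?case using assms(1) indexed_const by (simp add: indexed_pset.indexed_const)
next
  case (indexed_padd P Q)
  have "(\<lambda>m. k \<otimes> indexed_padd P Q m) = indexed_padd (\<lambda>m. k \<otimes> P m) (\<lambda>m. k \<otimes> Q m)"
    using assms(1) indexed_padd by (auto simp: indexed_padd_def r_distr)
  then show ?case using indexed_padd by (simp add: indexed_pset.indexed_padd)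
next
  case (indexed_pmult P i)
  have "(\<lambda>m. k \<otimes> indexed_pmult P i m) = indexed_pmult (\<lambda>m. k \<otimes> P m) i"
    using assms(1) by (auto simp: indexed_pmult_def)
  then show ?case using indexed_pmult by (simp add: indexed_pset.indexed_pmult)
qed

lemma conv_closed:
  assumes "P \<in> pset S" "Q \<in> pset S"
  shows "conv P Q \<in> pset S"
  using assms(1)
proof induction
  case (indexed_const k)
  then show ?case using assms(2) by (simp add: conv_const pset_scale)
next
  case (indexed_padd P P')
  then show ?case using assms(2) by (simp add: conv_padd indexed_pset.indexed_padd)
next
  case (indexed_pmult P i)
  then show ?case using assms(2) by (simp add: conv_pmult indexed_pset.indexed_pmult)
qed

lemma conv_scale:
  assumes "k \<in> carrier R" "\<And>m. P m \<in> carrier R" "\<And>m. Q m \<in> carrier R"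
  shows "conv (\<lambda>m. k \<otimes> P m) Q = (\<lambda>m. k \<otimes> conv P Q m)"
  using assms by (intro ext) (simp add: conv_def finsum_rdistr finite_submultisets m_assoc Pi_def)

text \<open>Induction on the first factor reduces to constants, where associativity is compatibility
  with scaling; this avoids reindexing sums over triples of monomials.\<close>

lemma conv_assoc:
  assumes "P \<in> pset S" "Q \<in> pset S" "T \<in> pset S"
  shows "conv (conv P Q) T = conv P (conv Q T)"
  using assms(1)
proof induction
  case (indexed_const k)
  note c = pset_closed[OF assms(2)] pset_closed[OF assms(3)] pset_closed[OF conv_closed[OF assms(2,3)]]
  show ?case
    unfolding conv_const[OF indexed_const c(1)] conv_const[OF indexed_const c(3)]
    by (rule conv_scale[OF indexed_const c(1,2)])
next
  case (indexed_padd P P')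
  note c = pset_closed[OF indexed_padd.hyps(1)] pset_closed[OF indexed_padd.hyps(2)] pset_closed[OF assms(2)]
    pset_closed[OF assms(3)] pset_closed[OF conv_closed[OF assms(2,3)]]
    pset_closed[OF conv_closed[OF indexed_padd.hyps(1) assms(2)]]
    pset_closed[OF conv_closed[OF indexed_padd.hyps(2) assms(2)]]
  show ?case
    unfolding conv_padd[OF c(1-3)] conv_padd[OF c(6,7,4)] conv_padd[OF c(1,2,5)] indexed_padd.IH ..
next
  case (indexed_pmult P i)
  note c = pset_closed[OF indexed_pmult.hyps(1)] pset_closed[OF assms(2)]
    pset_closed[OF assms(3)] pset_closed[OF conv_closed[OF assms(2,3)]]
    pset_closed[OF conv_closed[OF indexed_pmult.hyps(1) assms(2)]]
  show ?case
    unfolding conv_pmult[OF c(1,2)] conv_pmult[OF c(5,3)] conv_pmult[OF c(1,4)] indexed_pmult.IH ..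
qed

lemma mpoly_ring_simps:
  "carrier (mpoly_ring R S) = pset S" "P \<otimes>\<^bsub>mpoly_ring R S\<^esub> Q = conv P Q"
  "\<one>\<^bsub>mpoly_ring R S\<^esub> = indexed_const \<one>" "\<zero>\<^bsub>mpoly_ring R S\<^esub> = indexed_const \<zero>"
  "P \<oplus>\<^bsub>mpoly_ring R S\<^esub> Q = indexed_padd P Q"
  by (simp_all add: mpoly_ring_def conv_def)

lemma cring_mpoly_ring: "cring (mpoly_ring R S)"
  for S :: "'x set"
proof (intro cringI abelian_groupI comm_monoidI, unfold mpoly_ring_simps)
  fix x y z :: "'x multiset \<Rightarrow> 'a"
  show "indexed_const \<zero> \<in> pset S" "indexed_const \<one> \<in> pset S"
    by (auto intro: indexed_pset.indexed_const)
  assume x: "x \<in> pset S"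
  note [simp] = pset_closed[OF x]
  show "indexed_padd (indexed_const \<zero>) x = x" by (simp add: indexed_padd_def indexed_const_def)
  show "conv (indexed_const \<one>) x = x" by (simp add: conv_const)
  show "\<exists>y\<in>pset S. indexed_padd y x = indexed_const \<zero>"
  proof (rule bexI)
    show "indexed_padd (\<lambda>m. \<ominus> \<one> \<otimes> x m) x = indexed_const \<zero>"
      by (auto simp: indexed_padd_def indexed_zero_def l_minus l_neg)
  qed (use x in \<open>simp add: pset_scale\<close>)
  assume y: "y \<in> pset S"
  note [simp] = pset_closed[OF y]
  show "indexed_padd x y \<in> pset S" using x y by (rule indexed_pset.indexed_padd)
  show "indexed_padd x y = indexed_padd y x" by (simp add: indexed_padd_def a_comm)
  show "conv x y \<in> pset S" using x y by (rule conv_closed)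
  show "conv x y = conv y x" by (rule conv_comm) auto
  assume z: "z \<in> pset S"
  note [simp] = pset_closed[OF z]
  show "indexed_padd (indexed_padd x y) z = indexed_padd x (indexed_padd y z)"
    by (simp add: indexed_padd_def a_assoc)
  show "conv (conv x y) z = conv x (conv y z)" using x y z by (rule conv_assoc)
  show "conv (indexed_padd x y) z = indexed_padd (conv x z) (conv y z)" by (rule conv_padd) auto
qed

lemma indexed_const_ring_hom: "indexed_const \<in> Ring.ring_hom R (mpoly_ring R S)"
  for S :: "'x set"
proof (rule ring_hom_memI, unfold mpoly_ring_simps)
  fix x y assume xy: "x \<in> carrier R" "y \<in> carrier R"
  have c: "\<And>m :: 'x multiset. indexed_const y m \<in> carrier R" using xy by (simp add: indexed_const_def)
  show "indexed_const (x \<otimes> y) = conv (indexed_const x) (indexed_const y :: 'x multiset \<Rightarrow> 'a)"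
    unfolding conv_const[OF xy(1) c] using xy by (auto simp: indexed_const_def)
  show "indexed_const (x \<oplus> y) = indexed_padd (indexed_const x) (indexed_const y :: 'x multiset \<Rightarrow> 'a)"
    by (simp add: indexed_padd_const)
qed (auto intro: indexed_pset.indexed_const)

lemma indexed_var_closed: "i \<in> S \<Longrightarrow> indexed_var i \<in> carrier (mpoly_ring R S)"
  by (simp add: mpoly_ring_simps indexed_var_def indexed_pset.intros)

lemma indexed_pmult_eq:
  assumes "P \<in> carrier (mpoly_ring R S)" "i \<in> S"
  shows "indexed_pmult P i = indexed_var i \<otimes>\<^bsub>mpoly_ring R S\<^esub> P"
proof -
  have P: "\<And>m. P m \<in> carrier R" using assms by (simp add: mpoly_ring_simps)
  have one: "\<And>m. indexed_const \<one> m \<in> carrier R" by (simp add: indexed_const_def)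
  show ?thesis
    unfolding mpoly_ring_simps indexed_var_def conv_pmult[OF one P] conv_const[OF one_closed P] using P by simp
qed

lemma mpoly_ring_induct [consumes 1, case_names const add var_mult]:
  assumes "P \<in> carrier (mpoly_ring R S)"
    and "\<And>k. k \<in> carrier R \<Longrightarrow> Z (indexed_const k)"
    and "\<And>P Q. P \<in> carrier (mpoly_ring R S) \<Longrightarrow> Q \<in> carrier (mpoly_ring R S) \<Longrightarrow> Z P \<Longrightarrow> Z Q \<Longrightarrow>
      Z (P \<oplus>\<^bsub>mpoly_ring R S\<^esub> Q)"
    and "\<And>P i. P \<in> carrier (mpoly_ring R S) \<Longrightarrow> i \<in> S \<Longrightarrow> Z P \<Longrightarrow>
      Z (indexed_var i \<otimes>\<^bsub>mpoly_ring R S\<^esub> P)"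
  shows "Z P"
proof -
  have "P \<in> pset S" using assms(1) by (simp add: mpoly_ring_simps)
  then show ?thesis
  proof induction
    case (indexed_pmult P i)
    then show ?case using assms(4)[of P i] indexed_pmult_eq[of P S i] by (simp add: mpoly_ring_simps(1))
  qed (use assms(2,3) in \<open>auto simp: mpoly_ring_simps(1,5)\<close>)
qed

text \<open>The uniqueness half of the universal property of polynomial rings. Simplicial identities
  are reduced by it to constants and variables.\<close>

lemma mpoly_ring_hom_eqI:
  assumes f: "ring_hom_cring (mpoly_ring R S) B f" and g: "ring_hom_cring (mpoly_ring R S) B g"
    and const: "\<And>k. k \<in> carrier R \<Longrightarrow> f (indexed_const k) = g (indexed_const k)"
    and var: "\<And>i. i \<in> S \<Longrightarrow> f (indexed_var i) = g (indexed_var i)"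
    and P: "P \<in> carrier (mpoly_ring R S)"
  shows "f P = g P"
proof -
  interpret f: ring_hom_cring "mpoly_ring R S" B f by fact
  interpret g: ring_hom_cring "mpoly_ring R S" B g by fact
  show ?thesis
    using P by (induction rule: mpoly_ring_induct) (simp_all add: const var indexed_var_closed)
qed

end

section \<open>Evaluation of polynomials in several variables as a ring homomorphism\<close>

locale mpoly_evaluation = ring_hom_cring R A \<phi>
  for R :: "('a, 'm) ring_scheme" and A :: "('b, 'n) ring_scheme" and \<phi> +
  fixes S :: "'x set" and v :: "'x \<Rightarrow> 'b"
  assumes v_closed: "i \<in> S \<Longrightarrow> v i \<in> carrier A"
begin

definition monomial :: "'x multiset \<Rightarrow> 'b" where
  "monomial m = (\<Otimes>\<^bsub>A\<^esub>x\<in>set_mset m. v x [^]\<^bsub>A\<^esub> count m x)"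

lemma monomial_closed: "set_mset m \<subseteq> S \<Longrightarrow> monomial m \<in> carrier A"
  unfolding monomial_def by (rule S.finprod_closed) (use v_closed in auto)

lemma monomial_empty: "monomial {#} = \<one>\<^bsub>A\<^esub>"
  by (simp add: monomial_def)

text \<open>The index set of the product grows when \<open>i\<close> does not occur in
  \<open>m\<close>. Both monomials are therefore written first as a power of \<open>v i\<close>,
  possibly with exponent zero, times the product over the other variables.\<close>

lemma monomial_add_mset:
  assumes "i \<in> S" "set_mset m \<subseteq> S"
  shows "monomial (add_mset i m) = v i \<otimes>\<^bsub>A\<^esub> monomial m"
proof -
  let ?J = "set_mset m - {i}"
  have split: "monomial l = v i [^]\<^bsub>A\<^esub> count l i \<otimes>\<^bsub>A\<^esub> (\<Otimes>\<^bsub>A\<^esub>x\<in>?J. v x [^]\<^bsub>A\<^esub> count m x)"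
    if l: "set_mset l \<subseteq> insert i ?J" "\<And>x. x \<in> ?J \<Longrightarrow> count l x = count m x" for l
  proof -
    have "monomial l = (\<Otimes>\<^bsub>A\<^esub>x\<in>insert i ?J. v x [^]\<^bsub>A\<^esub> count l x)"
      unfolding monomial_def
      by (rule S.finprod_mono_neutral_cong_left)
        (use assms l v_closed in \<open>auto simp: not_in_iff\<close>)
    also have "\<dots> = v i [^]\<^bsub>A\<^esub> count l i \<otimes>\<^bsub>A\<^esub> (\<Otimes>\<^bsub>A\<^esub>x\<in>?J. v x [^]\<^bsub>A\<^esub> count l x)"
      by (rule S.finprod_insert) (use assms v_closed in auto)
    also have "(\<Otimes>\<^bsub>A\<^esub>x\<in>?J. v x [^]\<^bsub>A\<^esub> count l x) = (\<Otimes>\<^bsub>A\<^esub>x\<in>?J. v x [^]\<^bsub>A\<^esub> count m x)"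
      by (rule S.finprod_cong') (use assms l v_closed in auto)
    finally show ?thesis .
  qed
  have vi: "v i \<in> carrier A" by (rule v_closed) fact
  have P: "(\<Otimes>\<^bsub>A\<^esub>x\<in>?J. v x [^]\<^bsub>A\<^esub> count m x) \<in> carrier A"
    by (rule S.finprod_closed) (use assms v_closed in auto)
  have "monomial (add_mset i m) = v i [^]\<^bsub>A\<^esub> Suc (count m i) \<otimes>\<^bsub>A\<^esub> (\<Otimes>\<^bsub>A\<^esub>x\<in>?J. v x [^]\<^bsub>A\<^esub> count m x)"
    by (subst split) auto
  also have "\<dots> = v i \<otimes>\<^bsub>A\<^esub> (v i [^]\<^bsub>A\<^esub> count m i \<otimes>\<^bsub>A\<^esub> (\<Otimes>\<^bsub>A\<^esub>x\<in>?J. v x [^]\<^bsub>A\<^esub> count m x))"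
    using vi P by (simp add: S.m_ac)
  also have "v i [^]\<^bsub>A\<^esub> count m i \<otimes>\<^bsub>A\<^esub> (\<Otimes>\<^bsub>A\<^esub>x\<in>?J. v x [^]\<^bsub>A\<^esub> count m x) = monomial m"
    by (rule split[symmetric]) auto
  finally show ?thesis .
qed

abbreviation "ev \<equiv> mpoly_eval R A \<phi> v"

text \<open>Supports change under addition, shifting and scaling; a larger common index set lets
  these operations be compared term by term.\<close>

lemma eval_superset:
  assumes "P \<in> R.pset S" "finite I" "\<And>m. P m \<noteq> \<zero>\<^bsub>R\<^esub> \<Longrightarrow> m \<in> I" "\<And>m. m \<in> I \<Longrightarrow> set_mset m \<subseteq> S"
  shows "ev P = (\<Oplus>\<^bsub>A\<^esub>m\<in>I. \<phi> (P m) \<otimes>\<^bsub>A\<^esub> monomial m)"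
  unfolding mpoly_eval_def monomial_def[symmetric]
  by (rule S.add.finprod_mono_neutral_cong_left)
    (use assms in \<open>auto simp: monomial_closed\<close>)

lemma eval_closed: "P \<in> R.pset S \<Longrightarrow> ev P \<in> carrier A"
  unfolding mpoly_eval_def monomial_def[symmetric]
  by (rule S.finsum_closed) (use R.indexed_pset_support(2) in \<open>force simp: monomial_closed\<close>)

lemma eval_const: "k \<in> carrier R \<Longrightarrow> ev (R.indexed_const k) = \<phi> k"
  by (subst eval_superset[of _ "{{#}}"])
    (auto simp: R.indexed_const_def monomial_empty split: if_splits
      intro: R.indexed_pset.indexed_const[unfolded R.indexed_const_def])

lemma eval_padd:
  assumes P: "P \<in> R.pset S" and Q: "Q \<in> R.pset S"
  shows "ev (R.indexed_padd P Q) = ev P \<oplus>\<^bsub>A\<^esub> ev Q"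
proof -
  let ?I = "{m. P m \<noteq> \<zero>\<^bsub>R\<^esub>} \<union> {m. Q m \<noteq> \<zero>\<^bsub>R\<^esub>}"
  have sup: "set_mset m \<subseteq> S" if "m \<in> ?I" for m
    using that R.indexed_pset_support(2)[OF P] R.indexed_pset_support(2)[OF Q] by blast
  have *: "ev T = (\<Oplus>\<^bsub>A\<^esub>m\<in>?I. \<phi> (T m) \<otimes>\<^bsub>A\<^esub> monomial m)" if "T \<in> {P, Q, R.indexed_padd P Q}" for T
  proof (rule eval_superset)
    show "T \<in> R.pset S" using that P Q by (auto intro: R.indexed_pset.indexed_padd)
    show "finite ?I" using R.indexed_pset_support(1)[OF P] R.indexed_pset_support(1)[OF Q] by simp
    show "m \<in> ?I" if "T m \<noteq> \<zero>\<^bsub>R\<^esub>" for m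
      using that \<open>T \<in> {P, Q, R.indexed_padd P Q}\<close> by (auto simp: R.indexed_padd_def)
  qed (use sup in blast)
  have "ev (R.indexed_padd P Q) = (\<Oplus>\<^bsub>A\<^esub>m\<in>?I. \<phi> (P m) \<otimes>\<^bsub>A\<^esub> monomial m \<oplus>\<^bsub>A\<^esub> \<phi> (Q m) \<otimes>\<^bsub>A\<^esub> monomial m)"
    by (subst *, simp, rule S.finsum_cong')
      (use P Q sup monomial_closed in \<open>auto simp: R.indexed_padd_def S.l_distr\<close>)
  also have "\<dots> = ev P \<oplus>\<^bsub>A\<^esub> ev Q"
    by (subst S.finsum_addf) (use P Q sup monomial_closed in \<open>auto simp: *\<close>)
  finally show ?thesis .
qed

lemma eval_pmult:
  assumes P: "P \<in> R.pset S" and i: "i \<in> S"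
  shows "ev (R.indexed_pmult P i) = v i \<otimes>\<^bsub>A\<^esub> ev P"
proof -
  let ?I = "{m. P m \<noteq> \<zero>\<^bsub>R\<^esub>}"
  note sup = R.indexed_pset_support[OF P]
  have "ev (R.indexed_pmult P i) = (\<Oplus>\<^bsub>A\<^esub>m\<in>add_mset i ` ?I. \<phi> (R.indexed_pmult P i m) \<otimes>\<^bsub>A\<^esub> monomial m)"
  proof (rule eval_superset)
    show "R.indexed_pmult P i \<in> R.pset S" using P i by (rule R.indexed_pset.indexed_pmult)
    show "m \<in> add_mset i ` ?I" if "R.indexed_pmult P i m \<noteq> \<zero>\<^bsub>R\<^esub>" for m
    proof -
      have "i \<in># m" "P (m - {#i#}) \<noteq> \<zero>\<^bsub>R\<^esub>"
        using that by (auto simp: R.indexed_pmult_def split: if_splits)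
      then show ?thesis by (intro image_eqI[of _ _ "m - {#i#}"]) auto
    qed
    show "set_mset m \<subseteq> S" if m: "m \<in> add_mset i ` ?I" for m
    proof -
      obtain l where "m = add_mset i l" "P l \<noteq> \<zero>\<^bsub>R\<^esub>" using m by blast
      then show ?thesis using sup(2)[of l] i by simp
    qed
  qed (use sup(1) in simp)
  also have "\<dots> = (\<Oplus>\<^bsub>A\<^esub>m\<in>?I. \<phi> (R.indexed_pmult P i (add_mset i m)) \<otimes>\<^bsub>A\<^esub> monomial (add_mset i m))"
    by (rule S.add.finprod_reindex)
      (use sup i in \<open>auto simp: R.indexed_pmult_def monomial_closed inj_on_def\<close>)
  also have "\<dots> = (\<Oplus>\<^bsub>A\<^esub>m\<in>?I. v i \<otimes>\<^bsub>A\<^esub> (\<phi> (P m) \<otimes>\<^bsub>A\<^esub> monomial m))"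
  proof (rule S.finsum_cong')
    fix m assume "m \<in> ?I"
    then have "set_mset m \<subseteq> S" using sup by auto
    then show "\<phi> (R.indexed_pmult P i (add_mset i m)) \<otimes>\<^bsub>A\<^esub> monomial (add_mset i m) =
        v i \<otimes>\<^bsub>A\<^esub> (\<phi> (P m) \<otimes>\<^bsub>A\<^esub> monomial m)"
      using i sup(3) v_closed[OF i] monomial_closed[of m]
      by (simp add: monomial_add_mset R.indexed_pmult_def S.m_ac)
  qed (use sup i v_closed[OF i] monomial_closed in auto)
  also have "\<dots> = v i \<otimes>\<^bsub>A\<^esub> ev P"
    unfolding mpoly_eval_def monomial_def[symmetric]
    by (rule S.finsum_rdistr[symmetric]) (use sup v_closed[OF i] monomial_closed in auto)
  finally show ?thesis .
qed

lemma eval_scale: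
  assumes k: "k \<in> carrier R" and P: "P \<in> R.pset S"
  shows "ev (\<lambda>m. k \<otimes>\<^bsub>R\<^esub> P m) = \<phi> k \<otimes>\<^bsub>A\<^esub> ev P"
proof -
  note sup = R.indexed_pset_support[OF P]
  have "ev (\<lambda>m. k \<otimes>\<^bsub>R\<^esub> P m) = (\<Oplus>\<^bsub>A\<^esub>m\<in>{m. P m \<noteq> \<zero>\<^bsub>R\<^esub>}. \<phi> (k \<otimes>\<^bsub>R\<^esub> P m) \<otimes>\<^bsub>A\<^esub> monomial m)"
    by (rule eval_superset) (use k P sup R.pset_scale in auto)
  also have "\<dots> = (\<Oplus>\<^bsub>A\<^esub>m\<in>{m. P m \<noteq> \<zero>\<^bsub>R\<^esub>}. \<phi> k \<otimes>\<^bsub>A\<^esub> (\<phi> (P m) \<otimes>\<^bsub>A\<^esub> monomial m))"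
    by (rule S.finsum_cong') (use k sup monomial_closed in \<open>auto simp: S.m_assoc\<close>)
  also have "\<dots> = \<phi> k \<otimes>\<^bsub>A\<^esub> ev P"
    unfolding mpoly_eval_def monomial_def[symmetric]
    by (rule S.finsum_rdistr[symmetric]) (use k sup monomial_closed in auto)
  finally show ?thesis .
qed

lemma eval_conv:
  assumes P: "P \<in> R.pset S" and Q: "Q \<in> R.pset S"
  shows "ev (R.conv P Q) = ev P \<otimes>\<^bsub>A\<^esub> ev Q"
  using P
proof induction
  case (indexed_const k)
  show ?case
    unfolding R.conv_const[OF indexed_const R.pset_closed[OF Q]] eval_const[OF indexed_const]
    by (rule eval_scale[OF indexed_const Q])
next
  case (indexed_padd P P')
  note h = indexed_padd.hyps
  show ?case
    unfolding R.conv_padd[OF R.pset_closed[OF h(1)] R.pset_closed[OF h(2)] R.pset_closed[OF Q]]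
      eval_padd[OF R.conv_closed[OF h(1) Q] R.conv_closed[OF h(2) Q]] eval_padd[OF h] indexed_padd.IH
    using eval_closed[OF h(1)] eval_closed[OF h(2)] eval_closed[OF Q] by (simp add: S.l_distr)
next
  case (indexed_pmult P i)
  note h = indexed_pmult.hyps
  show ?case
    unfolding R.conv_pmult[OF R.pset_closed[OF h(1)] R.pset_closed[OF Q]]
      eval_pmult[OF R.conv_closed[OF h(1) Q] h(2)] eval_pmult[OF h] indexed_pmult.IH
    using eval_closed[OF h(1)] eval_closed[OF Q] v_closed[OF h(2)] by (simp add: S.m_assoc)
qed

lemma eval_ring_hom: "ev \<in> Ring.ring_hom (mpoly_ring R S) A"
  by (rule ring_hom_memI)
    (simp_all add: R.mpoly_ring_simps eval_closed eval_conv eval_padd eval_const)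

lemma eval_var: "i \<in> S \<Longrightarrow> ev (R.indexed_var i) = v i"
  unfolding R.indexed_var_def
  using v_closed by (subst eval_pmult) (auto intro: R.indexed_pset.indexed_const simp: eval_const)

end

section \<open>The standard simplicial ring\<close>

lemma ring_hom_cring_comp:
  assumes "ring_hom_cring A B f" "ring_hom_cring B C g"
  shows "ring_hom_cring A C (\<lambda>x. g (f x))"
proof -
  interpret f: ring_hom_cring A B f by fact
  interpret g: ring_hom_cring B C g by fact
  have "(\<lambda>x. g (f x)) \<in> Ring.ring_hom A C"
    using ring_hom_trans[OF f.homh g.homh] by (simp only: comp_def)
  then show ?thesis by unfold_locales
qed

lemma ring_hom_cring_id:
  assumes "cring A"
  shows "ring_hom_cring A A (\<lambda>x. x)"
proof -
  interpret cring A by fact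
  show ?thesis by unfold_locales (rule ring_hom_memI; simp)
qed

section \<open>Homomorphisms between the rings of functions on simplices\<close>

context cring
begin

definition simplex_class :: "nat \<Rightarrow> (nat multiset \<Rightarrow> 'a) \<Rightarrow> (nat multiset \<Rightarrow> 'a) set" where
  "simplex_class n p = simplex_ideal R n +>\<^bsub>mpoly_ring R {..n}\<^esub> p"

lemma simplex_generator_closed:
  "(\<Oplus>\<^bsub>mpoly_ring R {..n}\<^esub>i\<in>{..n}. indexed_var i) \<in> carrier (mpoly_ring R {..n})"
proof -
  interpret P: cring "mpoly_ring R {..n}" by (rule cring_mpoly_ring)
  show ?thesis by (rule P.finsum_closed) (simp add: indexed_var_closed)
qed

lemma ideal_simplex_ideal: "ideal (simplex_ideal R n) (mpoly_ring R {..n})"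
proof -
  interpret P: cring "mpoly_ring R {..n}" by (rule cring_mpoly_ring)
  show ?thesis
    unfolding simplex_ideal_def Let_def
    by (rule P.cgenideal_ideal[OF P.minus_closed[OF simplex_generator_closed P.one_closed]])
qed

lemma simplex_class_hom:
  "ring_hom_cring (mpoly_ring R {..n}) (simplex_ring R n) (simplex_class n)"
proof -
  have "simplex_class n = (\<lambda>p. simplex_ideal R n +>\<^bsub>mpoly_ring R {..n}\<^esub> p)"
    by (intro ext) (rule simplex_class_def)
  then show ?thesis
    unfolding simplex_ring_def
    using ideal.rcos_ring_hom_cring[OF ideal_simplex_ideal cring_mpoly_ring, of n] by (simp only:)
qed

lemma cring_simplex_ring: "cring (simplex_ring R n)"
  using simplex_class_hom[of n] by (simp add: ring_hom_cring_def)

lemma simplex_ring_carrier: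
  assumes "U \<in> carrier (simplex_ring R n)"
  obtains p where "p \<in> carrier (mpoly_ring R {..n})" "U = simplex_class n p"
  using assms unfolding simplex_ring_def FactRing_def A_RCOSETS_def' simplex_class_def by auto

lemma simplex_class_ideal:
  assumes "h \<in> simplex_ideal R n"
  shows "simplex_class n h = \<zero>\<^bsub>simplex_ring R n\<^esub>"
proof -
  interpret P: cring "mpoly_ring R {..n}" by (rule cring_mpoly_ring)
  show ?thesis
    using P.a_rcos_zero[OF ideal_simplex_ideal assms] by (simp add: simplex_ring_def FactRing_def simplex_class_def)
qed

lemma hom_simplex_generator:
  assumes "ring_hom_cring (mpoly_ring R {..n}) B g"
  shows "g ((\<Oplus>\<^bsub>mpoly_ring R {..n}\<^esub>i\<in>{..n}. indexed_var i) \<ominus>\<^bsub>mpoly_ring R {..n}\<^esub> \<one>\<^bsub>mpoly_ring R {..n}\<^esub>) =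
    (\<Oplus>\<^bsub>B\<^esub>i\<in>{..n}. g (indexed_var i)) \<ominus>\<^bsub>B\<^esub> \<one>\<^bsub>B\<^esub>"
proof -
  interpret g: ring_hom_cring "mpoly_ring R {..n}" B g by fact
  have "g (\<Oplus>\<^bsub>mpoly_ring R {..n}\<^esub>i\<in>{..n}. indexed_var i) = (\<Oplus>\<^bsub>B\<^esub>i\<in>{..n}. (g \<circ> indexed_var) i)"
    by (rule g.hom_finsum) (simp add: indexed_var_closed)
  then show ?thesis
    using simplex_generator_closed[of n] by (simp add: a_minus_def comp_def)
qed

lemma simplex_class_sum: "(\<Oplus>\<^bsub>simplex_ring R n\<^esub>i\<in>{..n}. simplex_class n (indexed_var i)) = \<one>\<^bsub>simplex_ring R n\<^esub>"
proof -
  interpret P: cring "mpoly_ring R {..n}" by (rule cring_mpoly_ring)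
  interpret A: cring "simplex_ring R n" by (rule cring_simplex_ring)
  interpret c: ring_hom_cring "mpoly_ring R {..n}" "simplex_ring R n" "simplex_class n"
    by (rule simplex_class_hom)
  let ?s = "\<Oplus>\<^bsub>simplex_ring R n\<^esub>i\<in>{..n}. simplex_class n (indexed_var i)"
  have s: "?s \<in> carrier (simplex_ring R n)"
    by (rule A.finsum_closed) (simp add: indexed_var_closed)
  have "?s \<ominus>\<^bsub>simplex_ring R n\<^esub> \<one>\<^bsub>simplex_ring R n\<^esub> = \<zero>\<^bsub>simplex_ring R n\<^esub>"
    unfolding hom_simplex_generator[OF simplex_class_hom, symmetric]
    by (rule simplex_class_ideal)
      (simp only: simplex_ideal_def Let_def P.cgenideal_self[OF P.minus_closed[OF simplex_generator_closed P.one_closed]])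
  then show ?thesis using A.r_right_minus_eq[OF s A.one_closed] by (simp only:)
qed

text \<open>The second condition says that evaluation followed by the quotient map kills the
  generator of \<open>simplex_ideal\<close>. The sum is tested in the quotient, since for
  polynomials it would fail already for the faces.\<close>

definition simplex_substitution :: "nat \<Rightarrow> nat \<Rightarrow> (nat \<Rightarrow> nat multiset \<Rightarrow> 'a) \<Rightarrow> bool" where
  "simplex_substitution n m v \<longleftrightarrow> (\<forall>j\<le>n. v j \<in> carrier (mpoly_ring R {..m})) \<and>
     (\<Oplus>\<^bsub>simplex_ring R m\<^esub>j\<in>{..n}. simplex_class m (v j)) = \<one>\<^bsub>simplex_ring R m\<^esub>"

lemma mpoly_evaluation_simplex:
  "simplex_substitution n m v \<Longrightarrow> mpoly_evaluation R (mpoly_ring R {..m}) indexed_const {..n} v"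
  using cring_mpoly_ring[where S = "{..m}"] indexed_const_ring_hom[where S = "{..m}"] cring_axioms
  by (simp add: mpoly_evaluation_def mpoly_evaluation_axioms_def ring_hom_cring_def
      ring_hom_cring_axioms_def simplex_substitution_def)

text \<open>\<open>simplex_map\<close> extracts the only element of the image of a coset. Evaluation
  followed by the quotient map is constant on the coset, because two representatives differ by a
  multiple of the generator, which goes to zero.\<close>

lemma simplex_map_class:
  assumes v: "simplex_substitution n m v" and p: "p \<in> carrier (mpoly_ring R {..n})"
  shows "simplex_map R m v (simplex_class n p) =
    simplex_class m (mpoly_eval R (mpoly_ring R {..m}) indexed_const v p)"
proof -
  interpret P: cring "mpoly_ring R {..n}" by (rule cring_mpoly_ring)
  interpret Q: cring "mpoly_ring R {..m}" by (rule cring_mpoly_ring)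
  interpret A: cring "simplex_ring R m" by (rule cring_simplex_ring)
  interpret E: mpoly_evaluation R "mpoly_ring R {..m}" indexed_const "{..n}" v
    by (rule mpoly_evaluation_simplex[OF v])
  have ev: "ring_hom_cring (mpoly_ring R {..n}) (mpoly_ring R {..m}) E.ev"
    by unfold_locales (rule E.eval_ring_hom)
  define g where "g x = simplex_class m (E.ev x)" for x
  have g: "ring_hom_cring (mpoly_ring R {..n}) (simplex_ring R m) g"
    unfolding g_def by (rule ring_hom_cring_comp[OF ev simplex_class_hom])
  interpret g: ring_hom_cring "mpoly_ring R {..n}" "simplex_ring R m" g by (rule g)
  let ?s = "(\<Oplus>\<^bsub>mpoly_ring R {..n}\<^esub>i\<in>{..n}. indexed_var i) \<ominus>\<^bsub>mpoly_ring R {..n}\<^esub> \<one>\<^bsub>mpoly_ring R {..n}\<^esub>"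
  have s: "?s \<in> carrier (mpoly_ring R {..n})"
    by (rule P.minus_closed[OF simplex_generator_closed P.one_closed])
  interpret c: ring_hom_cring "mpoly_ring R {..m}" "simplex_ring R m" "simplex_class m"
    by (rule simplex_class_hom)
  have vc: "v j \<in> carrier (mpoly_ring R {..m})" if "j \<in> {..n}" for j
    using conjunct1[OF v[unfolded simplex_substitution_def]] that by blast
  have "(\<Oplus>\<^bsub>simplex_ring R m\<^esub>i\<in>{..n}. g (indexed_var i)) = (\<Oplus>\<^bsub>simplex_ring R m\<^esub>i\<in>{..n}. simplex_class m (v i))"
  proof (rule A.finsum_cong'[OF HOL.refl])
    show "(\<lambda>i. simplex_class m (v i)) \<in> {..n} \<rightarrow> carrier (simplex_ring R m)"
      by (rule Pi_I) (rule c.hom_closed[OF vc])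
    show "g (indexed_var i) = simplex_class m (v i)" if "i \<in> {..n}" for i
      unfolding g_def E.eval_var[OF that] ..
  qed
  also have "\<dots> = \<one>\<^bsub>simplex_ring R m\<^esub>" using v unfolding simplex_substitution_def by (rule conjunct2)
  finally have gs: "g ?s = \<zero>\<^bsub>simplex_ring R m\<^esub>"
    unfolding hom_simplex_generator[OF g] by (simp only: a_minus_def A.r_neg[OF A.one_closed])
  have const: "g q = g p" if q: "q \<in> simplex_class n p" for q
  proof -
    have "\<exists>h\<in>simplex_ideal R n. q = h \<oplus>\<^bsub>mpoly_ring R {..n}\<^esub> p"
      using q by (simp add: simplex_class_def a_r_coset_defs)
    then obtain h where h: "h \<in> simplex_ideal R n" "q = h \<oplus>\<^bsub>mpoly_ring R {..n}\<^esub> p"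
      by blast
    have "h \<in> {x \<otimes>\<^bsub>mpoly_ring R {..n}\<^esub> ?s | x. x \<in> carrier (mpoly_ring R {..n})}"
      using h(1) unfolding simplex_ideal_def Let_def cgenideal_def .
    then obtain x where x: "x \<in> carrier (mpoly_ring R {..n})" "h = x \<otimes>\<^bsub>mpoly_ring R {..n}\<^esub> ?s"
      by blast
    have "g q = g x \<otimes>\<^bsub>simplex_ring R m\<^esub> g ?s \<oplus>\<^bsub>simplex_ring R m\<^esub> g p"
      unfolding h(2) x(2) g.hom_add[OF P.m_closed[OF x(1) s] p] g.hom_mult[OF x(1) s] ..
    then show ?thesis using x(1) p unfolding gs by simp
  qed
  have "\<zero>\<^bsub>mpoly_ring R {..n}\<^esub> \<in> simplex_ideal R n"
    by (rule additive_subgroup.zero_closed[OF ideal.axioms(1)[OF ideal_simplex_ideal]])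
  then have "\<zero>\<^bsub>mpoly_ring R {..n}\<^esub> \<oplus>\<^bsub>mpoly_ring R {..n}\<^esub> p \<in> simplex_class n p"
    by (auto simp: simplex_class_def a_r_coset_defs)
  then have "p \<in> simplex_class n p" unfolding P.l_zero[OF p] .
  moreover have "g ` simplex_class n p = (\<lambda>_. g p) ` simplex_class n p"
    by (rule image_cong[OF HOL.refl const])
  ultimately have "g ` simplex_class n p = {g p}" by (simp only: image_constant)
  then have "the_elem (g ` simplex_class n p) = g p" by (simp only: the_elem_eq)
  then show ?thesis
    unfolding simplex_map_def Let_def g_def simplex_class_def .
qed

lemma simplex_map_hom:
  assumes v: "simplex_substitution n m v"
  shows "ring_hom_cring (simplex_ring R n) (simplex_ring R m) (simplex_map R m v)"
proof -
  interpret A: cring "simplex_ring R n" by (rule cring_simplex_ring)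
  interpret B: cring "simplex_ring R m" by (rule cring_simplex_ring)
  interpret P: cring "mpoly_ring R {..n}" by (rule cring_mpoly_ring)
  interpret Q: cring "mpoly_ring R {..m}" by (rule cring_mpoly_ring)
  interpret E: mpoly_evaluation R "mpoly_ring R {..m}" indexed_const "{..n}" v
    by (rule mpoly_evaluation_simplex[OF v])
  have ev: "ring_hom_cring (mpoly_ring R {..n}) (mpoly_ring R {..m}) E.ev"
    by unfold_locales (rule E.eval_ring_hom)
  define g where "g x = simplex_class m (E.ev x)" for x
  interpret g: ring_hom_cring "mpoly_ring R {..n}" "simplex_ring R m" g
    unfolding g_def by (rule ring_hom_cring_comp[OF ev simplex_class_hom])
  interpret c: ring_hom_cring "mpoly_ring R {..n}" "simplex_ring R n" "simplex_class n"
    by (rule simplex_class_hom)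
  have map: "simplex_map R m v (simplex_class n p) = g p" if "p \<in> carrier (mpoly_ring R {..n})" for p
    unfolding g_def by (rule simplex_map_class[OF v that])
  have "simplex_map R m v \<in> Ring.ring_hom (simplex_ring R n) (simplex_ring R m)"
  proof (rule ring_hom_memI)
    fix U assume "U \<in> carrier (simplex_ring R n)"
    then obtain p where p: "p \<in> carrier (mpoly_ring R {..n})" "U = simplex_class n p"
      by (rule simplex_ring_carrier)
    show "simplex_map R m v U \<in> carrier (simplex_ring R m)"
      unfolding p(2) map[OF p(1)] by (rule g.hom_closed[OF p(1)])
    fix V assume "V \<in> carrier (simplex_ring R n)"
    then obtain q where q: "q \<in> carrier (mpoly_ring R {..n})" "V = simplex_class n q"
      by (rule simplex_ring_carrier)
    show "simplex_map R m v (U \<otimes>\<^bsub>simplex_ring R n\<^esub> V) = simplex_map R m v U \<otimes>\<^bsub>simplex_ring R m\<^esub> simplex_map R m v V"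
      unfolding p(2) q(2) c.hom_mult[OF p(1) q(1), symmetric] map[OF p(1)] map[OF q(1)]
        map[OF P.m_closed[OF p(1) q(1)]] by (rule g.hom_mult[OF p(1) q(1)])
    show "simplex_map R m v (U \<oplus>\<^bsub>simplex_ring R n\<^esub> V) = simplex_map R m v U \<oplus>\<^bsub>simplex_ring R m\<^esub> simplex_map R m v V"
      unfolding p(2) q(2) c.hom_add[OF p(1) q(1), symmetric] map[OF p(1)] map[OF q(1)]
        map[OF P.a_closed[OF p(1) q(1)]] by (rule g.hom_add[OF p(1) q(1)])
  next
    show "simplex_map R m v \<one>\<^bsub>simplex_ring R n\<^esub> = \<one>\<^bsub>simplex_ring R m\<^esub>"
      unfolding c.hom_one[symmetric] map[OF P.one_closed] by (rule g.hom_one)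
  qed
  then show ?thesis by unfold_locales
qed

lemma indexed_const_closed: "k \<in> carrier R \<Longrightarrow> indexed_const k \<in> carrier (mpoly_ring R S)"
  by (simp add: mpoly_ring_simps indexed_pset.indexed_const)

lemma simplex_map_const:
  assumes "simplex_substitution n m v" "k \<in> carrier R"
  shows "simplex_map R m v (simplex_class n (indexed_const k)) = simplex_class m (indexed_const k)"
  unfolding simplex_map_class[OF assms(1) indexed_const_closed[OF assms(2)]]
    mpoly_evaluation.eval_const[OF mpoly_evaluation_simplex[OF assms(1)] assms(2)] ..

lemma simplex_map_var:
  assumes "simplex_substitution n m v" "j \<le> n"
  shows "simplex_map R m v (simplex_class n (indexed_var j)) = simplex_class m (v j)"
proof -
  have j: "j \<in> {..n}" using assms(2) by simp
  show ?thesis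
    unfolding simplex_map_class[OF assms(1) indexed_var_closed[OF j]]
      mpoly_evaluation.eval_var[OF mpoly_evaluation_simplex[OF assms(1)] j] ..
qed

text \<open>Elements of the quotient are represented by polynomials, so the uniqueness property is
  inherited after composing with the quotient map.\<close>

lemma simplex_hom_eqI:
  assumes f: "ring_hom_cring (simplex_ring R n) B f" and g: "ring_hom_cring (simplex_ring R n) B g"
    and const: "\<And>k. k \<in> carrier R \<Longrightarrow> f (simplex_class n (indexed_const k)) = g (simplex_class n (indexed_const k))"
    and var: "\<And>j. j \<le> n \<Longrightarrow> f (simplex_class n (indexed_var j)) = g (simplex_class n (indexed_var j))"
    and U: "U \<in> carrier (simplex_ring R n)"
  shows "f U = g U"
proof -
  obtain p where p: "p \<in> carrier (mpoly_ring R {..n})" "U = simplex_class n p"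
    using U by (rule simplex_ring_carrier)
  show ?thesis
    unfolding p(2)
    by (rule mpoly_ring_hom_eqI[OF ring_hom_cring_comp[OF simplex_class_hom f]
          ring_hom_cring_comp[OF simplex_class_hom g] const _ p(1)]) (simp_all add: var)
qed

abbreviation vertex :: "nat \<Rightarrow> nat \<Rightarrow> (nat multiset \<Rightarrow> 'a) set" where
  "vertex n j \<equiv> simplex_class n (indexed_var j)"

lemma vertex_closed: "j \<le> n \<Longrightarrow> vertex n j \<in> carrier (simplex_ring R n)"
proof -
  interpret c: ring_hom_cring "mpoly_ring R {..n}" "simplex_ring R n" "simplex_class n"
    by (rule simplex_class_hom)
  show "j \<le> n \<Longrightarrow> vertex n j \<in> carrier (simplex_ring R n)"
    by (rule c.hom_closed[OF indexed_var_closed]) simp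
qed

lemma simplex_class_zero: "simplex_class n (indexed_const \<zero>) = \<zero>\<^bsub>simplex_ring R n\<^esub>"
proof -
  interpret c: ring_hom_cring "mpoly_ring R {..n}" "simplex_ring R n" "simplex_class n"
    by (rule simplex_class_hom)
  show ?thesis using c.hom_zero by (simp only: mpoly_ring_simps)
qed

lemma simplex_class_add:
  assumes "i \<le> n" "j \<le> n"
  shows "simplex_class n (indexed_padd (indexed_var i) (indexed_var j)) = vertex n i \<oplus>\<^bsub>simplex_ring R n\<^esub> vertex n j"
proof -
  interpret c: ring_hom_cring "mpoly_ring R {..n}" "simplex_ring R n" "simplex_class n"
    by (rule simplex_class_hom)
  show ?thesis
    using c.hom_add[OF indexed_var_closed indexed_var_closed, of i j] assms by (simp add: mpoly_ring_simps(5))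
qed

lemma vertex_sum:
  "vertex 0 0 = \<one>\<^bsub>simplex_ring R 0\<^esub>"
  "vertex 1 0 \<oplus>\<^bsub>simplex_ring R 1\<^esub> vertex 1 1 = \<one>\<^bsub>simplex_ring R 1\<^esub>"
  "vertex 2 0 \<oplus>\<^bsub>simplex_ring R 2\<^esub> vertex 2 1 \<oplus>\<^bsub>simplex_ring R 2\<^esub> vertex 2 2 = \<one>\<^bsub>simplex_ring R 2\<^esub>"
proof -
  interpret A0: cring "simplex_ring R 0" by (rule cring_simplex_ring)
  interpret A1: cring "simplex_ring R 1" by (rule cring_simplex_ring)
  interpret A2: cring "simplex_ring R 2" by (rule cring_simplex_ring)
  show "vertex 0 0 = \<one>\<^bsub>simplex_ring R 0\<^esub>"
    using simplex_class_sum[of 0] vertex_closed[of 0 0] by simp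
  note One_nat_def [simp del]
  have "{..1} = {0, 1::nat}" "{..2} = {0, 1, 2::nat}" by (auto simp: One_nat_def)
  then show "vertex 1 0 \<oplus>\<^bsub>simplex_ring R 1\<^esub> vertex 1 1 = \<one>\<^bsub>simplex_ring R 1\<^esub>"
    "vertex 2 0 \<oplus>\<^bsub>simplex_ring R 2\<^esub> vertex 2 1 \<oplus>\<^bsub>simplex_ring R 2\<^esub> vertex 2 2 = \<one>\<^bsub>simplex_ring R 2\<^esub>"
    using simplex_class_sum[of 1] simplex_class_sum[of 2] vertex_closed[of 0 1] vertex_closed[of 1 1]
      vertex_closed[of 0 2] vertex_closed[of 1 2] vertex_closed[of 2 2]
    by (simp_all add: A1.finsum_insert A2.finsum_insert A2.a_assoc)
qed

end

section \<open>Faces, degeneracies and the simplicial identities up to degree two\<close>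

context cring
begin

lemma simplex_class_face:
  assumes "j \<le> m + 1" "i \<le> m + 1"
  shows "face_substitution R i j \<in> carrier (mpoly_ring R {..m})"
    and "simplex_class m (face_substitution R i j) =
      (if j < i then vertex m j else if j = i then \<zero>\<^bsub>simplex_ring R m\<^esub> else vertex m (j - 1))"
  using assms by (auto simp: face_substitution_def simplex_class_zero indexed_var_closed indexed_const_closed)

lemma simplex_class_degen:
  assumes "j \<le> m" "i \<le> m"
  shows "degen_substitution R i j \<in> carrier (mpoly_ring R {..m + 1})"
    and "simplex_class (m + 1) (degen_substitution R i j) =
      (if j < i then vertex (m + 1) j else if j = i then vertex (m + 1) i \<oplus>\<^bsub>simplex_ring R (m + 1)\<^esub> vertex (m + 1) (i + 1)
       else vertex (m + 1) (j + 1))"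
proof -
  interpret P: cring "mpoly_ring R {..m + 1}" by (rule cring_mpoly_ring)
  have "indexed_padd (indexed_var i) (indexed_var (i + 1)) \<in> carrier (mpoly_ring R {..m + 1})"
    using P.a_closed[OF indexed_var_closed indexed_var_closed, of i "i + 1"] assms by (simp add: mpoly_ring_simps(5))
  then show "degen_substitution R i j \<in> carrier (mpoly_ring R {..m + 1})"
    using assms by (auto simp: degen_substitution_def indexed_var_closed)
  show "simplex_class (m + 1) (degen_substitution R i j) =
      (if j < i then vertex (m + 1) j else if j = i then vertex (m + 1) i \<oplus>\<^bsub>simplex_ring R (m + 1)\<^esub> vertex (m + 1) (i + 1)
       else vertex (m + 1) (j + 1))"
    using assms simplex_class_add[of i "m + 1" "i + 1"] by (simp add: degen_substitution_def)
qed

lemma atMost_1: "{..1} = {0, 1::nat}" and atMost_2: "{..2} = {0, 1, 2::nat}"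
  by auto

declare One_nat_def [simp del]
declare One_nat_def [symmetric, simp]

text \<open>A face sets one coordinate to zero and renumbers the others, so the images still add up
  to the sum of all coordinates of the smaller simplex.\<close>

lemma face_substitution_ok:
  "i \<le> 1 \<Longrightarrow> simplex_substitution 1 0 (face_substitution R i)"
  "i \<le> 2 \<Longrightarrow> simplex_substitution 2 1 (face_substitution R i)"
proof -
  interpret A0: cring "simplex_ring R 0" by (rule cring_simplex_ring)
  interpret A1: cring "simplex_ring R 1" by (rule cring_simplex_ring)
  have v: "vertex 0 0 = \<one>\<^bsub>simplex_ring R 0\<^esub>" by (rule vertex_sum(1))
  have w: "vertex 1 0 \<in> carrier (simplex_ring R 1)" "vertex 1 1 \<in> carrier (simplex_ring R 1)"
    by (rule vertex_closed, simp)+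
  have f: "simplex_class 0 (face_substitution R i j) =
      (if j < i then vertex 0 j else if j = i then \<zero>\<^bsub>simplex_ring R 0\<^esub> else vertex 0 (j - 1))"
    if "j \<le> 1" "i \<le> 1" for i j
    using simplex_class_face(2)[of j 0 i] that by simp
  have c: "simplex_class 1 (face_substitution R i j) \<in> carrier (simplex_ring R 1)" if "j \<le> 2" "i \<le> 2" for i j
    using ring_hom_cring.axioms(3)[OF simplex_class_hom[of 1]] simplex_class_face(1)[of j 1 i] that
    by (auto simp: ring_hom_cring_axioms_def dest: ring_hom_closed)
  have f': "simplex_class 1 (face_substitution R i j) =
      (if j < i then vertex 1 j else if j = i then \<zero>\<^bsub>simplex_ring R 1\<^esub> else vertex 1 (j - 1))"
    if "j \<le> 2" "i \<le> 2" for i j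
    using simplex_class_face(2)[of j 1 i] that by simp
  show "simplex_substitution 1 0 (face_substitution R i)" if i: "i \<le> 1"
  proof -
    have "i = 0 \<or> i = 1" using i by arith
    then have "(\<Oplus>\<^bsub>simplex_ring R 0\<^esub>j\<in>{..1}. simplex_class 0 (face_substitution R i j)) = \<one>\<^bsub>simplex_ring R 0\<^esub>"
      unfolding atMost_1 by (elim disjE) (simp_all add: A0.finsum_insert f v)
    then show ?thesis
      using simplex_class_face(1)[of _ 0 i] i by (simp add: simplex_substitution_def)
  qed
  show "simplex_substitution 2 1 (face_substitution R i)" if i: "i \<le> 2"
  proof -
    have "i = 0 \<or> i = 1 \<or> i = 2" using i by arith
    then have "(\<Oplus>\<^bsub>simplex_ring R 1\<^esub>j\<in>{..2}. simplex_class 1 (face_substitution R i j)) =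
        vertex 1 0 \<oplus>\<^bsub>simplex_ring R 1\<^esub> vertex 1 1"
      unfolding atMost_2 using w by (elim disjE) (simp_all add: A1.finsum_insert Pi_def c, simp_all add: f')
    then show ?thesis
      using simplex_class_face(1)[of _ 1 i] i vertex_sum(2) by (simp add: simplex_substitution_def)
  qed
qed

text \<open>A degeneracy splits one coordinate into two and renumbers the others, which leaves the
  total sum unchanged.\<close>

lemma degen_substitution_ok:
  "simplex_substitution 0 1 (degen_substitution R 0)"
  "i \<le> 1 \<Longrightarrow> simplex_substitution 1 2 (degen_substitution R i)"
proof -
  interpret A1: cring "simplex_ring R 1" by (rule cring_simplex_ring)
  interpret A2: cring "simplex_ring R 2" by (rule cring_simplex_ring)
  have w: "vertex 1 0 \<in> carrier (simplex_ring R 1)" "vertex 1 1 \<in> carrier (simplex_ring R 1)"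
    by (rule vertex_closed, simp)+
  have w': "vertex 2 0 \<in> carrier (simplex_ring R 2)" "vertex 2 1 \<in> carrier (simplex_ring R 2)"
    "vertex 2 2 \<in> carrier (simplex_ring R 2)"
    by (rule vertex_closed, simp)+
  have s: "simplex_class 1 (degen_substitution R 0 0) = \<one>\<^bsub>simplex_ring R 1\<^esub>"
    using simplex_class_degen(2)[of 0 0 0] vertex_sum(2) by simp
  show "simplex_substitution 0 1 (degen_substitution R 0)"
    using simplex_class_degen(1)[of 0 0 0] s by (simp add: simplex_substitution_def)
  have d: "simplex_class 2 (degen_substitution R i j) =
      (if j < i then vertex 2 j else if j = i then vertex 2 i \<oplus>\<^bsub>simplex_ring R 2\<^esub> vertex 2 (i + 1)
       else vertex 2 (j + 1))" if "j \<le> 1" "i \<le> 1" for i j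
    using simplex_class_degen(2)[of j 1 i] that by (simp add: one_add_one)
  show "simplex_substitution 1 2 (degen_substitution R i)" if i: "i \<le> 1"
  proof -
    have "i = 0 \<or> i = 1" using i by arith
    then have "(\<Oplus>\<^bsub>simplex_ring R 2\<^esub>j\<in>{..1}. simplex_class 2 (degen_substitution R i j)) =
        vertex 2 0 \<oplus>\<^bsub>simplex_ring R 2\<^esub> vertex 2 1 \<oplus>\<^bsub>simplex_ring R 2\<^esub> vertex 2 2"
      unfolding atMost_1 using w' by (elim disjE) (simp_all add: A2.finsum_insert d A2.a_assoc)
    moreover have "degen_substitution R i j \<in> carrier (mpoly_ring R {..2})" if "j \<le> 1" for j
      using simplex_class_degen(1)[of j 1 i] i that by (simp add: one_add_one)
    ultimately show ?thesis
      using vertex_sum(3) by (simp add: simplex_substitution_def)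
  qed
qed

abbreviation "sface n i \<equiv> simplex_map R (n - 1) (face_substitution R i)"
abbreviation "sdegen n i \<equiv> simplex_map R (n + 1) (degen_substitution R i)"

text \<open>Both sides of each simplicial identity are composites of ring homomorphisms, so they
  agree once they agree on constants, which all maps preserve, and on the finitely many coordinates,
  which are checked case by case.\<close>

lemma ring_triangle_simplex:
  "ring_triangle (simplex_ring R 0) (simplex_ring R 1) (sface 1 0) (sface 1 1) (sdegen 0 0) (vertex 1 0) (vertex 1 1)
     (simplex_ring R 2) (sface 2 0) (sface 2 1) (sface 2 2) (sdegen 1 0) (sdegen 1 1)
     (vertex 2 0) (vertex 2 1) (vertex 2 2)"
proof -
  interpret A0: cring "simplex_ring R 0" by (rule cring_simplex_ring)
  interpret A1: cring "simplex_ring R 1" by (rule cring_simplex_ring)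
  interpret A2: cring "simplex_ring R 2" by (rule cring_simplex_ring)
  define d where "d i = simplex_map R 0 (face_substitution R i)" for i
  define e where "e i = simplex_map R 1 (face_substitution R i)" for i
  define s where "s = simplex_map R 1 (degen_substitution R 0)"
  define t where "t i = simplex_map R 2 (degen_substitution R i)" for i
  have eqs: "sface 1 i = d i" "sface 2 i = e i" "sdegen 0 0 = s" "sdegen 1 i = t i" for i
    by (simp_all add: d_def e_def s_def t_def)
  have dh: "ring_hom_cring (simplex_ring R 1) (simplex_ring R 0) (d i)" if "i \<le> 1" for i
    unfolding d_def by (rule simplex_map_hom[OF face_substitution_ok(1)[OF that]])
  have eh: "ring_hom_cring (simplex_ring R 2) (simplex_ring R 1) (e i)" if "i \<le> 2" for i
    unfolding e_def by (rule simplex_map_hom[OF face_substitution_ok(2)[OF that]])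
  have sh: "ring_hom_cring (simplex_ring R 0) (simplex_ring R 1) s"
    unfolding s_def by (rule simplex_map_hom[OF degen_substitution_ok(1)])
  have th: "ring_hom_cring (simplex_ring R 1) (simplex_ring R 2) (t i)" if "i \<le> 1" for i
    unfolding t_def by (rule simplex_map_hom[OF degen_substitution_ok(2)[OF that]])
  have dv: "d i (vertex 1 j) = (if j < i then vertex 0 j else if j = i then \<zero>\<^bsub>simplex_ring R 0\<^esub> else vertex 0 (j - 1))"
    if "j \<le> 1" "i \<le> 1" for i j
    unfolding d_def simplex_map_var[OF face_substitution_ok(1)[OF that(2)] that(1)]
    using simplex_class_face(2)[of j 0 i] that by simp
  have ev: "e i (vertex 2 j) = (if j < i then vertex 1 j else if j = i then \<zero>\<^bsub>simplex_ring R 1\<^esub> else vertex 1 (j - 1))"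
    if "j \<le> 2" "i \<le> 2" for i j
    unfolding e_def simplex_map_var[OF face_substitution_ok(2)[OF that(2)] that(1)]
    using simplex_class_face(2)[of j 1 i] that by simp
  have sv: "s (vertex 0 0) = vertex 1 0 \<oplus>\<^bsub>simplex_ring R 1\<^esub> vertex 1 1"
    unfolding s_def simplex_map_var[OF degen_substitution_ok(1) le_refl]
    using simplex_class_degen(2)[of 0 0 0] by simp
  have tv: "t i (vertex 1 j) = (if j < i then vertex 2 j else if j = i then vertex 2 i \<oplus>\<^bsub>simplex_ring R 2\<^esub> vertex 2 (i + 1)
       else vertex 2 (j + 1))" if "j \<le> 1" "i \<le> 1" for i j
    unfolding t_def simplex_map_var[OF degen_substitution_ok(2)[OF that(2)] that(1)]
    using simplex_class_degen(2)[of j 1 i] that by (simp add: one_add_one)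
  have dk: "d i (simplex_class 1 (indexed_const k)) = simplex_class 0 (indexed_const k)"
    if "i \<le> 1" "k \<in> carrier R" for i k
    unfolding d_def by (rule simplex_map_const[OF face_substitution_ok(1)[OF that(1)] that(2)])
  have ek: "e i (simplex_class 2 (indexed_const k)) = simplex_class 1 (indexed_const k)"
    if "i \<le> 2" "k \<in> carrier R" for i k
    unfolding e_def by (rule simplex_map_const[OF face_substitution_ok(2)[OF that(1)] that(2)])
  have sk: "s (simplex_class 0 (indexed_const k)) = simplex_class 1 (indexed_const k)"
    if "k \<in> carrier R" for k
    unfolding s_def by (rule simplex_map_const[OF degen_substitution_ok(1) that])
  have tk: "t i (simplex_class 1 (indexed_const k)) = simplex_class 2 (indexed_const k)"
    if "i \<le> 1" "k \<in> carrier R" for i k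
    unfolding t_def by (rule simplex_map_const[OF degen_substitution_ok(2)[OF that(1)] that(2)])
  interpret d0: ring_hom_cring "simplex_ring R 1" "simplex_ring R 0" "d 0" by (rule dh) simp
  interpret d1: ring_hom_cring "simplex_ring R 1" "simplex_ring R 0" "d 1" by (rule dh) simp
  interpret e0: ring_hom_cring "simplex_ring R 2" "simplex_ring R 1" "e 0" by (rule eh) simp
  interpret e1: ring_hom_cring "simplex_ring R 2" "simplex_ring R 1" "e 1" by (rule eh) simp
  interpret e2: ring_hom_cring "simplex_ring R 2" "simplex_ring R 1" "e 2" by (rule eh) simp
  interpret s: ring_hom_cring "simplex_ring R 0" "simplex_ring R 1" s by (rule sh)
  interpret t0: ring_hom_cring "simplex_ring R 1" "simplex_ring R 2" "t 0" by (rule th) simp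
  interpret t1: ring_hom_cring "simplex_ring R 1" "simplex_ring R 2" "t 1" by (rule th) simp
  have w: "vertex 0 0 \<in> carrier (simplex_ring R 0)"
    "vertex 1 0 \<in> carrier (simplex_ring R 1)" "vertex 1 1 \<in> carrier (simplex_ring R 1)"
    "vertex 2 0 \<in> carrier (simplex_ring R 2)" "vertex 2 1 \<in> carrier (simplex_ring R 2)"
    "vertex 2 2 \<in> carrier (simplex_ring R 2)"
    by (rule vertex_closed, simp)+
  have j01: "j = 0 \<or> j = 1" if "j \<le> 1" for j :: nat using that by arith
  note hom_simps = dv ev sv tv dk ek sk tk w
  have ds: "d i (s a) = a" if "i \<le> 1" "a \<in> carrier (simplex_ring R 0)" for i a
  proof -
    have "\<And>j. j \<le> 0 \<Longrightarrow> d i (s (vertex 0 j)) = vertex 0 j"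
      using j01[OF that(1)] by (elim disjE) (simp_all add: hom_simps)
    then show ?thesis
      using simplex_hom_eqI[OF ring_hom_cring_comp[OF sh dh[OF that(1)]] ring_hom_cring_id[OF cring_simplex_ring], of a] that
      by (simp add: sk dk)
  qed
  have et: "e i (t j b) = b" if ij: "i \<le> 2" "j \<le> 1" "i = j \<or> i = j + 1" and b: "b \<in> carrier (simplex_ring R 1)" for i j b
  proof -
    have cases: "(i = 0 \<and> j = 0) \<or> (i = 1 \<and> j = 0) \<or> (i = 1 \<and> j = 1) \<or> (i = 2 \<and> j = 1)"
      using ij by arith
    have "e i (t j (vertex 1 l)) = vertex 1 l" if "l \<le> 1" for l
      using cases j01[OF that] by (elim disjE conjE) (simp_all add: hom_simps)
    then show ?thesis
      using simplex_hom_eqI[OF ring_hom_cring_comp[OF th[OF ij(2)] eh[OF ij(1)]] ring_hom_cring_id[OF cring_simplex_ring], of b] ij b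
      by (simp add: tk ek)
  qed
  have es: "e 0 (t 1 b) = s (d 0 b)" "e 2 (t 0 b) = s (d 1 b)" if b: "b \<in> carrier (simplex_ring R 1)" for b
  proof -
    have "e 0 (t 1 (vertex 1 l)) = s (d 0 (vertex 1 l))" if "l \<le> 1" for l
      using j01[OF that] by (elim disjE) (simp_all add: hom_simps)
    then show "e 0 (t 1 b) = s (d 0 b)"
      using simplex_hom_eqI[OF ring_hom_cring_comp[OF th eh, of 1 0] ring_hom_cring_comp[OF dh sh, of 0], of b] b
      by (simp add: tk ek sk dk)
    have "e 2 (t 0 (vertex 1 l)) = s (d 1 (vertex 1 l))" if "l \<le> 1" for l
      using j01[OF that] by (elim disjE) (simp_all add: hom_simps)
    then show "e 2 (t 0 b) = s (d 1 b)"
      using simplex_hom_eqI[OF ring_hom_cring_comp[OF th eh, of 0 2] ring_hom_cring_comp[OF dh sh, of 1], of b] b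
      by (simp add: tk ek sk dk)
  qed
  show ?thesis
    unfolding eqs
    by unfold_locales
      (use d0.homh d1.homh s.homh e0.homh e1.homh e2.homh t0.homh t1.homh in
        \<open>simp_all add: ds et es hom_simps vertex_sum(1,2)\<close>)
qed

end

section \<open>Homotopy groups of the elementary and the Steinberg group\<close>

lemma (in cring) ring_interval_simplex:
  "ring_interval (simplex_ring R 0) (simplex_ring R 1) (sface 1 0) (sface 1 1) (sdegen 0 0) (vertex 1 0) (vertex 1 1)"
  using ring_triangle_simplex by (rule ring_triangle.axioms(1))

text \<open>The quotient consists of the relation images of single spheres. If any two spheres are
  related, each such image is the set of all spheres; the given sphere makes the quotient
  nonempty.\<close>

lemma is_singleton_homotopy_set:
  assumes "x\<^sub>0 \<in> spheres S n"
    and fill: "\<And>x y. x \<in> spheres S n \<Longrightarrow> y \<in> spheres S n \<Longrightarrow> \<exists>z\<in>carrier (level S (n + 1)).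
      (\<forall>i<n. face S (n + 1) i z = \<one>\<^bsub>level S n\<^esub>) \<and> face S (n + 1) n z = x \<and> face S (n + 1) (n + 1) z = y"
  shows "is_singleton (homotopy_set S n)"
proof -
  have img: "homotopy_rel S n `` {x} = spheres S n" if x: "x \<in> spheres S n" for x
  proof (intro subset_antisym subsetI)
    fix y assume y: "y \<in> spheres S n"
    show "y \<in> homotopy_rel S n `` {x}"
      unfolding homotopy_rel_def Image_singleton mem_Collect_eq case_prod_conv
      by (intro conjI x y fill)
  qed (auto simp: homotopy_rel_def)
  have "homotopy_set S n = {spheres S n}"
    unfolding homotopy_set_def quotient_def using assms(1) by (auto simp: img)
  then show ?thesis by (simp only: is_singletonI)
qed

section \<open>Homotopy classes of vertices and loops in the simplicial Steinberg group\<close>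

context steinberg_data
begin

text \<open>Two loops are joined directly by one triangle, without proving that homotopy is an
  equivalence relation. Fillers with \<open>u\<close> or \<open>w\<close> as middle face and trivial
  outer faces are combined with the degenerate triangle \<open>word_map s1 w\<close>.\<close>

lemma st_loops_homotopic:
  assumes T: "ring_triangle A0 A1 d0 d1 s t0 t1 A2 e0 e1 e2 s0 s1 u0 u1 u2"
    and rank: "root_rank \<Phi> \<noteq> 1"
    and u: "u \<in> st_words A1" "st_eqv A0 (word_map d0 u) []" "st_eqv A0 (word_map d1 u) []"
    and w: "w \<in> st_words A1" "st_eqv A0 (word_map d0 w) []" "st_eqv A0 (word_map d1 w) []"
  shows "\<exists>z\<in>st_words A2. st_eqv A1 (word_map e0 z) [] \<and> st_eqv A1 (word_map e1 z) u \<and> st_eqv A1 (word_map e2 z) w"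
proof -
  interpret ring_triangle A0 A1 d0 d1 s t0 t1 A2 e0 e1 e2 s0 s1 u0 u1 u2 by fact
  interpret S1: presentation "steinberg_generators \<Phi> A1" "steinberg_relations \<Phi> ord N A1"
    by (rule presentation_st) (rule A1.cring_axioms)
  interpret S2: presentation "steinberg_generators \<Phi> A2" "steinberg_relations \<Phi> ord N A2"
    by (rule presentation_st) (rule A2.cring_axioms)
  obtain z where z: "z \<in> st_words A2" "st_eqv A1 (word_map e0 z) []" "st_eqv A1 (word_map e1 z) u"
    "st_eqv A1 (word_map e2 z) []"
    using st_loop_fill[OF T rank u] by (elim bexE conjE)
  obtain y where y: "y \<in> st_words A2" "st_eqv A1 (word_map e0 y) []" "st_eqv A1 (word_map e1 y) w"
    "st_eqv A1 (word_map e2 y) []"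
    using st_loop_fill[OF T rank w] by (elim bexE conjE)
  define x where "x = word_map s1 w"
  have x: "x \<in> st_words A2" unfolding x_def by (rule word_map_words[OF s1.hom_closed w(1)])
  have "word_map e0 x = word_map s (word_map d0 w)"
    unfolding x_def word_map_word_map by (rule word_map_cong[OF e_s(5) w(1)])
  moreover have "st_eqv A1 (word_map s (word_map d0 w)) []"
    using word_map_hom_eqv[OF A0.cring_axioms A1.cring_axioms s_hom w(2)] by simp
  ultimately have x0: "st_eqv A1 (word_map e0 x) []" by simp
  have "word_map e1 x = word_map (\<lambda>a. a) w"
    unfolding x_def word_map_word_map by (rule word_map_cong[OF e_s(3) w(1)])
  then have x1: "word_map e1 x = w" by (simp only: word_map_id)
  have "word_map e2 x = word_map (\<lambda>a. a) w"
    unfolding x_def word_map_word_map by (rule word_map_cong[OF e_s(4) w(1)])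
  then have x2: "word_map e2 x = w" by (simp only: word_map_id)
  have ww: "st_eqv A1 w w" by (rule presentation_eq.refl[OF w(1)])
  have uu: "st_eqv A1 u u" by (rule presentation_eq.refl[OF u(1)])
  \<comment> \<open>The faces in the order \<open>e0\<close>, \<open>e1\<close>, \<open>e2\<close>
    are (1, u, 1) for \<open>z\<close>, (1, w, 1) for \<open>y\<close> and (1, w, w) for the
    degenerate \<open>x\<close>. The product therefore has faces 1, u w^-1 w and w.\<close>
  let ?Z = "z @ inverse_word y @ x"
  have "st_eqv A1 (word_map e0 ?Z) []"
    unfolding word_map_simps(2,5)
    by (rule S1.eqv_append_Nil(1)[OF z(2) S1.eqv_append_Nil(1)[OF S1.eqv_inverse_Nil[OF y(2)] x0]])
  moreover have "st_eqv A1 (word_map e1 ?Z) (u @ inverse_word w @ w)"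
    unfolding word_map_simps(2,5) x1
    by (rule presentation_eq.append[OF z(3) presentation_eq.append[OF S1.eqv_inverse_word[OF y(3)] ww]])
  then have "st_eqv A1 (word_map e1 ?Z) u"
    by (rule presentation_eq.trans[OF _ S1.eqv_append_Nil(2)[OF S1.inverse_word_append[OF w(1)] uu]])
  moreover have "st_eqv A1 (word_map e2 ?Z) w"
    unfolding word_map_simps(2,5) x2
    by (rule S1.eqv_append_Nil(1)[OF z(4) S1.eqv_append_Nil(1)[OF S1.eqv_inverse_Nil[OF y(4)] ww]])
  moreover have "?Z \<in> st_words A2"
    using z(1) S2.inverse_word_words[OF y(1)] x by (simp only: append_in_lists_conv)
  ultimately show ?thesis by (intro bexI[of _ ?Z] conjI)
qed

lemma simplicial_steinberg_simps:
  "level (simplicial_steinberg_group \<Phi> ord N R) n = steinberg_group \<Phi> ord N (simplex_ring R n)"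
  "face (simplicial_steinberg_group \<Phi> ord N R) n i =
     steinberg_map \<Phi> ord N (simplex_ring R n) (simplex_ring R (n - 1)) (simplex_map R (n - 1) (face_substitution R i))"
  by (simp_all add: simplicial_steinberg_group_def apply_functor_def standard_simplicial_ring_def)

lemma steinberg_pi0:
  assumes "cring R"
  shows "is_singleton (homotopy_set (simplicial_steinberg_group \<Phi> ord N R) 0)"
proof -
  interpret R: cring R by fact
  let ?S = "simplicial_steinberg_group \<Phi> ord N R"
  note I = R.ring_interval_simplex
  interpret ring_interval "simplex_ring R 0" "simplex_ring R 1" "R.sface 1 0" "R.sface 1 1" "R.sdegen 0 0"
    "R.vertex 1 0" "R.vertex 1 1" by (rule I)
  have sph: "spheres ?S 0 = st_cls (simplex_ring R 0) ` st_words (simplex_ring R 0)"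
    by (simp add: spheres_def simplicial_steinberg_simps steinberg_group_simps)
  show ?thesis
  proof (rule is_singleton_homotopy_set)
    show "st_cls (simplex_ring R 0) [] \<in> spheres ?S 0" unfolding sph by (rule imageI) simp
    fix x y assume "x \<in> spheres ?S 0" "y \<in> spheres ?S 0"
    then obtain u v where u: "u \<in> st_words (simplex_ring R 0)" "x = st_cls (simplex_ring R 0) u"
      and v: "v \<in> st_words (simplex_ring R 0)" "y = st_cls (simplex_ring R 0) v"
      unfolding sph by (elim imageE)
    obtain z where z: "z \<in> st_words (simplex_ring R 1)" "st_eqv (simplex_ring R 0) (word_map (R.sface 1 0) z) u"
      "st_eqv (simplex_ring R 0) (word_map (R.sface 1 1) z) v"
      using st_words_connected[OF I u(1) v(1)] by (elim bexE conjE)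
    have "face ?S (0 + 1) 0 (st_cls (simplex_ring R 1) z) = x"
      unfolding simplicial_steinberg_simps add_0 diff_self_eq_0 u(2)
      using steinberg_map_cls[OF A1.cring_axioms A0.cring_axioms d0_hom z(1)]
        presentation.cls_eqI[OF presentation_st[OF A0.cring_axioms] z(2)] by simp
    moreover have "face ?S (0 + 1) (0 + 1) (st_cls (simplex_ring R 1) z) = y"
      unfolding simplicial_steinberg_simps add_0 diff_self_eq_0 v(2)
      using steinberg_map_cls[OF A1.cring_axioms A0.cring_axioms d1_hom z(1)]
        presentation.cls_eqI[OF presentation_st[OF A0.cring_axioms] z(3)] by simp
    moreover have "st_cls (simplex_ring R 1) z \<in> carrier (level ?S (0 + 1))"
      unfolding simplicial_steinberg_simps steinberg_group_simps add_0 by (rule imageI[OF z(1)])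
    ultimately show "\<exists>z\<in>carrier (level ?S (0 + 1)). (\<forall>i<0. face ?S (0 + 1) i z = \<one>\<^bsub>level ?S 0\<^esub>) \<and>
        face ?S (0 + 1) 0 z = x \<and> face ?S (0 + 1) (0 + 1) z = y"
      by (intro bexI[of _ "st_cls (simplex_ring R 1) z"] conjI) simp_all
  qed
qed

lemma steinberg_pi1:
  assumes "cring R" and rank: "root_rank \<Phi> \<noteq> 1"
  shows "is_singleton (homotopy_set (simplicial_steinberg_group \<Phi> ord N R) 1)"
proof -
  interpret R: cring R by fact
  let ?S = "simplicial_steinberg_group \<Phi> ord N R"
  note T = R.ring_triangle_simplex
  interpret ring_triangle "simplex_ring R 0" "simplex_ring R 1" "R.sface 1 0" "R.sface 1 1" "R.sdegen 0 0"
    "R.vertex 1 0" "R.vertex 1 1" "simplex_ring R 2" "R.sface 2 0" "R.sface 2 1" "R.sface 2 2"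
    "R.sdegen 1 0" "R.sdegen 1 1" "R.vertex 2 0" "R.vertex 2 1" "R.vertex 2 2" by (rule T)
  note P0 = presentation_st[OF A0.cring_axioms] and P1 = presentation_st[OF A1.cring_axioms]
  have nil: "[] \<in> st_words (simplex_ring R 0)" "[] \<in> st_words (simplex_ring R 1)" by simp_all
  have f1: "face ?S 1 0 (st_cls (simplex_ring R 1) w) = st_cls (simplex_ring R 0) (word_map (R.sface 1 0) w)"
    "face ?S 1 1 (st_cls (simplex_ring R 1) w) = st_cls (simplex_ring R 0) (word_map (R.sface 1 1) w)"
    if w: "w \<in> st_words (simplex_ring R 1)" for w
    using steinberg_map_cls[OF A1.cring_axioms A0.cring_axioms d0_hom w]
      steinberg_map_cls[OF A1.cring_axioms A0.cring_axioms d1_hom w]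
    unfolding simplicial_steinberg_simps diff_self_eq_0 by simp_all
  have f2: "face ?S 2 0 (st_cls (simplex_ring R 2) w) = st_cls (simplex_ring R 1) (word_map (R.sface 2 0) w)"
    "face ?S 2 1 (st_cls (simplex_ring R 2) w) = st_cls (simplex_ring R 1) (word_map (R.sface 2 1) w)"
    "face ?S 2 2 (st_cls (simplex_ring R 2) w) = st_cls (simplex_ring R 1) (word_map (R.sface 2 2) w)"
    if w: "w \<in> st_words (simplex_ring R 2)" for w
    using steinberg_map_cls[OF A2.cring_axioms A1.cring_axioms e0_hom w]
      steinberg_map_cls[OF A2.cring_axioms A1.cring_axioms e1_hom w]
      steinberg_map_cls[OF A2.cring_axioms A1.cring_axioms e2_hom w]
    unfolding simplicial_steinberg_simps by simp_all
  \<comment> \<open>Loops are translated to words: a class with trivial faces is the class of a word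
    whose two end words are derivably trivial, and these two derivations are what the filling
    argument consumes.\<close>
  have sph: "x \<in> spheres ?S 1 \<longleftrightarrow> (\<exists>w\<in>st_words (simplex_ring R 1). x = st_cls (simplex_ring R 1) w \<and>
      st_eqv (simplex_ring R 0) (word_map (R.sface 1 0) w) [] \<and>
      st_eqv (simplex_ring R 0) (word_map (R.sface 1 1) w) [])" for x
  proof -
    have "x \<in> spheres ?S 1 \<longleftrightarrow> x \<in> st_cls (simplex_ring R 1) ` st_words (simplex_ring R 1) \<and>
        face ?S 1 0 x = st_cls (simplex_ring R 0) [] \<and> face ?S 1 1 x = st_cls (simplex_ring R 0) []"
    proof -
      have "(\<forall>i\<le>1. Q i) \<longleftrightarrow> Q 0 \<and> Q (1::nat)" for Q
        by (auto simp: le_Suc_eq One_nat_def simp del: One_nat_def[symmetric])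
      then show ?thesis
        by (simp add: spheres_def simplicial_steinberg_simps(1) steinberg_group_simps)
    qed
    also have "\<dots> \<longleftrightarrow> (\<exists>w\<in>st_words (simplex_ring R 1). x = st_cls (simplex_ring R 1) w \<and>
      face ?S 1 0 (st_cls (simplex_ring R 1) w) = st_cls (simplex_ring R 0) [] \<and>
      face ?S 1 1 (st_cls (simplex_ring R 1) w) = st_cls (simplex_ring R 0) [])"
      by blast
    also have "\<dots> \<longleftrightarrow> (\<exists>w\<in>st_words (simplex_ring R 1). x = st_cls (simplex_ring R 1) w \<and>
      st_eqv (simplex_ring R 0) (word_map (R.sface 1 0) w) [] \<and>
      st_eqv (simplex_ring R 0) (word_map (R.sface 1 1) w) [])"
      by (rule bex_cong[OF HOL.refl]) (simp only: f1 presentation.cls_eq_iff[OF P0 nil(1)])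
    finally show ?thesis .
  qed
  show ?thesis
  proof (rule is_singleton_homotopy_set)
    show "st_cls (simplex_ring R 1) [] \<in> spheres ?S 1"
      unfolding sph by (intro bexI[OF _ nil(2)] conjI HOL.refl) (simp_all add: presentation_eq.refl)
    fix x y assume "x \<in> spheres ?S 1" "y \<in> spheres ?S 1"
    then obtain u w where u: "u \<in> st_words (simplex_ring R 1)" "x = st_cls (simplex_ring R 1) u"
        "st_eqv (simplex_ring R 0) (word_map (R.sface 1 0) u) []"
        "st_eqv (simplex_ring R 0) (word_map (R.sface 1 1) u) []"
      and w: "w \<in> st_words (simplex_ring R 1)" "y = st_cls (simplex_ring R 1) w"
        "st_eqv (simplex_ring R 0) (word_map (R.sface 1 0) w) []"
        "st_eqv (simplex_ring R 0) (word_map (R.sface 1 1) w) []"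
      unfolding sph by (elim bexE conjE)
    obtain z where z: "z \<in> st_words (simplex_ring R 2)"
      "st_eqv (simplex_ring R 1) (word_map (R.sface 2 0) z) []"
      "st_eqv (simplex_ring R 1) (word_map (R.sface 2 1) z) u"
      "st_eqv (simplex_ring R 1) (word_map (R.sface 2 2) z) w"
      using st_loops_homotopic[OF T rank u(1,3,4) w(1,3,4)] by (elim bexE conjE)
    have two: "1 + 1 = (2::nat)" by simp
    have "face ?S 2 0 (st_cls (simplex_ring R 2) z) = \<one>\<^bsub>level ?S 1\<^esub>"
      unfolding f2[OF z(1)] simplicial_steinberg_simps(1) steinberg_group_simps(2)
      by (rule presentation.cls_eqI[OF P1 z(2)])
    moreover have "face ?S 2 1 (st_cls (simplex_ring R 2) z) = x"
      unfolding f2[OF z(1)] u(2) by (rule presentation.cls_eqI[OF P1 z(3)])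
    moreover have "face ?S 2 2 (st_cls (simplex_ring R 2) z) = y"
      unfolding f2[OF z(1)] w(2) by (rule presentation.cls_eqI[OF P1 z(4)])
    moreover have "st_cls (simplex_ring R 2) z \<in> carrier (level ?S 2)"
      unfolding simplicial_steinberg_simps steinberg_group_simps by (rule imageI[OF z(1)])
    ultimately show "\<exists>z\<in>carrier (level ?S (1 + 1)). (\<forall>i<1. face ?S (1 + 1) i z = \<one>\<^bsub>level ?S 1\<^esub>) \<and>
        face ?S (1 + 1) 1 z = x \<and> face ?S (1 + 1) (1 + 1) z = y"
      unfolding two by (intro bexI[of _ "st_cls (simplex_ring R 2) z"] conjI) simp_all
  qed
qed

end

lemma (in admissible_root_vectors) elementary_pi0:
  assumes "cring R"
  shows "is_singleton (homotopy_set (simplicial_elementary_group \<Phi> n e R) 0)"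
proof -
  interpret R: cring R by fact
  let ?S = "simplicial_elementary_group \<Phi> n e R"
  have level: "level ?S k = elementary_group \<Phi> n e (simplex_ring R k)" for k
    by (simp add: simplicial_elementary_group_def apply_functor_def standard_simplicial_ring_def)
  have face: "face ?S k i = map_mat (simplex_map R (k - 1) (face_substitution R i))" for k i
    by (intro ext) (simp add: simplicial_elementary_group_def apply_functor_def standard_simplicial_ring_def
        elementary_map_def)
  have sph: "spheres ?S 0 = carrier (elementary_group \<Phi> n e (simplex_ring R 0))"
    by (simp add: spheres_def level)
  show ?thesis
  proof (rule is_singleton_homotopy_set)
    show "\<one>\<^bsub>matrix_monoid (simplex_ring R 0) n\<^esub> \<in> spheres ?S 0"
      unfolding sph by (rule elementary_group_intros(1)[OF R.cring_simplex_ring])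
    fix x y assume "x \<in> spheres ?S 0" "y \<in> spheres ?S 0"
    then obtain z where "z \<in> carrier (elementary_group \<Phi> n e (simplex_ring R 1))"
      "map_mat (R.sface 1 0) z = x" "map_mat (R.sface 1 1) z = y"
      using elementary_connected[OF R.ring_interval_simplex] unfolding sph by metis
    then show "\<exists>z\<in>carrier (level ?S (0 + 1)). (\<forall>i<0. face ?S (0 + 1) i z = \<one>\<^bsub>level ?S 0\<^esub>) \<and>
        face ?S (0 + 1) 0 z = x \<and> face ?S (0 + 1) (0 + 1) z = y"
      unfolding level face add_0 by (intro bexI[of _ z] conjI) simp_all
  qed
qed

theorem proposition3p5:
  fixes \<Phi> \<Lambda> :: "'v::euclidean_space set"
    and R :: "('a, 'm) ring_scheme"
    and n :: nat
    and e :: "'v \<Rightarrow> int mat"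
    and ord :: "'v \<Rightarrow> 'v \<Rightarrow> (nat \<times> nat) list"
    and N :: "'v \<Rightarrow> 'v \<Rightarrow> nat \<Rightarrow> nat \<Rightarrow> int"
  assumes "irreducible_root_system \<Phi>"
    and "additive_subgroup_of_space \<Lambda>"
    and "root_lattice \<Phi> \<subseteq> \<Lambda>" and "\<Lambda> \<subseteq> weight_lattice \<Phi>"
    and "chevalley_representation \<Phi> \<Lambda> n e"
    and "commutator_order \<Phi> ord"
    and "structure_constants \<Phi> n e ord N"
    and "cring R"
  shows "simplicially_connected (simplicial_elementary_group \<Phi> n e R) \<and>
         simplicially_connected (simplicial_steinberg_group \<Phi> ord N R) \<and>
         (2 \<le> root_rank \<Phi> \<longrightarrow>
            simplicially_simply_connected (simplicial_steinberg_group \<Phi> ord N R))"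
proof -
  have root: "root_system \<Phi>" using assms(1) by (simp add: irreducible_root_system_def)
  have neg: "- \<alpha> \<in> \<Phi>" if \<alpha>: "\<alpha> \<in> \<Phi>" for \<alpha>
  proof -
    have "\<alpha> \<noteq> 0" using root \<alpha> by (auto simp: root_system_def)
    then have "coroot_pairing \<alpha> \<alpha> = 2" by (simp add: coroot_pairing_def)
    \<comment> \<open>The reflection in \<alpha> applied to \<alpha> itself gives the opposite
      root.\<close>
    moreover have "\<alpha> - coroot_pairing \<alpha> \<alpha> *\<^sub>R \<alpha> \<in> \<Phi>" using root \<alpha> by (simp add: root_system_def)
    moreover have "\<alpha> - 2 *\<^sub>R \<alpha> = - \<alpha>" by (simp add: scaleR_2)
    ultimately show ?thesis by simp
  qed
  interpret steinberg_data \<Phi> ord N by (rule steinberg_data.intro[OF neg assms(6)])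
  interpret admissible_root_vectors \<Phi> n e
    using assms(5) unfolding chevalley_representation_def
    by (intro admissible_root_vectors.intro divided_powers.intro) blast+
  show ?thesis
    unfolding simplicially_connected_def simplicially_simply_connected_def
    using elementary_pi0[OF assms(8)] steinberg_pi0[OF assms(8)] steinberg_pi1[OF assms(8)] by simp
qed

end
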